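(* Let $0\le s\le d$ and let $\Gamma$ be a graph that is not generically globally rigid in $\mathbb S^d$. Suppose $\Gamma$ has a subgraph $\Gamma_0$ (vertex set $\mathcal V_0\subseteq\mathcal V$, edge set $\mathcal E_0\subseteq\mathcal E$) with at least $d+1$ vertices that is generically globally rigid in $\mathbb S^d$ (equivalently, in $\mathbb E^d$). Then $\Gamma$ is generically globally flexible in $\mathbb S^d$, i.e. every generic framework of $\Gamma$ in $\mathbb S^d$ is globally flexible.
   Context: For a fixed integer $0\le s\le d$, $\mathbb S^d$ denotes $\mathbb R^d$ with squared length $|w|^2=-\sum_{i=1}^s w_i^2+\sum_{i=s+1}^d w_i^2$; $\mathbb E^d$ is the case $s=0$. A graph $\Gamma$ has vertex set $\mathcal V$ and edge set $\mathcal E$. A framework of $\Gamma$ in $\mathbb S^d$ is a map $\rho:\mathcal V\to\mathbb R^d$. Frameworks $\rho,\sigma$ are equivalent if $|\rho(t)-\rho(u)|^2=|\sigma(t)-\sigma(u)|^2$ for all edges $\{t,u\}$, and congruent if this holds for all pairs of vertices. A framework is globally rigid if every equivalent framework is congruent to it, and globally flexible otherwise. A framework is generic if its coordinates satisfy no nonzero polynomial equation with rational coefficients. $\Gamma$ is generically globally rigid (resp. generically globally flexible) in $\mathbb S^d$ if all generic frameworks of $\Gamma$ in $\mathbb S^d$ are globally rigid (resp. globally flexible). *)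

theory Defs
  imports Complex_Main
begin

text \<open>A framework in d-space is a map from vertices to coordinate functions
  nat => real; only the coordinates 0..d-1 are meaningful.
  Pseudo-Euclidean squared length in S^d with s negative signs.\<close>

definition sqlen :: "nat \<Rightarrow> nat \<Rightarrow> (nat \<Rightarrow> real) \<Rightarrow> real" where
  "sqlen s d w = - (\<Sum>i<s. (w i)^2) + (\<Sum>i\<in>{s..<d}. (w i)^2)"

definition diffv :: "(nat \<Rightarrow> real) \<Rightarrow> (nat \<Rightarrow> real) \<Rightarrow> (nat \<Rightarrow> real)" where
  "diffv x y = (\<lambda>i. x i - y i)"

definition is_graph :: "'v set \<Rightarrow> 'v set set \<Rightarrow> bool" where
  "is_graph V E \<longleftrightarrow> finite V \<and> (\<forall>e\<in>E. e \<subseteq> V \<and> card e = 2)"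

definition equivalent_fw ::
  "nat \<Rightarrow> nat \<Rightarrow> 'v set set \<Rightarrow> ('v \<Rightarrow> nat \<Rightarrow> real) \<Rightarrow> ('v \<Rightarrow> nat \<Rightarrow> real) \<Rightarrow> bool" where
  "equivalent_fw s d E \<rho> \<sigma> \<longleftrightarrow>
     (\<forall>t u. {t, u} \<in> E \<longrightarrow> sqlen s d (diffv (\<rho> t) (\<rho> u)) = sqlen s d (diffv (\<sigma> t) (\<sigma> u)))"

definition congruent_fw ::
  "nat \<Rightarrow> nat \<Rightarrow> 'v set \<Rightarrow> ('v \<Rightarrow> nat \<Rightarrow> real) \<Rightarrow> ('v \<Rightarrow> nat \<Rightarrow> real) \<Rightarrow> bool" where
  "congruent_fw s d V \<rho> \<sigma> \<longleftrightarrow>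
     (\<forall>t\<in>V. \<forall>u\<in>V. sqlen s d (diffv (\<rho> t) (\<rho> u)) = sqlen s d (diffv (\<sigma> t) (\<sigma> u)))"

definition globally_rigid ::
  "nat \<Rightarrow> nat \<Rightarrow> 'v set \<Rightarrow> 'v set set \<Rightarrow> ('v \<Rightarrow> nat \<Rightarrow> real) \<Rightarrow> bool" where
  "globally_rigid s d V E \<rho> \<longleftrightarrow>
     (\<forall>\<sigma>. equivalent_fw s d E \<rho> \<sigma> \<longrightarrow> congruent_fw s d V \<rho> \<sigma>)"

definition globally_flexible ::
  "nat \<Rightarrow> nat \<Rightarrow> 'v set \<Rightarrow> 'v set set \<Rightarrow> ('v \<Rightarrow> nat \<Rightarrow> real) \<Rightarrow> bool" where
  "globally_flexible s d V E \<rho> \<longleftrightarrow> \<not> globally_rigid s d V E \<rho>"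

text \<open>Genericity: the coordinates \<rho> v i (v in V, i < d) satisfy no nonzero polynomial
  equation with rational coefficients. A polynomial is given by a finite set M of
  monomials (exponent vectors supported on the variables V x {..<d}) and rational
  coefficients c.\<close>
definition generic_fw :: "'v set \<Rightarrow> nat \<Rightarrow> ('v \<Rightarrow> nat \<Rightarrow> real) \<Rightarrow> bool" where
  "generic_fw V d \<rho> \<longleftrightarrow>
     (\<forall>(M :: ('v \<times> nat \<Rightarrow> nat) set) (c :: ('v \<times> nat \<Rightarrow> nat) \<Rightarrow> rat).
        finite M \<longrightarrow> (\<forall>m\<in>M. \<forall>x. x \<notin> V \<times> {..<d} \<longrightarrow> m x = 0) \<longrightarrow>
        (\<Sum>m\<in>M. of_rat (c m) * (\<Prod>x\<in>V \<times> {..<d}. (\<rho> (fst x) (snd x)) ^ m x)) = (0::real) \<longrightarrow>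
        (\<forall>m\<in>M. c m = 0))"

definition gen_globally_rigid :: "nat \<Rightarrow> nat \<Rightarrow> 'v set \<Rightarrow> 'v set set \<Rightarrow> bool" where
  "gen_globally_rigid s d V E \<longleftrightarrow> (\<forall>\<rho>. generic_fw V d \<rho> \<longrightarrow> globally_rigid s d V E \<rho>)"

definition gen_globally_flexible :: "nat \<Rightarrow> nat \<Rightarrow> 'v set \<Rightarrow> 'v set set \<Rightarrow> bool" where
  "gen_globally_flexible s d V E \<longleftrightarrow> (\<forall>\<rho>. generic_fw V d \<rho> \<longrightarrow> globally_flexible s d V E \<rho>)"

end

theory Submission
  imports Defs "HOL-Computational_Algebra.Fundamental_Theorem_Algebra" "HOL-Analysis.Continuum_Not_Denumerable"
begin

text \<open>
  Multiplying the first \<open>s\<close> coordinates by the imaginary unit turns the signature into complex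
  conjugations of one and the same complex problem: the squared length becomes a sum of squares.
  Pin \<open>d + 1\<close> vertices of \<open>V0\<close>, and consider the set of all complex configurations with the same pinned
  vertices and the same edge lengths as a generic one. Its cardinality \<open>n\<close> does not depend on the
  generic configuration, since any two are conjugate under a partial isomorphism of the complex
  numbers. If some generic framework of signature \<open>s\<close> is globally rigid, then it is the only real point of
  its fibre, and the other points come in conjugate pairs, so \<open>n\<close> is odd (the fibre is finite, because
  otherwise moving some free coordinates generically would produce a second real point).

  On the other hand \<open>n\<close> is even or \<open>1\<close>. Take a generic real Euclidean configuration and a generic stress
  \<open>\<omega>\<close> of it. The whole fibre lies in the affine space of configurations having the stress \<open>\<omega>\<close>, and
  differentiating the energy \<open>\<Sum>e. \<omega> e * len p e\<close> shows that the length map sends this space into an affine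
  space of the same dimension. If that dimension is positive, a generic point of the target with
  negative coordinates has no real preimage, so its fibre, again of cardinality \<open>n\<close>, splits into
  conjugate pairs. Hence \<open>n = 1\<close>, and then every generic framework is globally rigid, because the
  globally rigid subgraph allows one to move any equivalent framework to one with the same pinned vertices.

  Transcendence degrees are handled by linear algebra in the space of derivations of the complex
  numbers: over a set \<open>X\<close>, numbers are algebraically independent iff derivations vanishing on \<open>X\<close> take
  arbitrary values on them, and a number is algebraic iff all such derivations kill it.
\<close>

section \<open>Linear functionals on spaces of functions\<close>

text \<open>The count \<open>n\<close> must be compared in three situations: the whole configuration
  moves, only some free coordinates of one fibre move, or only the target of the length map moves.
  Each time the solutions are algebraic over finitely many independent numbers together with fixed
  constants, and a partial isomorphism whose domain contains these algebraic numbers carries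
  solutions injectively to solutions. Derivations and partial isomorphisms come from one
  construction: a maximal subring made of zero and units, in the dual numbers or in pairs of complex
  numbers, is the graph of the wanted map. A single lemma on lifting simple roots serves both. The
  number \<open>d + 1\<close> of pinned vertices is forced: with fewer, a reflection fixing them
  would survive, whereas \<open>d + 1\<close> generic points leave no isometry. They lie in the
  rigid subgraph because they need not be joined by edges; that subgraph supplies their mutual
  distances in every equivalent framework. The stress argument runs in the Euclidean form because
  there every real configuration has nonnegative squared lengths.\<close>

definition lspace :: "('i \<Rightarrow> complex) set \<Rightarrow> bool" where
  "lspace W \<longleftrightarrow> (\<lambda>_. 0) \<in> W \<and> (\<forall>D\<in>W. \<forall>D'\<in>W. \<forall>c. (\<lambda>x. c * D x + D' x) \<in> W)"

definition lfun :: "('i \<Rightarrow> complex) set \<Rightarrow> (('i \<Rightarrow> complex) \<Rightarrow> complex) \<Rightarrow> bool" where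
  "lfun W l \<longleftrightarrow> (\<forall>D\<in>W. \<forall>D'\<in>W. \<forall>c. l (\<lambda>x. c * D x + D' x) = c * l D + l D')"

text \<open>For finite \<open>J\<close> and linear \<open>a j\<close> this is linear independence of
  the functionals on \<open>W\<close>, a form that also suits a \<open>W\<close> of infinite
  dimension.\<close>

definition onto :: "('i \<Rightarrow> complex) set \<Rightarrow> 'j set \<Rightarrow> ('j \<Rightarrow> ('i \<Rightarrow> complex) \<Rightarrow> complex) \<Rightarrow> bool" where
  "onto W J a \<longleftrightarrow> (\<forall>\<delta>. \<exists>D\<in>W. \<forall>j\<in>J. a j D = \<delta> j)"

lemma lspaceD: "lspace W \<Longrightarrow> D \<in> W \<Longrightarrow> D' \<in> W \<Longrightarrow> (\<lambda>x. c * D x + D' x) \<in> W"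
  by (simp add: lspace_def)

lemma lfunD: "lfun W l \<Longrightarrow> D \<in> W \<Longrightarrow> D' \<in> W \<Longrightarrow> l (\<lambda>x. c * D x + D' x) = c * l D + l D'"
  by (simp add: lfun_def)

lemma lfun_subset: "lfun W l \<Longrightarrow> W' \<subseteq> W \<Longrightarrow> lfun W' l"
  unfolding lfun_def by blast

lemma lfun_zero:
  assumes "lfun W l" "lspace W" shows "l (\<lambda>_. 0) = 0"
  using lfunD[OF assms(1), of "\<lambda>_. 0" "\<lambda>_. 0" "-1"] assms(2) by (simp add: lspace_def)

lemma lspace_kernel:
  assumes "lspace W" "lfun W l" shows "lspace {D \<in> W. l D = 0}"
  using assms lfun_zero[OF assms(2,1)] unfolding lspace_def lfun_def by simp

lemma ontoD: "onto W J a \<Longrightarrow> \<exists>D\<in>W. \<forall>j\<in>J. a j D = \<delta> j"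
  by (simp add: onto_def)

lemma onto_mono: "onto W J a \<Longrightarrow> J' \<subseteq> J \<Longrightarrow> onto W J' a"
  unfolding onto_def by (meson subsetD)

text \<open>Greedy choice of a basis: a functional is kept exactly when it is nonzero somewhere on
  the common kernel of those already kept.\<close>

lemma onto_maximal_subset:
  assumes "finite J" "lspace W" "\<And>j. j \<in> J \<Longrightarrow> lfun W (a j)"
  shows "\<exists>S\<subseteq>J. onto W S a \<and> (\<forall>D\<in>W. (\<forall>j\<in>S. a j D = 0) \<longrightarrow> (\<forall>j\<in>J. a j D = 0))"
  using assms(1,3)
proof (induction J rule: finite_induct)
  case empty
  then show ?case using assms(2) by (auto simp: onto_def lspace_def)
next
  case (insert j J)
  then obtain S where S: "S \<subseteq> J" "onto W S a"
    "\<forall>D\<in>W. (\<forall>j\<in>S. a j D = 0) \<longrightarrow> (\<forall>j\<in>J. a j D = 0)" by auto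
  have lj: "lfun W (a j)" and lS: "\<And>i. i \<in> S \<Longrightarrow> lfun W (a i)" using insert S by auto
  show ?case
  proof (cases "\<exists>D0\<in>W. (\<forall>i\<in>S. a i D0 = 0) \<and> a j D0 \<noteq> 0")
    case True
    then obtain D0 where D0: "D0 \<in> W" "\<forall>i\<in>S. a i D0 = 0" "a j D0 \<noteq> 0" by auto
    have "onto W (insert j S) a"
      unfolding onto_def
    proof
      fix \<delta>
      obtain D1 where D1: "D1 \<in> W" "\<forall>i\<in>S. a i D1 = \<delta> i" using ontoD[OF S(2)] by blast
      define k where "k = (\<delta> j - a j D1) / a j D0"
      have k: "k * a j D0 = \<delta> j - a j D1" using D0(3) by (simp add: k_def)
      let ?D = "\<lambda>x. k * D0 x + D1 x"
      have "?D \<in> W" using lspaceD[OF assms(2) D0(1) D1(1)] .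
      moreover have "a j ?D = \<delta> j" using lfunD[OF lj D0(1) D1(1)] k by simp
      moreover have "a i ?D = \<delta> i" if "i \<in> S" for i
        using lfunD[OF lS[OF that] D0(1) D1(1)] D0(2) D1(2) that by simp
      ultimately show "\<exists>D\<in>W. \<forall>i\<in>insert j S. a i D = \<delta> i" by blast
    qed
    then show ?thesis using S by (intro exI[of _ "insert j S"]) auto
  next
    case False
    then show ?thesis using S by (intro exI[of _ S]) auto
  qed
qed

text \<open>The exchange argument, by induction on \<open>S\<close>: passing to the kernel of one
  \<open>b s\<close> costs at most one of the functionals \<open>a j\<close>.\<close>

lemma onto_card_le:
  assumes "finite S" "finite J" "lspace W"
    "\<And>j. j \<in> J \<Longrightarrow> lfun W (a j)" "\<And>j. j \<in> S \<Longrightarrow> lfun W (b j)" "onto W J a"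
    "\<And>D j. D \<in> W \<Longrightarrow> (\<forall>s\<in>S. b s D = 0) \<Longrightarrow> j \<in> J \<Longrightarrow> a j D = 0"
  shows "card J \<le> card S"
  using assms
proof (induction S arbitrary: W J a rule: finite_induct)
  case empty
  have "J = {}"
  proof (rule ccontr)
    assume "J \<noteq> {}"
    then obtain j where j: "j \<in> J" by auto
    obtain D where "D \<in> W" "\<forall>j\<in>J. a j D = 1" using ontoD[OF empty(5), of "\<lambda>_. 1"] by blast
    then show False using empty(6) j by force
  qed
  then show ?case by simp
next
  case (insert s S)
  note W = insert.prems(2) and la = insert.prems(3) and lb = insert.prems(4)
    and on = insert.prems(5) and ker = insert.prems(6)
  show ?case
  proof (cases "\<exists>D0\<in>W. (\<forall>i\<in>S. b i D0 = 0) \<and> b s D0 \<noteq> 0")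
    case False
    have "card J \<le> card S"
      by (rule insert.IH[OF insert.prems(1) W la lb on]) (use False ker in auto)
    then show ?thesis using insert by simp
  next
    case True
    then obtain D0 where D0: "D0 \<in> W" "\<forall>i\<in>S. b i D0 = 0" "b s D0 \<noteq> 0" by auto
    define W1 where "W1 = {D \<in> W. b s D = 0}"
    have W1: "lspace W1" unfolding W1_def by (rule lspace_kernel[OF W lb]) simp
    have W1W: "W1 \<subseteq> W" by (auto simp: W1_def)
    \<comment> \<open>Adding \<open>k D\<close> times \<open>D0\<close> projects \<open>W\<close>
      onto \<open>W1\<close> along \<open>D0\<close>.\<close>
    define k where "k D = - b s D / b s D0" for D
    have k: "k D * b s D0 = - b s D" for D using D0(3) by (simp add: k_def)
    have proj: "(\<lambda>x. k D * D0 x + D x) \<in> W1" if "D \<in> W" for D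
      using lspaceD[OF W D0(1) that] lfunD[OF lb D0(1) that, of s] k
      by (simp add: W1_def)
    have lb1: "\<And>j. j \<in> S \<Longrightarrow> lfun W1 (b j)" using lb lfun_subset[OF _ W1W] by blast
    show ?thesis
    proof (cases "\<forall>j\<in>J. a j D0 = 0")
      case True
      have "onto W1 J a"
        unfolding onto_def
      proof
        fix \<delta>
        obtain D where D: "D \<in> W" "\<forall>j\<in>J. a j D = \<delta> j" using ontoD[OF on] by blast
        have "\<forall>j\<in>J. a j (\<lambda>x. k D * D0 x + D x) = \<delta> j"
          using lfunD[OF la D0(1) D(1)] True D(2) by simp
        then show "\<exists>D\<in>W1. \<forall>j\<in>J. a j D = \<delta> j" using proj[OF D(1)] by blast
      qed
      moreover have "a j D = 0" if "D \<in> W1" "\<forall>i\<in>S. b i D = 0" "j \<in> J" for D j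
        using ker[of D j] that by (auto simp: W1_def)
      ultimately have "card J \<le> card S"
        by (intro insert.IH[where a = a, OF insert.prems(1) W1 _ lb1])
          (use la lfun_subset[OF _ W1W] in auto)
      then show ?thesis using insert by simp
    next
      case False
      then obtain j0 where j0: "j0 \<in> J" "a j0 D0 \<noteq> 0" by auto
      \<comment> \<open>Gauss elimination with pivot \<open>j0\<close>: every \<open>a' j\<close>
        vanishes at \<open>D0\<close>, so the projection along \<open>D0\<close> does not change its
        values.\<close>
      define a' where "a' j D = a j D - (a j D0 / a j0 D0) * a j0 D" for j D
      have la': "lfun W (a' j)" if "j \<in> J" for j
        using la[OF that] la[OF j0(1)] unfolding lfun_def a'_def by (simp add: algebra_simps)
      have "onto W1 (J - {j0}) a'"
        unfolding onto_def
      proof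
        fix \<delta>
        obtain D where D: "D \<in> W" "\<forall>j\<in>J. a j D = (\<delta>(j0 := 0)) j" using ontoD[OF on] by blast
        have "\<forall>j\<in>J - {j0}. a' j (\<lambda>x. k D * D0 x + D x) = \<delta> j"
          using lfunD[OF la' D0(1) D(1)] D(2) j0 by (simp add: a'_def)
        then show "\<exists>D\<in>W1. \<forall>j\<in>J - {j0}. a' j D = \<delta> j" using proj[OF D(1)] by blast
      qed
      moreover have "a' j D = 0" if "D \<in> W1" "\<forall>i\<in>S. b i D = 0" "j \<in> J - {j0}" for D j
        using ker[of D j] ker[of D j0] that j0(1) by (auto simp: W1_def a'_def)
      ultimately have "card (J - {j0}) \<le> card S"
        by (intro insert.IH[where a = a', OF _ W1 _ lb1])
          (use insert.prems(1) la' lfun_subset[OF _ W1W] in auto)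
      then show ?thesis using insert j0 by simp
    qed
  qed
qed

text \<open>The exchange bound, applied to a maximal independent part of \<open>S\<close>, leaves no
  room for that part to be proper.\<close>

lemma onto_of_kernel_subset:
  assumes "finite S" "finite J" "lspace W"
    "\<And>j. j \<in> J \<Longrightarrow> lfun W (a j)" "\<And>j. j \<in> S \<Longrightarrow> lfun W (b j)" "onto W J a"
    "\<And>D j. D \<in> W \<Longrightarrow> (\<forall>s\<in>S. b s D = 0) \<Longrightarrow> j \<in> J \<Longrightarrow> a j D = 0"
    "card S \<le> card J"
  shows "onto W S b"
proof -
  obtain S' where S': "S' \<subseteq> S" "onto W S' b"
    "\<forall>D\<in>W. (\<forall>j\<in>S'. b j D = 0) \<longrightarrow> (\<forall>j\<in>S. b j D = 0)"
    using onto_maximal_subset[OF assms(1,3), of b] assms(5) by blast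
  have "card J \<le> card S'"
    by (rule onto_card_le[OF finite_subset[OF S'(1) assms(1)] assms(2,3,4) _ assms(6)])
      (use S' assms in blast)+
  then have "S' = S" using S'(1) assms(1,8) card_subset_eq[OF assms(1) S'(1)]
    card_mono[OF assms(1) S'(1)] by simp
  then show ?thesis using S' by simp
qed

text \<open>At equal rank the inclusion of kernels reverses: otherwise \<open>J\<close> would stay
  independent on the kernel of \<open>b s\<close>, where only \<open>card S - 1\<close> functionals
  control it.\<close>

lemma kernel_subset_of_onto:
  assumes "finite S" "finite J" "lspace W"
    "\<And>j. j \<in> J \<Longrightarrow> lfun W (a j)" "\<And>j. j \<in> S \<Longrightarrow> lfun W (b j)" "onto W J a"
    "\<And>D j. D \<in> W \<Longrightarrow> (\<forall>s\<in>S. b s D = 0) \<Longrightarrow> j \<in> J \<Longrightarrow> a j D = 0"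
    "card S \<le> card J" "D1 \<in> W" "\<And>j. j \<in> J \<Longrightarrow> a j D1 = 0" "s \<in> S"
  shows "b s D1 = 0"
proof (rule ccontr)
  assume ne: "b s D1 \<noteq> 0"
  define W1 where "W1 = {D \<in> W. b s D = 0}"
  have W1: "lspace W1" unfolding W1_def by (rule lspace_kernel[OF assms(3,5)]) fact
  have W1W: "W1 \<subseteq> W" by (auto simp: W1_def)
  have "onto W1 J a"
    unfolding onto_def
  proof
    fix \<delta>
    obtain D where D: "D \<in> W" "\<forall>j\<in>J. a j D = \<delta> j" using ontoD[OF assms(6)] by blast
    define k where "k = - b s D / b s D1"
    have k: "k * b s D1 = - b s D" using ne by (simp add: k_def)
    let ?D = "\<lambda>x. k * D1 x + D x"
    have "?D \<in> W1"
      using lspaceD[OF assms(3,9) D(1)] lfunD[OF assms(5)[OF assms(11)] assms(9) D(1)] k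
      by (simp add: W1_def)
    moreover have "\<forall>j\<in>J. a j ?D = \<delta> j"
      using lfunD[OF assms(4) assms(9) D(1)] assms(10) D(2) by simp
    ultimately show "\<exists>D\<in>W1. \<forall>j\<in>J. a j D = \<delta> j" by blast
  qed
  moreover have "a j D = 0" if "D \<in> W1" "\<forall>i\<in>S - {s}. b i D = 0" "j \<in> J" for D j
    using assms(7)[of D j] that by (auto simp: W1_def)
  ultimately have "card J \<le> card (S - {s})"
    by (intro onto_card_le[where a = a and b = b and W = W1] W1)
      (use assms lfun_subset[OF _ W1W] in auto)
  moreover have "card (S - {s}) < card S" using assms(1,11) by (rule card_Diff1_less)
  ultimately show False using assms(8) by simp
qed

text \<open>Induction on \<open>T\<close>: a vector seen by \<open>a t\<close> alone determines the
  coefficient of \<open>a t\<close>, and the remainder vanishes on the larger kernel of the other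
  functionals.\<close>

lemma lfun_in_span:
  assumes "finite T" "lspace W" "\<And>t. t \<in> T \<Longrightarrow> lfun W (a t)" "lfun W l"
    "\<And>D. D \<in> W \<Longrightarrow> (\<forall>t\<in>T. a t D = 0) \<Longrightarrow> l D = 0"
  shows "\<exists>c. \<forall>D\<in>W. l D = (\<Sum>t\<in>T. c t * a t D)"
  using assms(1,3-)
proof (induction T arbitrary: l rule: finite_induct)
  case empty
  then show ?case by simp
next
  case (insert t T)
  show ?case
  proof (cases "\<exists>D0\<in>W. (\<forall>i\<in>T. a i D0 = 0) \<and> a t D0 \<noteq> 0")
    case False
    then have "\<exists>c. \<forall>D\<in>W. l D = (\<Sum>t\<in>T. c t * a t D)"
      by (intro insert.IH) (use insert.prems in auto)
    then obtain c where c: "\<forall>D\<in>W. l D = (\<Sum>t\<in>T. c t * a t D)" by auto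
    have "(\<Sum>i\<in>insert t T. (c(t := 0)) i * a i D) = (\<Sum>t\<in>T. c t * a t D)" for D
      using insert.hyps by (auto intro!: sum.cong)
    then show ?thesis using c by metis
  next
    case True
    then obtain D0 where D0: "D0 \<in> W" "\<forall>i\<in>T. a i D0 = 0" "a t D0 \<noteq> 0" by auto
    define k where "k = l D0 / a t D0"
    have lt: "lfun W (a t)" and ll: "lfun W l" using insert.prems by auto
    have "\<exists>c. \<forall>D\<in>W. l D - k * a t D = (\<Sum>t\<in>T. c t * a t D)"
    proof (rule insert.IH)
      show "lfun W (\<lambda>D. l D - k * a t D)"
        using lt ll unfolding lfun_def by (simp add: algebra_simps)
      fix D assume D: "D \<in> W" "\<forall>i\<in>T. a i D = 0"
      define m where "m = - a t D / a t D0"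
      have m: "m * a t D0 = - a t D" using D0(3) by (simp add: m_def)
      let ?D = "\<lambda>x. m * D0 x + D x"
      have "?D \<in> W" using lspaceD[OF assms(2) D0(1) D(1)] .
      moreover have "\<forall>i\<in>insert t T. a i ?D = 0"
        using lfunD[OF insert.prems(1) D0(1) D(1)] D0 D m by simp
      ultimately have "m * l D0 + l D = 0"
        using insert.prems(3)[of ?D] lfunD[OF ll D0(1) D(1)] by simp
      then show "l D - k * a t D = 0"
        using D0(3) by (simp add: k_def m_def field_simps)
    qed (use insert.prems in auto)
    then obtain c where c: "\<forall>D\<in>W. l D - k * a t D = (\<Sum>t\<in>T. c t * a t D)" by auto
    have "(\<Sum>i\<in>insert t T. (c(t := k)) i * a i D) = k * a t D + (\<Sum>t\<in>T. c t * a t D)" for D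
      using insert.hyps by (auto intro!: sum.cong)
    then show ?thesis using c by (metis add.commute diff_add_cancel)
  qed
qed

section \<open>Subrings whose nonzero elements are units\<close>

definition over :: "'r::comm_ring_1 set \<Rightarrow> 'r poly \<Rightarrow> bool" where
  "over G p \<longleftrightarrow> (\<forall>i. coeff p i \<in> G)"

definition subring_of :: "'r::comm_ring_1 set \<Rightarrow> bool" where
  "subring_of G \<longleftrightarrow> 1 \<in> G \<and> (\<forall>a\<in>G. \<forall>b\<in>G. a - b \<in> G \<and> a * b \<in> G)"

text \<open>Inverses are asked for in the ambient ring only; a maximal ring of this kind turns out
  to contain them. Under the projections used below, a nonzero element then has nonzero image, which
  makes the ring the graph of a map.\<close>

definition unit_ring :: "'r::comm_ring_1 set \<Rightarrow> bool" where
  "unit_ring G \<longleftrightarrow> subring_of G \<and> (\<forall>g\<in>G. g \<noteq> 0 \<longrightarrow> g dvd 1)"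

lemma subring_minus: "subring_of G \<Longrightarrow> a \<in> G \<Longrightarrow> b \<in> G \<Longrightarrow> a - b \<in> G"
  and subring_mult: "subring_of G \<Longrightarrow> a \<in> G \<Longrightarrow> b \<in> G \<Longrightarrow> a * b \<in> G"
  and subring_one: "subring_of G \<Longrightarrow> 1 \<in> G"
  by (auto simp: subring_of_def)

lemma subring_zero: "subring_of G \<Longrightarrow> 0 \<in> G"
  using subring_minus[of G 1 1] by (auto simp: subring_of_def)

lemma subring_uminus: "subring_of G \<Longrightarrow> a \<in> G \<Longrightarrow> - a \<in> G"
  using subring_minus[of G 0 a] subring_zero by auto

lemma subring_add: "subring_of G \<Longrightarrow> a \<in> G \<Longrightarrow> b \<in> G \<Longrightarrow> a + b \<in> G"
  using subring_minus[of G a "- b"] subring_uminus by auto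

lemma subring_sum: "subring_of G \<Longrightarrow> (\<And>i. i \<in> I \<Longrightarrow> f i \<in> G) \<Longrightarrow> sum f I \<in> G"
  by (induction I rule: infinite_finite_induct) (auto intro: subring_add subring_zero)

lemma subring_of_nat: "subring_of G \<Longrightarrow> of_nat n \<in> G"
  by (induction n) (auto intro: subring_add subring_zero subring_one)

lemmas subring_intros = subring_one subring_zero subring_minus subring_uminus subring_add
  subring_mult subring_sum subring_of_nat

lemma over_minus: "subring_of G \<Longrightarrow> over G p \<Longrightarrow> over G q \<Longrightarrow> over G (p - q)"
  by (simp add: over_def subring_intros)

lemma over_add: "subring_of G \<Longrightarrow> over G p \<Longrightarrow> over G q \<Longrightarrow> over G (p + q)"
  by (simp add: over_def subring_intros)

lemma over_mult: "subring_of G \<Longrightarrow> over G p \<Longrightarrow> over G q \<Longrightarrow> over G (p * q)"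
  by (simp add: over_def coeff_mult subring_intros)

lemma over_zero: "subring_of G \<Longrightarrow> over G 0"
  by (simp add: over_def subring_intros)

lemma over_monom: "subring_of G \<Longrightarrow> c \<in> G \<Longrightarrow> over G (monom c n)"
  by (simp add: over_def subring_intros)

lemma over_const: "subring_of G \<Longrightarrow> c \<in> G \<Longrightarrow> over G [:c:]"
  by (simp add: over_def coeff_pCons subring_intros split: nat.split)

lemma over_pCons: "over G (pCons a p) \<longleftrightarrow> a \<in> G \<and> over G p"
  unfolding over_def coeff_pCons by (auto split: nat.splits)

lemma subring_adjoin:
  assumes "subring_of G" shows "subring_of {poly p r |p. over G p}"
  unfolding subring_of_def
proof (intro conjI ballI)
  show "1 \<in> {poly p r |p. over G p}"
    using over_const[OF assms subring_one[OF assms]] by (force intro: exI[of _ "[:1:]"])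
next
  fix a b assume "a \<in> {poly p r |p. over G p}" "b \<in> {poly p r |p. over G p}"
  then obtain p q where pq: "over G p" "over G q" "a = poly p r" "b = poly q r" by auto
  show "a - b \<in> {poly p r |p. over G p}"
    using over_minus[OF assms pq(1,2)] pq by (force intro: exI[of _ "p - q"])
  show "a * b \<in> {poly p r |p. over G p}"
    using over_mult[OF assms pq(1,2)] pq by (force intro: exI[of _ "p * q"])
qed

lemma subset_adjoin:
  assumes "subring_of G" shows "insert r G \<subseteq> {poly p r |p. over G p}"
proof -
  have "over G [:0, 1:]" using assms by (auto simp: over_pCons over_zero subring_intros)
  then have "\<exists>p. r = poly p r \<and> over G p" by (intro exI[of _ "[:0, 1:]"]) simp
  moreover have "\<exists>p. c = poly p r \<and> over G p" if "c \<in> G" for c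
    using over_const[OF assms that] by (intro exI[of _ "[:c:]"]) simp
  ultimately show ?thesis by auto
qed

lemma unit_ring_adjoin:
  assumes "unit_ring G" "\<And>p. over G p \<Longrightarrow> poly p r \<noteq> 0 \<Longrightarrow> poly p r dvd 1"
  shows "unit_ring {poly p r |p. over G p}"
  using assms subring_adjoin[of G r] by (auto simp: unit_ring_def)

lemma unit_ring_fractions:
  assumes "unit_ring G"
  shows "unit_ring {a * b' |a b b'. a \<in> G \<and> b \<in> G \<and> b * b' = 1}" (is "unit_ring ?Q")
proof -
  have sG: "subring_of G" using assms by (simp add: unit_ring_def)
  have "1 \<in> ?Q" using subring_one[OF sG] by force
  moreover have "x - y \<in> ?Q \<and> x * y \<in> ?Q" if xy: "x \<in> ?Q" "y \<in> ?Q" for x y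
  proof -
    obtain a b b' c d d' where *: "a \<in> G" "b \<in> G" "b * b' = 1" "x = a * b'"
      "c \<in> G" "d \<in> G" "d * d' = 1" "y = c * d'" using xy by blast
    have bd: "(b * d) * (b' * d') = 1" using *(3,7) by (metis mult.left_commute mult.assoc mult.right_neutral)
    have "x - y = (a * (d * d')) * b' - (c * (b * b')) * d'" using * by simp
    then have 1: "x - y = (a * d - c * b) * (b' * d')" by (simp add: algebra_simps)
    have 2: "x * y = (a * c) * (b' * d')" using * by (simp add: algebra_simps)
    have 3: "a * d - c * b \<in> G" "a * c \<in> G" "b * d \<in> G" using * sG by (auto intro!: subring_intros)
    show ?thesis using 1 2 3 bd by blast
  qed
  moreover have "x dvd 1" if x: "x \<in> ?Q" "x \<noteq> 0" for x
  proof -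
    obtain a b b' where *: "a \<in> G" "b \<in> G" "b * b' = 1" "x = a * b'" using x(1) by blast
    have "a dvd 1" using assms * x(2) by (auto simp: unit_ring_def)
    moreover have "b' dvd 1" using *(3) by (metis dvd_triv_right)
    ultimately show ?thesis using * mult_dvd_mono[of a 1 b' 1] by simp
  qed
  ultimately show ?thesis by (auto simp: unit_ring_def subring_of_def)
qed

definition maximal_unit_ring :: "'r::comm_ring_1 set \<Rightarrow> bool" where
  "maximal_unit_ring G \<longleftrightarrow> unit_ring G \<and> (\<forall>H. unit_ring H \<longrightarrow> G \<subseteq> H \<longrightarrow> H = G)"

lemma maximal_unit_ring_exists:
  assumes "unit_ring (G0 :: 'r::comm_ring_1 set)"
  shows "\<exists>G. maximal_unit_ring G \<and> G0 \<subseteq> G"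
proof -
  let ?A = "{G. unit_ring G \<and> G0 \<subseteq> G}"
  have "\<exists>M\<in>?A. \<forall>X\<in>?A. M \<subseteq> X \<longrightarrow> X = M"
  proof (rule subset_Zorn_nonempty)
    show "?A \<noteq> {}" using assms by auto
    fix C assume C: "C \<noteq> {}" "subset.chain ?A C"
    have un: "\<And>G. G \<in> C \<Longrightarrow> unit_ring G \<and> G0 \<subseteq> G" using C by (auto simp: subset.chain_def)
    have "subring_of (\<Union>C)"
      unfolding subring_of_def
    proof (intro conjI ballI)
      show "1 \<in> \<Union>C" using C(1) un by (auto simp: unit_ring_def subring_of_def)
      fix a b assume "a \<in> \<Union>C" "b \<in> \<Union>C"
      then obtain G H where GH: "G \<in> C" "a \<in> G" "H \<in> C" "b \<in> H" by auto
      then have "G \<subseteq> H \<or> H \<subseteq> G" using C(2) by (auto simp: subset_chain_def)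
      then obtain K where "K \<in> C" "a \<in> K" "b \<in> K" using GH by blast
      then show "a - b \<in> \<Union>C" "a * b \<in> \<Union>C"
        using un[of K] by (auto simp: unit_ring_def subring_of_def)
    qed
    then show "\<Union>C \<in> ?A" using un C(1) by (auto simp: unit_ring_def)
  qed
  then obtain M where M: "unit_ring M" "G0 \<subseteq> M" "\<forall>X. unit_ring X \<and> G0 \<subseteq> X \<longrightarrow> M \<subseteq> X \<longrightarrow> X = M"
    by auto
  then have "maximal_unit_ring M" unfolding maximal_unit_ring_def by (meson order_trans)
  then show ?thesis using M by auto
qed

text \<open>Maximality absorbs the ring of fractions, whose nonzero elements are again
  units.\<close>

lemma maximal_unit_ring_inverse:
  assumes "maximal_unit_ring G" "g \<in> G" "g \<noteq> 0"
  shows "\<exists>g'\<in>G. g * g' = 1"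
proof -
  let ?Q = "{a * b' |a b b'. a \<in> G \<and> b \<in> G \<and> b * b' = 1}"
  have u: "unit_ring G" using assms by (simp add: maximal_unit_ring_def)
  then have one: "1 \<in> G" by (simp add: unit_ring_def subring_of_def)
  have "G \<subseteq> ?Q" using one by (force intro: exI[of _ 1])
  then have Q: "?Q = G" using unit_ring_fractions[OF u] assms(1) unfolding maximal_unit_ring_def by blast
  obtain g' where g': "g * g' = 1" using u assms by (metis dvdE unit_ring_def)
  then have "1 * g' \<in> ?Q" using one assms(2) by blast
  then show ?thesis using Q g' by auto
qed

text \<open>The ambient ring may have zero divisors, so the degree of a product is only bounded
  above, and the inverse \<open>c\<close> of the leading coefficient has to be given inside
  \<open>G\<close>.\<close>

lemma division_over:
  assumes "subring_of G" "over G p" "c \<in> G" "lead_coeff p * c = 1" "over G q"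
  shows "\<exists>s t. over G s \<and> over G t \<and> q = p * s + t \<and> (t = 0 \<or> degree t < degree p)"
  using assms(5)
proof (induction "degree q" arbitrary: q rule: less_induct)
  case less
  show ?case
  proof (cases "q = 0 \<or> degree q < degree p")
    case True
    then show ?thesis using less.prems over_zero[OF assms(1)]
      by (intro exI[of _ 0] exI[of _ q]) auto
  next
    case False
    define m where "m = monom (c * lead_coeff q) (degree q - degree p)"
    define q' where "q' = q - p * m"
    have m: "over G m" unfolding m_def
      by (rule over_monom[OF assms(1)]) (use assms less.prems in \<open>auto simp: over_def intro: subring_intros\<close>)
    have q': "over G q'" unfolding q'_def using assms less.prems m over_minus over_mult by blast
    have deg: "degree (p * m) \<le> degree q"
      using degree_mult_le[of p m] degree_monom_le[of "c * lead_coeff q" "degree q - degree p"] False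
      unfolding m_def by linarith
    have "coeff (p * m) (degree p + (degree q - degree p)) = lead_coeff p * (c * lead_coeff q)"
      unfolding m_def using coeff_monom_mult[of "c * lead_coeff q" "degree q - degree p" p "degree p + (degree q - degree p)"]
      by (simp add: mult.commute)
    then have "coeff (p * m) (degree q) = lead_coeff q"
      using False assms(4) by (simp add: mult.assoc[symmetric])
    then have co: "coeff q' (degree q) = 0" by (simp add: q'_def)
    have le: "degree q' \<le> degree q" unfolding q'_def by (rule degree_diff_le) (use deg in auto)
    show ?thesis
    proof (cases "q' = 0")
      case True
      then show ?thesis using m over_zero[OF assms(1)] by (intro exI[of _ m] exI[of _ 0]) (auto simp: q'_def)
    next
      case False
      then have "degree q' \<noteq> degree q" using co by (metis leading_coeff_0_iff)
      then have "degree q' < degree q" using le by simp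
      from less.hyps[OF this q'] obtain s t where st: "over G s" "over G t" "q' = p * s + t"
        "t = 0 \<or> degree t < degree p" by auto
      have "q = p * (s + m) + t" using st(3) by (simp add: q'_def algebra_simps)
      then show ?thesis using st over_add[OF assms(1) st(1) m] by blast
    qed
  qed
qed

lemma derivative_over:
  assumes "subring_of G" "over G (p :: 'r::comm_ring_1 poly)"
  obtains q where "over G q" "\<And>n. coeff q n = of_nat (Suc n) * coeff p (Suc n)"
proof -
  let ?q = "Poly (map (\<lambda>n. of_nat (Suc n) * coeff p (Suc n)) [0..<degree p])"
  have c: "coeff ?q n = of_nat (Suc n) * coeff p (Suc n)" for n
    by (cases "n < degree p") (auto simp: nth_default_def coeff_eq_0 simp del: of_nat_Suc)
  then have "over G ?q" using assms by (auto simp: over_def intro!: subring_mult subring_of_nat simp del: of_nat_Suc)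
  then show ?thesis using that c by blast
qed

text \<open>For dual numbers the lifting of a simple root is a Newton step in the infinitesimal
  component; for pairs it is the fundamental theorem of algebra in the second component.\<close>

locale root_lifting =
  fixes \<pi> :: "'r::comm_ring_1 \<Rightarrow> complex"
  assumes \<pi>_add: "\<pi> (x + y) = \<pi> x + \<pi> y"
    and \<pi>_mult: "\<pi> (x * y) = \<pi> x * \<pi> y"
    and \<pi>_one: "\<pi> 1 = 1"
    and lift_root: "degree p > 0 \<Longrightarrow> lead_coeff p dvd 1 \<Longrightarrow> poly (map_poly \<pi> p) \<alpha> = 0 \<Longrightarrow>
      poly (pderiv (map_poly \<pi> p)) \<alpha> \<noteq> 0 \<Longrightarrow> \<exists>r. \<pi> r = \<alpha> \<and> poly p r = 0"
begin

lemma \<pi>_zero: "\<pi> 0 = 0"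
  using \<pi>_add[of 0 0] by simp

lemma \<pi>_of_nat: "\<pi> (of_nat n) = of_nat n"
  by (induction n) (simp_all add: \<pi>_zero \<pi>_add \<pi>_one)

lemma \<pi>_poly: "\<pi> (poly p r) = poly (map_poly \<pi> p) (\<pi> r)"
  by (induction p) (simp_all add: map_poly_pCons \<pi>_zero \<pi>_add \<pi>_mult)

lemma \<pi>_unit: "g dvd 1 \<Longrightarrow> \<pi> g \<noteq> 0"
  using \<pi>_mult \<pi>_one by (metis dvdE mult_zero_left zero_neq_one)

lemma \<pi>_nonzero: "unit_ring G \<Longrightarrow> g \<in> G \<Longrightarrow> g \<noteq> 0 \<Longrightarrow> \<pi> g \<noteq> 0"
  using \<pi>_unit[of g] unfolding unit_ring_def by blast

text \<open>A polynomial of least degree whose image vanishes at \<open>\<alpha>\<close> has a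
  simple root there. The root lifts to some \<open>r\<close>, and adjoining \<open>r\<close> keeps
  nonzero elements invertible, so by maximality \<open>r\<close> already lies in
  \<open>G\<close>.\<close>

lemma maximal_unit_ring_closed:
  assumes G: "maximal_unit_ring G" and p0: "over G p0" "p0 \<noteq> 0" "poly (map_poly \<pi> p0) \<alpha> = 0"
  shows "\<exists>r\<in>G. \<pi> r = \<alpha>"
proof -
  have u: "unit_ring G" and sG: "subring_of G"
    using G by (auto simp: maximal_unit_ring_def unit_ring_def)
  define P where "P p \<longleftrightarrow> over G p \<and> p \<noteq> 0 \<and> poly (map_poly \<pi> p) \<alpha> = 0" for p
  define p where "p = arg_min degree P"
  have "P p0" using p0 by (simp add: P_def)
  then have Pp: "P p" and min: "\<And>q. P q \<Longrightarrow> degree p \<le> degree q"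
    unfolding p_def using arg_min_natI[of P p0 degree] arg_min_nat_le[of P _ degree] by auto
  have lc: "\<exists>c\<in>G. lead_coeff q * c = 1" if "over G q" "q \<noteq> 0" for q
    using maximal_unit_ring_inverse[OF G, of "lead_coeff q"] that by (auto simp: over_def)
  have oG: "over G p" "p \<noteq> 0" and rt: "poly (map_poly \<pi> p) \<alpha> = 0" using Pp by (auto simp: P_def)
  have dp: "degree p > 0"
  proof (rule ccontr)
    assume "\<not> degree p > 0"
    then obtain c where c: "p = [:c:]" by (metis degree_eq_zeroE neq0_conv)
    then have "c \<in> G" "c \<noteq> 0" using oG by (auto simp: over_pCons)
    then show False using \<pi>_nonzero[OF u] rt c by (simp add: map_poly_pCons \<pi>_zero)
  qed
  \<comment> \<open>A multiple root would be a root of the image of the derivative, which is nonzero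
    in characteristic zero and has smaller degree.\<close>
  have "poly (pderiv (map_poly \<pi> p)) \<alpha> \<noteq> 0"
  proof
    assume 0: "poly (pderiv (map_poly \<pi> p)) \<alpha> = 0"
    obtain q where q: "over G q" "\<And>n. coeff q n = of_nat (Suc n) * coeff p (Suc n)"
      using derivative_over[OF sG oG(1)] by blast
    have "map_poly \<pi> q = pderiv (map_poly \<pi> p)"
      by (rule poly_eqI) (simp add: coeff_map_poly \<pi>_zero coeff_pderiv q \<pi>_mult \<pi>_of_nat \<pi>_add \<pi>_one)
    moreover have "\<pi> (coeff q (degree p - 1)) \<noteq> 0"
      using dp oG \<pi>_nonzero[OF u, of "lead_coeff p"]
      by (simp add: q \<pi>_mult \<pi>_of_nat \<pi>_add \<pi>_one over_def)
    then have "q \<noteq> 0" using \<pi>_zero by auto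
    ultimately have "P q" using q 0 by (simp add: P_def)
    moreover have "degree q < degree p"
    proof -
      have "degree q \<le> degree p - 1" by (rule degree_le) (use dp in \<open>auto simp: q coeff_eq_0 simp del: of_nat_Suc\<close>)
      then show ?thesis using dp by linarith
    qed
    ultimately show False using min by fastforce
  qed
  moreover have "lead_coeff p dvd 1" using lc[OF oG] by (metis dvd_triv_left)
  ultimately obtain r where r: "\<pi> r = \<alpha>" "poly p r = 0" using lift_root[OF dp _ rt] by blast
  have nz: "poly (map_poly \<pi> q) \<alpha> \<noteq> 0" if "over G q" "q \<noteq> 0" "degree q < degree p" for q
    using min[of q] that by (auto simp: P_def)
  \<comment> \<open>A combination \<open>w\<close> of \<open>t\<close> and \<open>p\<close> of least
    degree divides \<open>p\<close>. Minimality of \<open>p\<close> forces \<open>w\<close> to be a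
    constant, which is a unit and a multiple of \<open>poly t r\<close>.\<close>
  have unit: "poly t r dvd 1" if t: "over G t" "t \<noteq> 0" "degree t < degree p" for t
  proof -
    define W where "W w \<longleftrightarrow> w \<noteq> 0 \<and> (\<exists>u v. over G u \<and> over G v \<and> w = u * t + v * p)" for w
    define w where "w = arg_min degree W"
    have one: "over G 1" using over_const[OF sG subring_one[OF sG]] by (simp add: one_pCons)
    have Wt: "W t" using t one over_zero[OF sG] unfolding W_def
      by (intro conjI exI[of _ 1] exI[of _ 0]) auto
    then have Ww: "W w" and minw: "\<And>q. W q \<Longrightarrow> degree w \<le> degree q"
      unfolding w_def using arg_min_natI[of W t degree] arg_min_nat_le[of W _ degree] by auto
    then obtain a b where ab: "over G a" "over G b" "w = a * t + b * p" and w0: "w \<noteq> 0"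
      by (auto simp: W_def)
    have oGw: "over G w" unfolding ab(3) using ab t oG sG by (intro over_add over_mult) auto
    obtain c where c: "c \<in> G" "lead_coeff w * c = 1" using lc[OF oGw w0] by auto
    obtain s e where se: "over G s" "over G e" "p = w * s + e" "e = 0 \<or> degree e < degree w"
      using division_over[OF sG oGw c oG(1)] by auto
    have "e = (- s * a) * t + (1 - s * b) * p"
    proof -
      have "e = p - w * s" using se(3) by simp
      then show ?thesis unfolding ab(3) by (simp add: algebra_simps)
    qed
    moreover have "over G (- s * a)" "over G (1 - s * b)"
      using over_minus[OF sG over_zero[OF sG] over_mult[OF sG se(1) ab(1)]]
        over_minus[OF sG one over_mult[OF sG se(1) ab(2)]] by auto
    ultimately have "e = 0" using se(4) minw[of e] unfolding W_def by (metis not_le)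
    then have pw: "p = w * s" using se(3) by simp
    have "degree w < degree p" using minw[OF Wt] t(3) by simp
    then have "poly (map_poly \<pi> w) \<alpha> \<noteq> 0" by (rule nz[OF oGw w0])
    moreover have "poly (map_poly \<pi> w) \<alpha> * poly (map_poly \<pi> s) \<alpha> = 0"
      using \<pi>_poly[of w r] \<pi>_poly[of s r] \<pi>_mult[of "poly w r" "poly s r"] r \<pi>_zero pw by simp
    ultimately have "poly (map_poly \<pi> s) \<alpha> = 0" by simp
    moreover have s0: "s \<noteq> 0" using pw oG by auto
    ultimately have "degree p \<le> degree s" using nz[OF se(1)] by force
    moreover have "degree p = degree w + degree s"
    proof -
      \<comment> \<open>Degrees add here because the leading coefficient of \<open>w\<close> is
        invertible.\<close>
      have "lead_coeff w * lead_coeff s \<noteq> 0"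
        using c(2) s0 by (metis leading_coeff_0_iff mult.commute mult.left_commute mult_zero_right mult.right_neutral)
      then have "degree w + degree s \<le> degree p" unfolding pw
        by (intro le_degree) (simp add: coeff_mult_degree_sum)
      then show ?thesis using degree_mult_le[of w s] pw by simp
    qed
    ultimately have "degree w = 0" by simp
    then obtain k where k: "w = [:k:]" by (metis degree_eq_zeroE)
    have "k = poly w r" by (simp add: k)
    also have "\<dots> = poly a r * poly t r" using r by (simp add: ab(3))
    finally have "poly t r dvd k" by simp
    moreover have "k dvd 1" using c k by (metis degree_pCons_0 coeff_pCons_0 dvd_triv_left)
    ultimately show ?thesis by (rule dvd_trans)
  qed
  have "unit_ring {poly q r |q. over G q}"
  proof (rule unit_ring_adjoin[OF u])
    fix q assume q: "over G q" "poly q r \<noteq> 0"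
    obtain c where c: "c \<in> G" "lead_coeff p * c = 1" using lc[OF oG] by auto
    obtain s t where st: "over G s" "over G t" "q = p * s + t" "t = 0 \<or> degree t < degree p"
      using division_over[OF sG oG(1) c q(1)] by auto
    have "poly q r = poly t r" using st r by simp
    then show "poly q r dvd 1" using unit[OF st(2)] st(4) q(2) by (metis poly_0)
  qed
  then have "{poly q r |q. over G q} = G"
    using subset_adjoin[OF sG] G unfolding maximal_unit_ring_def by blast
  then show ?thesis using subset_adjoin[OF sG, of r] r by blast
qed

end

section \<open>Derivations of the complex numbers\<close>

definition derivation :: "(complex \<Rightarrow> complex) \<Rightarrow> bool" where
  "derivation D \<longleftrightarrow> (\<forall>x y. D (x + y) = D x + D y) \<and> (\<forall>x y. D (x * y) = D x * y + x * D y)"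

definition ders :: "complex set \<Rightarrow> (complex \<Rightarrow> complex) set" where
  "ders X = {D. derivation D \<and> (\<forall>x\<in>X. D x = 0)}"

lemma der_add: "D \<in> ders X \<Longrightarrow> D (x + y) = D x + D y"
  and der_mult: "D \<in> ders X \<Longrightarrow> D (x * y) = D x * y + x * D y"
  and der_const: "D \<in> ders X \<Longrightarrow> x \<in> X \<Longrightarrow> D x = 0"
  by (auto simp: ders_def derivation_def)

lemma ders_mono: "D \<in> ders X \<Longrightarrow> Y \<subseteq> X \<Longrightarrow> D \<in> ders Y"
  by (auto simp: ders_def)

lemma ders_Un: "D \<in> ders (X \<union> Y) \<longleftrightarrow> D \<in> ders X \<and> (\<forall>y\<in>Y. D y = 0)"
  by (auto simp: ders_def)

lemma der_zero: "D \<in> ders X \<Longrightarrow> D 0 = 0"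
  using der_add[of D X 0 0] by simp

lemma der_one: "D \<in> ders X \<Longrightarrow> D 1 = 0"
  using der_mult[of D X 1 1] by simp

lemma der_uminus: "D \<in> ders X \<Longrightarrow> D (- x) = - D x"
  using der_add[of D X x "- x"] der_zero[of D X] by (simp add: eq_neg_iff_add_eq_0 add.commute)

lemma der_diff: "D \<in> ders X \<Longrightarrow> D (x - y) = D x - D y"
  using der_add[of D X x "- y"] der_uminus by simp

lemma der_sum: "D \<in> ders X \<Longrightarrow> D (sum f I) = (\<Sum>i\<in>I. D (f i))"
  by (induction I rule: infinite_finite_induct) (auto simp: der_zero der_add)

lemma der_imaginary: "D \<in> ders X \<Longrightarrow> D \<i> = 0"
  using der_mult[of D X \<i> \<i>] der_uminus[of D X 1] der_one[of D X] by (simp add: algebra_simps)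

lemma der_of_nat: "D \<in> ders X \<Longrightarrow> D (of_nat n) = 0"
  by (induction n) (simp_all add: der_zero der_add der_one)

lemma lspace_ders: "lspace (ders X)"
  by (auto simp: lspace_def ders_def derivation_def algebra_simps)

lemma lfun_eval: "lfun W (\<lambda>D. D x)"
  by (simp add: lfun_def)

text \<open>Applying \<open>D\<close> to \<open>poly p x = 0\<close> gives
  \<open>poly (pderiv p) x * D x = 0\<close>; at a multiple root the argument descends to
  \<open>pderiv p\<close>.\<close>

lemma der_root:
  assumes "D \<in> ders X" "p \<noteq> 0" "\<forall>i. D (coeff p i) = 0" "poly p x = 0"
  shows "D x = 0"
  using assms(2-)
proof (induction "degree p" arbitrary: p rule: less_induct)
  case less
  have ev: "D (poly p x) = poly (pderiv p) x * D x" if "\<forall>i. D (coeff p i) = 0" for p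
    using that
  proof (induction p)
    case 0
    then show ?case by (simp add: der_zero[OF assms(1)])
  next
    case (pCons a p)
    have "\<forall>i. D (coeff p i) = 0" "D a = 0"
      using spec[OF pCons.prems, of "Suc i" for i] spec[OF pCons.prems, of 0] by auto
    then show ?case using pCons.IH
      by (simp add: der_add[OF assms(1)] der_mult[OF assms(1)] pderiv_pCons algebra_simps)
  qed
  show ?case
  proof (cases "poly (pderiv p) x = 0")
    case False
    then show ?thesis using ev[OF less.prems(2)] less.prems(3) der_zero[OF assms(1)] by simp
  next
    case True
    have dp: "degree p > 0"
    proof (rule ccontr)
      assume "\<not> degree p > 0"
      then obtain c where "p = [:c:]" by (metis degree_eq_zeroE neq0_conv)
      then show False using less.prems by simp
    qed
    then have "pderiv p \<noteq> 0" "degree (pderiv p) < degree p"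
      by (auto simp: pderiv_eq_0_iff degree_pderiv)
    moreover have "\<forall>i. D (coeff (pderiv p) i) = 0"
      using less.prems(2) by (simp add: coeff_pderiv der_mult[OF assms(1)] der_add[OF assms(1)] der_one[OF assms(1)] der_of_nat[OF assms(1)])
    ultimately show ?thesis using less.hyps True by blast
  qed
qed

section \<open>Dual numbers and the extension of derivations\<close>

datatype dual = Dual (dre: complex) (deps: complex)

instantiation dual :: comm_ring_1
begin
definition "0 = Dual 0 0"
definition "1 = Dual 1 0"
definition "x + y = Dual (dre x + dre y) (deps x + deps y)"
definition "x - y = Dual (dre x - dre y) (deps x - deps y)"
definition "- x = Dual (- dre x) (- deps x)"
definition "x * y = Dual (dre x * dre y) (dre x * deps y + deps x * dre y)"
instance
  by standard (simp_all add: zero_dual_def one_dual_def plus_dual_def minus_dual_def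
      uminus_dual_def times_dual_def dual.expand algebra_simps)
end

lemmas dual_defs = zero_dual_def one_dual_def plus_dual_def minus_dual_def times_dual_def

lemma dual_unit: "dre x \<noteq> 0 \<Longrightarrow> x dvd 1"
  by (rule dvdI[of _ _ "Dual (1 / dre x) (- deps x / (dre x)^2)"])
    (simp add: dual_defs field_simps power2_eq_square)

interpretation dual: root_lifting dre
proof
  fix p :: "dual poly" and \<alpha>
  assume p: "poly (map_poly dre p) \<alpha> = 0" "poly (pderiv (map_poly dre p)) \<alpha> \<noteq> 0"
  have re: "dre (poly q (Dual \<alpha> b)) = poly (map_poly dre q) \<alpha>" for q b
    by (induction q) (simp_all add: map_poly_pCons dual_defs)
  have eps: "deps (poly q (Dual \<alpha> b)) = deps (poly q (Dual \<alpha> 0)) + poly (pderiv (map_poly dre q)) \<alpha> * b" for q b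
  proof (induction q)
    case (pCons a q)
    then show ?case by (simp add: map_poly_pCons dual_defs pderiv_pCons re[unfolded dual_defs] algebra_simps)
  qed (simp_all add: dual_defs)
  define b where "b = - deps (poly p (Dual \<alpha> 0)) / poly (pderiv (map_poly dre p)) \<alpha>"
  have "deps (poly p (Dual \<alpha> b)) = 0" unfolding eps[of p b] using p by (simp add: b_def)
  then have "poly p (Dual \<alpha> b) = 0" using re[of p b] p by (simp add: dual_defs dual.expand)
  then show "\<exists>r. dre r = \<alpha> \<and> poly p r = 0" by (intro exI[of _ "Dual \<alpha> b"]) simp
qed (auto simp: dual_defs)

text \<open>Since \<open>x\<close> is transcendental over \<open>K\<close>, the ring generated by
  \<open>K\<close> and \<open>Dual x 1\<close> consists of zero and units. A maximal extension
  projects onto all complex numbers, and injectively, because an element with first component zero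
  is no unit; it is the graph of the derivation.\<close>

lemma derivation_exists:
  assumes K: "subring_of K" and x: "\<And>p. over K p \<Longrightarrow> p \<noteq> 0 \<Longrightarrow> poly p x \<noteq> 0"
  shows "\<exists>D\<in>ders K. D x = 1"
proof -
  let ?G0 = "(\<lambda>k. Dual k 0) ` K"
  have u0: "unit_ring ?G0"
    using K by (auto simp: unit_ring_def subring_of_def dual_defs image_iff dual_unit[unfolded dual_defs])
  have "unit_ring {poly p (Dual x 1) |p. over ?G0 p}"
  proof (rule unit_ring_adjoin[OF u0])
    fix p assume p: "over ?G0 p" "poly p (Dual x 1) \<noteq> 0"
    have "over K (map_poly dre p)"
      using p(1) by (auto simp: over_def coeff_map_poly dual.\<pi>_zero image_iff) (metis dual.sel(1))
    moreover have "map_poly dre p \<noteq> 0"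
    proof
      assume 0: "map_poly dre p = 0"
      have "coeff p i = 0" for i
      proof -
        have "dre (coeff p i) = 0" using 0 coeff_map_poly[of dre p i] dual.\<pi>_zero by simp
        moreover obtain k where "coeff p i = Dual k 0" using p(1) by (auto simp: over_def)
        ultimately show ?thesis by (simp add: dual_defs)
      qed
      then show False using p(2) by (simp add: poly_eq_iff[of p 0, THEN iffD2])
    qed
    ultimately have "dre (poly p (Dual x 1)) \<noteq> 0" using x by (simp add: dual.\<pi>_poly)
    then show "poly p (Dual x 1) dvd 1" by (rule dual_unit)
  qed
  then obtain G where G: "maximal_unit_ring G" "{poly p (Dual x 1) |p. over ?G0 p} \<subseteq> G"
    using maximal_unit_ring_exists by blast
  have u: "unit_ring G" and sG: "subring_of G" using G by (auto simp: maximal_unit_ring_def unit_ring_def)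
  have ins: "insert (Dual x 1) ?G0 \<subseteq> G"
    by (rule order_trans[OF subset_adjoin G(2)]) (use u0 in \<open>simp add: unit_ring_def\<close>)
  \<comment> \<open>By relative closedness a missing \<open>\<alpha>\<close> is a root of no nonzero
    polynomial coming from \<open>G\<close>; it could then be adjoined with an arbitrary second
    component, here \<open>0\<close>.\<close>
  have ex: "\<exists>b. Dual \<alpha> b \<in> G" for \<alpha>
  proof (rule ccontr)
    assume no: "\<nexists>b. Dual \<alpha> b \<in> G"
    have "unit_ring {poly p (Dual \<alpha> 0) |p. over G p}"
    proof (rule unit_ring_adjoin[OF u])
      fix p assume p: "over G p" "poly p (Dual \<alpha> 0) \<noteq> 0"
      then have "p \<noteq> 0" by auto
      have "dre (poly p (Dual \<alpha> 0)) \<noteq> 0"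
      proof
        assume "dre (poly p (Dual \<alpha> 0)) = 0"
        then have "\<exists>r\<in>G. dre r = \<alpha>"
          by (intro dual.maximal_unit_ring_closed[OF G(1) p(1) \<open>p \<noteq> 0\<close>]) (simp add: dual.\<pi>_poly)
        then show False using no by (metis dual.collapse)
      qed
      then show "poly p (Dual \<alpha> 0) dvd 1" by (rule dual_unit)
    qed
    then have "Dual \<alpha> 0 \<in> G"
      using subset_adjoin[OF sG, of "Dual \<alpha> 0"] G(1) unfolding maximal_unit_ring_def by blast
    then show False using no by blast
  qed
  have uniq: "b = b'" if "Dual \<alpha> b \<in> G" "Dual \<alpha> b' \<in> G" for \<alpha> b b'
  proof -
    have "Dual 0 (b - b') \<in> G" using subring_minus[OF sG that] by (simp add: dual_defs)
    then have "Dual 0 (b - b') = 0" using dual.\<pi>_nonzero[OF u, of "Dual 0 (b - b')"] by auto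
    then show ?thesis by (simp add: dual_defs)
  qed
  define D where "D \<alpha> = (SOME b. Dual \<alpha> b \<in> G)" for \<alpha>
  have DG: "Dual \<alpha> (D \<alpha>) \<in> G" for \<alpha> unfolding D_def using someI_ex[OF ex] .
  have DI: "Dual \<alpha> b \<in> G \<Longrightarrow> D \<alpha> = b" for \<alpha> b using uniq DG by blast
  have "D (y + z) = D y + D z" for y z
    by (rule DI) (use subring_add[OF sG DG[of y] DG[of z]] in \<open>simp add: dual_defs\<close>)
  moreover have "D (y * z) = D y * z + y * D z" for y z
    by (rule DI) (use subring_mult[OF sG DG[of y] DG[of z]] in \<open>simp add: dual_defs add.commute\<close>)
  moreover have "D k = 0" if "k \<in> K" for k by (rule DI) (use ins that in auto)
  moreover have "D x = 1" by (rule DI) (use ins in auto)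
  ultimately have "D \<in> ders K" "D x = 1" by (simp_all add: ders_def derivation_def)
  then show ?thesis by blast
qed

section \<open>Generated subrings and algebraic elements\<close>

inductive_set rgen :: "complex set \<Rightarrow> complex set" for X where
  rgen_one: "1 \<in> rgen X"
| rgen_minus: "a \<in> rgen X \<Longrightarrow> b \<in> rgen X \<Longrightarrow> a - b \<in> rgen X"
| rgen_gen: "x \<in> X \<Longrightarrow> a \<in> rgen X \<Longrightarrow> x * a \<in> rgen X"

lemma rgen_base: "x \<in> X \<Longrightarrow> x \<in> rgen X"
  using rgen_gen[OF _ rgen_one] by simp

lemma subring_rgen: "subring_of (rgen X)"
proof -
  have "a * b \<in> rgen X" if "a \<in> rgen X" "b \<in> rgen X" for a b
    using that by (induction) (auto simp: algebra_simps intro: rgen.intros)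
  then show ?thesis by (auto simp: subring_of_def intro: rgen.intros)
qed

lemma der_rgen: "a \<in> rgen X \<Longrightarrow> D \<in> ders X \<Longrightarrow> D a = 0"
  by (induction a rule: rgen.induct) (auto simp: der_one der_diff der_mult der_const)

lemma algebraic_over_rgen:
  assumes "\<And>D. D \<in> ders X \<Longrightarrow> D x = 0"
  shows "\<exists>p. over (rgen X) p \<and> p \<noteq> 0 \<and> poly p x = 0"
proof (rule ccontr)
  assume "\<not> ?thesis"
  then obtain D where "D \<in> ders (rgen X)" "D x = 1"
    using derivation_exists[OF subring_rgen] by blast
  then show False using assms[of D] ders_mono[of D "rgen X" X] rgen_base by auto
qed

section \<open>Partial isomorphisms of the complex numbers\<close>

text \<open>The graph of an isomorphism between two subrings of the complex numbers: the clauses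
  about zero make it single-valued and injective.\<close>

definition field_rel :: "(complex \<Rightarrow> complex \<Rightarrow> bool) \<Rightarrow> bool" where
  "field_rel R \<longleftrightarrow> R 1 1 \<and> (\<forall>x y x' y'. R x y \<longrightarrow> R x' y' \<longrightarrow> R (x - x') (y - y') \<and> R (x * x') (y * y')) \<and>
     (\<forall>y. R 0 y \<longrightarrow> y = 0) \<and> (\<forall>x. R x 0 \<longrightarrow> x = 0)"

lemma field_rel_one: "field_rel R \<Longrightarrow> R 1 1"
  and field_rel_diff: "field_rel R \<Longrightarrow> R x y \<Longrightarrow> R x' y' \<Longrightarrow> R (x - x') (y - y')"
  and field_rel_mult: "field_rel R \<Longrightarrow> R x y \<Longrightarrow> R x' y' \<Longrightarrow> R (x * x') (y * y')"
  and field_rel_zero_left: "field_rel R \<Longrightarrow> R 0 y \<Longrightarrow> y = 0"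
  and field_rel_zero_right: "field_rel R \<Longrightarrow> R x 0 \<Longrightarrow> x = 0"
  by (auto simp: field_rel_def)

lemma field_rel_zero: "field_rel R \<Longrightarrow> R 0 0"
  using field_rel_diff[of R 1 1 1 1] field_rel_one[of R] by simp

lemma field_rel_add: "field_rel R \<Longrightarrow> R x y \<Longrightarrow> R x' y' \<Longrightarrow> R (x + x') (y + y')"
  using field_rel_diff[of R x y "0 - x'" "0 - y'"] field_rel_diff[of R 0 0 x' y'] field_rel_zero[of R] by simp

lemma field_rel_sum: "field_rel R \<Longrightarrow> (\<And>i. i \<in> I \<Longrightarrow> R (f i) (g i)) \<Longrightarrow> R (sum f I) (sum g I)"
  by (induction I rule: infinite_finite_induct) (auto intro: field_rel_add field_rel_zero)

lemma field_rel_left_unique: "field_rel R \<Longrightarrow> R x y \<Longrightarrow> R x' y \<Longrightarrow> x = x'"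
  by (metis field_rel_diff field_rel_zero_right diff_self eq_iff_diff_eq_0)

lemma field_rel_right_unique: "field_rel R \<Longrightarrow> R x y \<Longrightarrow> R x y' \<Longrightarrow> y = y'"
  by (metis field_rel_diff field_rel_zero_left diff_self eq_iff_diff_eq_0)

lemma field_rel_rgen:
  assumes "field_rel R" "\<And>x. x \<in> X \<Longrightarrow> R x x" "a \<in> rgen X" shows "R a a"
  using assms(3)
  by induction (simp_all add: field_rel_one field_rel_diff field_rel_mult assms(1,2))

lemma field_rel_poly:
  assumes "field_rel R" "\<And>i. R (coeff p i) (coeff p' i)" "R x y"
  shows "R (poly p x) (poly p' y)"
  using assms(2)
proof (induction p arbitrary: p')
  case 0
  have "coeff p' i = 0" for i using 0[of i] field_rel_zero_left[OF assms(1)] by simp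
  then have "p' = 0" by (simp add: poly_eq_iff)
  then show ?case using field_rel_zero[OF assms(1)] by simp
next
  case (pCons a p)
  obtain a' q where p': "p' = pCons a' q" by (cases p')
  have "R a a'" "\<And>i. R (coeff p i) (coeff q i)"
    using pCons.prems[of 0] pCons.prems[of "Suc i" for i] by (auto simp: p')
  then show ?case
    using field_rel_add[OF assms(1) _ field_rel_mult[OF assms(1,3) pCons.IH]] by (simp add: p')
qed

section \<open>Pairs of complex numbers and the extension of partial isomorphisms\<close>

datatype cpair = CPair (cfst: complex) (csnd: complex)

instantiation cpair :: comm_ring_1
begin
definition "0 = CPair 0 0"
definition "1 = CPair 1 1"
definition "x + y = CPair (cfst x + cfst y) (csnd x + csnd y)"
definition "x - y = CPair (cfst x - cfst y) (csnd x - csnd y)"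
definition "- x = CPair (- cfst x) (- csnd x)"
definition "x * y = CPair (cfst x * cfst y) (csnd x * csnd y)"
instance
  by standard (simp_all add: zero_cpair_def one_cpair_def plus_cpair_def minus_cpair_def
      uminus_cpair_def times_cpair_def cpair.expand algebra_simps)
end

lemmas cpair_defs = zero_cpair_def one_cpair_def plus_cpair_def minus_cpair_def times_cpair_def

lemma cpair_unit: "x dvd 1 \<longleftrightarrow> cfst x \<noteq> 0 \<and> csnd x \<noteq> 0"
proof
  assume "x dvd 1"
  then obtain y where "1 = x * y" by (auto elim: dvdE)
  then show "cfst x \<noteq> 0 \<and> csnd x \<noteq> 0" by (auto simp: cpair_defs)
next
  assume "cfst x \<noteq> 0 \<and> csnd x \<noteq> 0"
  then show "x dvd 1" by (intro dvdI[of _ _ "CPair (1 / cfst x) (1 / csnd x)"]) (simp add: cpair_defs)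
qed

lemma cfst_poly: "cfst (poly q r) = poly (map_poly cfst q) (cfst r)"
  by (induction q) (simp_all add: map_poly_pCons cpair_defs)

lemma csnd_poly: "csnd (poly q r) = poly (map_poly csnd q) (csnd r)"
  by (induction q) (simp_all add: map_poly_pCons cpair_defs)

interpretation cpair: root_lifting cfst
proof
  fix p :: "cpair poly" and \<alpha>
  assume p: "degree p > 0" "lead_coeff p dvd 1" "poly (map_poly cfst p) \<alpha> = 0"
  have "coeff (map_poly csnd p) (degree p) \<noteq> 0"
    using p(2) by (simp add: coeff_map_poly zero_cpair_def cpair_unit)
  then have "degree (map_poly csnd p) \<noteq> 0" using p(1) le_degree[of "map_poly csnd p" "degree p"] by simp
  then obtain \<beta> where "poly (map_poly csnd p) \<beta> = 0"
    using fundamental_theorem_of_algebra[of "map_poly csnd p"] constant_degree[of "map_poly csnd p"] by metis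
  then have "poly p (CPair \<alpha> \<beta>) = 0"
    using p(3) cfst_poly[of p "CPair \<alpha> \<beta>"] csnd_poly[of p "CPair \<alpha> \<beta>"] by (simp add: cpair_defs cpair.expand)
  then show "\<exists>r. cfst r = \<alpha> \<and> poly p r = 0" by (intro exI[of _ "CPair \<alpha> \<beta>"]) simp
qed (auto simp: cpair_defs)

text \<open>The clauses on derivations carry the induction: the components of \<open>G\<close> are
  algebraic over the numbers adjoined so far, so the next \<open>a j\<close> and \<open>b j\<close>
  are roots of no nonzero polynomial with such coefficients.\<close>

lemma unit_ring_generic_pairs:
  assumes "finite J" "onto (ders X) J (\<lambda>j D. D (a j))" "onto (ders X) J (\<lambda>j D. D (b j))"
  shows "\<exists>G. unit_ring G \<and> (\<forall>x\<in>X. CPair x x \<in> G) \<and> (\<forall>j\<in>J. CPair (a j) (b j) \<in> G) \<and>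
    (\<forall>g\<in>G. (\<forall>D\<in>ders (X \<union> a ` J). D (cfst g) = 0) \<and> (\<forall>D\<in>ders (X \<union> b ` J). D (csnd g) = 0))"
  using assms
proof (induction J rule: finite_induct)
  case empty
  have "unit_ring ((\<lambda>k. CPair k k) ` rgen X)"
    using subring_rgen[of X] by (auto simp: unit_ring_def subring_of_def cpair_defs image_iff cpair_unit[unfolded one_cpair_def])
  then show ?case
    by (intro exI[of _ "(\<lambda>k. CPair k k) ` rgen X"]) (auto intro: rgen_base der_rgen)
next
  case (insert j J)
  have on: "onto (ders X) J (\<lambda>j D. D (a j))" "onto (ders X) J (\<lambda>j D. D (b j))"
    using insert.prems onto_mono by blast+
  obtain G where G: "unit_ring G" "\<forall>x\<in>X. CPair x x \<in> G" "\<forall>j\<in>J. CPair (a j) (b j) \<in> G"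
    "\<And>g D. g \<in> G \<Longrightarrow> D \<in> ders (X \<union> a ` J) \<Longrightarrow> D (cfst g) = 0"
    "\<And>g D. g \<in> G \<Longrightarrow> D \<in> ders (X \<union> b ` J) \<Longrightarrow> D (csnd g) = 0"
    using insert.IH[OF on] by auto
  have sG: "subring_of G" using G by (simp add: unit_ring_def)
  let ?r = "CPair (a j) (b j)"
  let ?H = "{poly p ?r |p. over G p}"
  obtain Da where Da: "Da \<in> ders X" "\<forall>i\<in>insert j J. Da (a i) = (if i = j then 1 else 0)"
    using ontoD[OF insert.prems(1), of "\<lambda>i. if i = j then 1 else 0"] by blast
  obtain Db where Db: "Db \<in> ders X" "\<forall>i\<in>insert j J. Db (b i) = (if i = j then 1 else 0)"
    using ontoD[OF insert.prems(2), of "\<lambda>i. if i = j then 1 else 0"] by blast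
  have Da': "Da \<in> ders (X \<union> a ` J)" and Db': "Db \<in> ders (X \<union> b ` J)"
    using Da Db insert.hyps by (auto simp: ders_Un)
  have "unit_ring ?H"
  proof (rule unit_ring_adjoin[OF G(1)])
    fix p assume p: "over G p" "poly p ?r \<noteq> 0"
    then obtain i where i: "coeff p i \<noteq> 0" by (metis poly_0 poly_eq_iff coeff_0)
    have "coeff p i dvd 1" using p(1) i G(1) by (auto simp: over_def unit_ring_def)
    then have nz: "map_poly cfst p \<noteq> 0" "map_poly csnd p \<noteq> 0"
      by (auto simp: cpair_unit poly_eq_iff coeff_map_poly zero_cpair_def)
    have "poly (map_poly cfst p) (a j) \<noteq> 0"
      using der_root[OF Da' nz(1), of "a j"] Da(2) p(1) G(4)[OF _ Da']
      by (auto simp: over_def coeff_map_poly cpair_defs)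
    moreover have "poly (map_poly csnd p) (b j) \<noteq> 0"
      using der_root[OF Db' nz(2), of "b j"] Db(2) p(1) G(5)[OF _ Db']
      by (auto simp: over_def coeff_map_poly cpair_defs)
    ultimately show "poly p ?r dvd 1" by (simp add: cpair_unit cfst_poly csnd_poly)
  qed
  moreover have "insert ?r G \<subseteq> ?H" by (rule subset_adjoin[OF sG])
  moreover have "D (cfst (poly p ?r)) = 0" if "over G p" "D \<in> ders (X \<union> a ` insert j J)" for p D
    using that(1)
  proof (induction p)
    case (pCons c p)
    have "D (cfst c) = 0" by (rule G(4)) (use pCons.prems that(2) in \<open>auto simp: over_pCons ders_def\<close>)
    moreover have "D (a j) = 0" using that(2) by (auto simp: ders_def)
    ultimately show ?case using pCons
      by (simp add: over_pCons cpair_defs der_add[OF that(2)] der_mult[OF that(2)])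
  qed (simp add: cpair_defs der_zero[OF that(2)])
  moreover have "D (csnd (poly p ?r)) = 0" if "over G p" "D \<in> ders (X \<union> b ` insert j J)" for p D
    using that(1)
  proof (induction p)
    case (pCons c p)
    have "D (csnd c) = 0" by (rule G(5)) (use pCons.prems that(2) in \<open>auto simp: over_pCons ders_def\<close>)
    moreover have "D (b j) = 0" using that(2) by (auto simp: ders_def)
    ultimately show ?case using pCons
      by (simp add: over_pCons cpair_defs der_add[OF that(2)] der_mult[OF that(2)])
  qed (simp add: cpair_defs der_zero[OF that(2)])
  ultimately show ?case using G(2,3) by (intro exI[of _ ?H]) auto
qed

text \<open>\<open>R\<close> is the relation given by a maximal ring of pairs. Relative closedness
  of its first projection puts every number algebraic over \<open>X\<close> and the
  \<open>a j\<close> into the domain.\<close>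

lemma partial_isomorphism:
  assumes "finite J" "onto (ders X) J (\<lambda>j D. D (a j))" "onto (ders X) J (\<lambda>j D. D (b j))"
  obtains R where "field_rel R" "\<And>x. x \<in> X \<Longrightarrow> R x x" "\<And>j. j \<in> J \<Longrightarrow> R (a j) (b j)"
    "\<And>x. (\<And>D. D \<in> ders (X \<union> a ` J) \<Longrightarrow> D x = 0) \<Longrightarrow> \<exists>y. R x y"
proof -
  obtain G0 where G0: "unit_ring G0" "\<forall>x\<in>X. CPair x x \<in> G0" "\<forall>j\<in>J. CPair (a j) (b j) \<in> G0"
    using unit_ring_generic_pairs[OF assms] by blast
  obtain G where G: "maximal_unit_ring G" "G0 \<subseteq> G" using maximal_unit_ring_exists[OF G0(1)] by blast
  have u: "unit_ring G" and sG: "subring_of G" using G by (auto simp: maximal_unit_ring_def unit_ring_def)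
  let ?R = "\<lambda>x y. CPair x y \<in> G"
  have "field_rel ?R"
    unfolding field_rel_def
  proof (intro conjI allI impI)
    show "?R 1 1" using subring_one[OF sG] by (simp add: cpair_defs)
    show "?R (x - x') (y - y')" "?R (x * x') (y * y')" if "?R x y" "?R x' y'" for x y x' y'
      using subring_minus[OF sG that] subring_mult[OF sG that] by (simp_all add: cpair_defs)
    show "y = 0" if "?R 0 y" for y
      using u that cpair_unit[of "CPair 0 y"] by (auto simp: unit_ring_def cpair_defs)
    show "x = 0" if "?R x 0" for x
      using u that cpair_unit[of "CPair x 0"] by (auto simp: unit_ring_def cpair_defs)
  qed
  moreover have "\<exists>y. ?R x y" if x: "\<And>D. D \<in> ders (X \<union> a ` J) \<Longrightarrow> D x = 0" for x
  proof -
    obtain p where p: "over (rgen (X \<union> a ` J)) p" "p \<noteq> 0" "poly p x = 0"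
      using algebraic_over_rgen[of "X \<union> a ` J" x] x by blast
    have sub: "subring_of (cfst ` G)"
      using sG unfolding subring_of_def
      by (auto simp: image_iff cpair_defs) (metis cpair.sel(1))+
    have img: "c \<in> cfst ` G" if "c \<in> rgen (X \<union> a ` J)" for c
      using that
    proof induction
      case (rgen_gen y c)
      have "y \<in> cfst ` G" using rgen_gen(1) G0 G(2) by (force simp: image_iff)
      then show ?case using rgen_gen sub by (intro subring_mult) auto
    qed (auto intro: subring_one[OF sub] subring_minus[OF sub])
    then have "\<forall>i. \<exists>g\<in>G. cfst g = coeff p i" using p(1) unfolding over_def by (metis imageE)
    then obtain g where g: "\<And>i. g i \<in> G" "\<And>i. cfst (g i) = coeff p i" by metis
    define q where "q = Poly (map g [0..<Suc (degree p)])"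
    have cq: "coeff q i = (if i \<le> degree p then g i else 0)" for i
      by (simp add: q_def nth_default_def less_Suc_eq_le del: upt_Suc)
    have "map_poly cfst q = p"
      by (rule poly_eqI) (auto simp: coeff_map_poly cpair_defs cq g coeff_eq_0)
    moreover have "over G q" using g subring_zero[OF sG] by (simp add: over_def cq)
    moreover have "q \<noteq> 0" using p(2) calculation(1) by auto
    ultimately obtain r where "r \<in> G" "cfst r = x"
      using cpair.maximal_unit_ring_closed[OF G(1), of q x] p(3) by auto
    then show ?thesis by (metis cpair.collapse)
  qed
  ultimately show ?thesis using that[of ?R] G0 G(2) by blast
qed

text \<open>By \<open>alg\<close>, all coordinates of a solution lie in the domain of a partial
  isomorphism taking \<open>a\<close> to \<open>b\<close>. Applying it coordinatewise is injective,
  and \<open>pres\<close> says that the equations survive.\<close>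

lemma solution_set_injection:
  assumes "finite J" "onto (ders X) J (\<lambda>j D. D (a j))" "onto (ders X) J (\<lambda>j D. D (b j))"
    and alg: "\<And>q k D. q \<in> Q \<Longrightarrow> D \<in> ders X \<Longrightarrow> (\<forall>j\<in>J. D (a j) = 0) \<Longrightarrow> D (q k) = 0"
    and pres: "\<And>R q q'. field_rel R \<Longrightarrow> (\<And>x. x \<in> X \<Longrightarrow> R x x) \<Longrightarrow> (\<And>j. j \<in> J \<Longrightarrow> R (a j) (b j)) \<Longrightarrow>
      q \<in> Q \<Longrightarrow> (\<And>k. R (q k) (q' k)) \<Longrightarrow> q' \<in> Q'"
  shows "\<exists>h. inj_on h Q \<and> h ` Q \<subseteq> Q'"
proof -
  obtain R where R: "field_rel R" "\<And>x. x \<in> X \<Longrightarrow> R x x" "\<And>j. j \<in> J \<Longrightarrow> R (a j) (b j)"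
    "\<And>x. (\<And>D. D \<in> ders (X \<union> a ` J) \<Longrightarrow> D x = 0) \<Longrightarrow> \<exists>y. R x y"
    using partial_isomorphism[OF assms(1-3)] by blast
  define h where "h q = (\<lambda>k. SOME y. R (q k) y)" for q :: "'b \<Rightarrow> complex"
  have h: "R (q k) (h q k)" if "q \<in> Q" for q k
    unfolding h_def by (rule someI_ex, rule R(4)) (use alg[OF that] in \<open>auto simp: ders_Un\<close>)
  have "inj_on h Q"
  proof (rule inj_onI)
    fix q q' assume q: "q \<in> Q" "q' \<in> Q" "h q = h q'"
    show "q = q'"
      by (rule ext) (metis h[OF q(1)] h[OF q(2)] q(3) field_rel_left_unique[OF R(1)])
  qed
  moreover have "h ` Q \<subseteq> Q'" using pres[OF R(1-3)] h by blast
  ultimately show ?thesis by blast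
qed

section \<open>Generic real numbers\<close>

lemma countable_rgen:
  assumes "countable X" shows "countable (rgen X)"
proof -
  define step where "step S = S \<union> (\<lambda>(a, b). a - b) ` (S \<times> S) \<union> (\<lambda>(x, a). x * a) ` (X \<times> S)" for S :: "complex set"
  define K where "K n = (step ^^ n) {1}" for n
  have cK: "countable (K n)" for n
    unfolding K_def by (induction n) (use assms in \<open>auto simp: step_def\<close>)
  have mono: "K n \<subseteq> K (n + m)" for n m
    by (induction m) (auto simp: K_def step_def)
  have "a \<in> (\<Union>n. K n)" if "a \<in> rgen X" for a
    using that
  proof induction
    case rgen_one
    have "1 \<in> K 0" by (simp add: K_def)
    then show ?case by blast
  next
    case (rgen_minus a b)
    then obtain m n where "a \<in> K m" "b \<in> K n" by auto
    then have "a \<in> K (m + n)" "b \<in> K (m + n)" using mono[of m n] mono[of n m] by (auto simp: add.commute)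
    then have "a - b \<in> K (Suc (m + n))" by (force simp: K_def step_def)
    then show ?case by blast
  next
    case (rgen_gen x a)
    then obtain m where "a \<in> K m" by auto
    then have "x * a \<in> K (Suc m)" using rgen_gen(1) by (force simp: K_def step_def)
    then show ?case by blast
  qed
  then have "rgen X \<subseteq> (\<Union>n. K n)" by blast
  then show ?thesis using cK by (meson countable_UN countable_subset uncountable_def UNIV_I countableI_type)
qed

lemma countable_roots:
  assumes "countable (K :: complex set)"
  shows "countable {x. \<exists>p. over K p \<and> p \<noteq> 0 \<and> poly p x = 0}"
proof -
  have "{p. over K p} \<subseteq> Poly ` lists K"
  proof
    fix p assume "p \<in> {p. over K p}"
    then have "set (coeffs p) \<subseteq> K" using range_coeff[of p] by (auto simp: over_def coeffs_def)
    then show "p \<in> Poly ` lists K" by (intro image_eqI[of _ _ "coeffs p"]) (auto simp: in_lists_conv_set)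
  qed
  then have "countable {p. over K p}" using assms by (meson countable_image countable_lists countable_subset)
  then have "countable (\<Union>p\<in>{p. over K p} - {0}. {x. poly p x = 0})"
    by (intro countable_UN) (auto intro: countable_finite poly_roots_finite)
  moreover have "{x. \<exists>p. over K p \<and> p \<noteq> 0 \<and> poly p x = 0} = (\<Union>p\<in>{p. over K p} - {0}. {x. poly p x = 0})"
    by auto
  ultimately show ?thesis by simp
qed

text \<open>Only countably many numbers are algebraic over a finite set, while the interval is
  uncountable.\<close>

lemma generic_negative_real:
  assumes "finite X"
  shows "\<exists>r<0. \<exists>D\<in>ders X. D (complex_of_real r) = 1"
proof -
  let ?Z = "{x. \<exists>p. over (rgen X) p \<and> p \<noteq> 0 \<and> poly p x = 0}"
  have c: "countable ?Z" by (intro countable_roots countable_rgen countable_finite assms)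
  have "\<exists>r\<in>{-1<..<0}. complex_of_real r \<notin> ?Z"
  proof (rule ccontr)
    assume "\<not> ?thesis"
    then have "complex_of_real ` {-1<..<0} \<subseteq> ?Z" by auto
    then have "countable (complex_of_real ` {-1<..<0})" using c countable_subset by blast
    then have "countable {-1<..<0::real}" by (rule countable_image_inj_on) (auto simp: inj_on_def)
    then show False using uncountable_open_interval[of "-1" 0] by simp
  qed
  then obtain r where r: "r < 0" "complex_of_real r \<notin> ?Z" by auto
  then obtain D where "D \<in> ders (rgen X)" "D (complex_of_real r) = 1"
    using derivation_exists[OF subring_rgen, of X "complex_of_real r"] by blast
  moreover have "D \<in> ders X" using calculation ders_mono rgen_base by blast
  ultimately show ?thesis using r by blast
qed

lemma generic_negative_reals:
  assumes "finite J" "finite X"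
  shows "\<exists>r. (\<forall>j. r j < 0) \<and> onto (ders X) J (\<lambda>j D. D (complex_of_real (r j)))"
  using assms
proof (induction J arbitrary: X rule: finite_induct)
  case empty
  then show ?case using lspace_ders[of X] by (auto simp: onto_def lspace_def intro: exI[of _ "\<lambda>_. -1"])
next
  case (insert j J)
  obtain t D0 where t: "t < 0" "D0 \<in> ders X" "D0 (complex_of_real t) = 1"
    using generic_negative_real[OF insert.prems] by blast
  obtain r where r: "\<And>j. r j < 0"
    "onto (ders (insert (complex_of_real t) X)) J (\<lambda>j D. D (complex_of_real (r j)))"
    using insert.IH[of "insert (complex_of_real t) X"] insert.prems by auto
  have "onto (ders X) (insert j J) (\<lambda>i D. D (complex_of_real ((r(j := t)) i)))"
    unfolding onto_def
  proof
    fix \<delta>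
    obtain D where D: "D \<in> ders (insert (complex_of_real t) X)"
      "\<forall>i\<in>J. D (complex_of_real (r i)) = \<delta> i - \<delta> j * D0 (complex_of_real (r i))"
      using ontoD[OF r(2), of "\<lambda>i. \<delta> i - \<delta> j * D0 (complex_of_real (r i))"] by blast
    have DX: "D \<in> ders X" "D (complex_of_real t) = 0" using D(1) by (auto simp: ders_def)
    have "(\<lambda>x. \<delta> j * D0 x + D x) \<in> ders X" by (rule lspaceD[OF lspace_ders t(2) DX(1)])
    moreover have "\<forall>i\<in>insert j J. \<delta> j * D0 (complex_of_real ((r(j := t)) i)) + D (complex_of_real ((r(j := t)) i)) = \<delta> i"
      using D(2) DX(2) t(3) insert.hyps by auto
    ultimately show "\<exists>D\<in>ders X. \<forall>i\<in>insert j J. D (complex_of_real ((r(j := t)) i)) = \<delta> i"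
      by (intro bexI[of _ "\<lambda>x. \<delta> j * D0 x + D x"])
  qed
  then show ?case using r t by (intro exI[of _ "r(j := t)"]) auto
qed

section \<open>Fibres of the length map of a pinned graph\<close>

lemma even_card_involution:
  assumes "finite Q" "\<And>q. q \<in> Q \<Longrightarrow> \<tau> q \<in> Q \<and> \<tau> (\<tau> q) = q \<and> \<tau> q \<noteq> q"
  shows "even (card Q)"
  using assms
proof (induction "card Q" arbitrary: Q rule: less_induct)
  case less
  show ?case
  proof (cases "Q = {}")
    case False
    then obtain q where q: "q \<in> Q" by auto
    have t: "\<tau> q \<in> Q" "\<tau> (\<tau> q) = q" "\<tau> q \<noteq> q" using less.prems(2)[OF q] by auto
    let ?Q = "Q - {q, \<tau> q}"
    have c: "card ?Q = card Q - 2" using q t less.prems(1) by (simp add: card_Diff_subset)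
    have "card {q, \<tau> q} \<le> card Q" by (rule card_mono) (use q t less.prems(1) in auto)
    then have ge: "card Q \<ge> 2" using t by simp
    have "even (card ?Q)"
    proof (rule less.hyps)
      show "card ?Q < card Q" using c ge by simp
      show "finite ?Q" using less.prems(1) by simp
      fix p assume p: "p \<in> ?Q"
      then have *: "\<tau> p \<in> Q" "\<tau> (\<tau> p) = p" "\<tau> p \<noteq> p" using less.prems(2)[of p] by auto
      then have "\<tau> p \<noteq> q" "\<tau> p \<noteq> \<tau> q" using p t by auto
      then show "\<tau> p \<in> ?Q \<and> \<tau> (\<tau> p) = p \<and> \<tau> p \<noteq> p" using * by simp
    qed
    then show ?thesis using c ge by presburger
  qed simp
qed

declare split_paired_Ball_Sigma [simp del] split_paired_All [simp del] split_paired_all [simp del]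

locale pinned_graph =
  fixes V :: "'v set" and d :: nat and E :: "'e set" and fst_end snd_end :: "'e \<Rightarrow> 'v" and B :: "'v set"
  assumes finite_V: "finite V" and finite_E: "finite E" and BV: "B \<subseteq> V"
    and ends: "e \<in> E \<Longrightarrow> fst_end e \<in> V" "e \<in> E \<Longrightarrow> snd_end e \<in> V"
begin

abbreviation "I \<equiv> V \<times> {..<d}"
abbreviation "Bc \<equiv> B \<times> {..<d}"
abbreviation "Fc \<equiv> (V - B) \<times> {..<d}"

text \<open>Polarisation of the squared length: \<open>bil z a e\<close> is the row of edge
  \<open>e\<close> in the rigidity matrix of \<open>z\<close>, applied to \<open>a\<close>.\<close>

definition bil :: "('v \<times> nat \<Rightarrow> complex) \<Rightarrow> ('v \<times> nat \<Rightarrow> complex) \<Rightarrow> 'e \<Rightarrow> complex" where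
  "bil p q e = (\<Sum>i<d. (p (fst_end e, i) - p (snd_end e, i)) * (q (fst_end e, i) - q (snd_end e, i)))"

definition len :: "('v \<times> nat \<Rightarrow> complex) \<Rightarrow> 'e \<Rightarrow> complex" where
  "len p e = bil p p e"

definition cfgs :: "('v \<times> nat \<Rightarrow> complex) set" where
  "cfgs = {p. \<forall>x. x \<notin> I \<longrightarrow> p x = 0}"

definition disps :: "('v \<times> nat \<Rightarrow> complex) set" where
  "disps = {p. \<forall>x. x \<notin> Fc \<longrightarrow> p x = 0}"

definition generic :: "('v \<times> nat \<Rightarrow> complex) \<Rightarrow> bool" where
  "generic z \<longleftrightarrow> z \<in> cfgs \<and> onto (ders {}) I (\<lambda>x D. D (z x))"

definition fibre :: "('v \<times> nat \<Rightarrow> complex) \<Rightarrow> ('v \<times> nat \<Rightarrow> complex) set" where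
  "fibre z = {q \<in> cfgs. (\<forall>x\<in>Bc. q x = z x) \<and> (\<forall>e\<in>E. len q e = len z e)}"

definition inf_rigid :: "('v \<times> nat \<Rightarrow> complex) \<Rightarrow> bool" where
  "inf_rigid z \<longleftrightarrow> (\<forall>a\<in>disps. (\<forall>e\<in>E. bil z a e = 0) \<longrightarrow> a = (\<lambda>_. 0))"

text \<open>These numbers generate a field of definition of the fibre of \<open>z\<close>.\<close>

definition base :: "('v \<times> nat \<Rightarrow> complex) \<Rightarrow> complex set" where
  "base z = z ` Bc \<union> len z ` E"

lemma cfgsD: "p \<in> cfgs \<Longrightarrow> x \<notin> I \<Longrightarrow> p x = 0"
  unfolding cfgs_def by blast

lemma dispsD: "a \<in> disps \<Longrightarrow> x \<notin> Fc \<Longrightarrow> a x = 0"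
  unfolding disps_def by blast

lemma fibreD:
  assumes "q \<in> fibre z"
  shows "q \<in> cfgs" "\<And>x. x \<in> Bc \<Longrightarrow> q x = z x" "\<And>e. e \<in> E \<Longrightarrow> len q e = len z e"
  using assms unfolding fibre_def by blast+

lemma fibreI:
  assumes "q \<in> cfgs" "\<And>x. x \<in> Bc \<Longrightarrow> q x = z x" "\<And>e. e \<in> E \<Longrightarrow> len q e = len z e"
  shows "q \<in> fibre z"
  using assms unfolding fibre_def by blast

lemma finite_index: "finite I" "finite Bc" "finite Fc"
  using finite_V BV by (auto intro: finite_subset)

lemma I_split: "I = Bc \<union> Fc"
  using BV by auto

lemma finite_base: "finite (base z)"
  unfolding base_def using finite_index finite_E by blast

lemma bil_add_right: "bil p (\<lambda>x. a x + b x) e = bil p a e + bil p b e"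
  by (simp add: bil_def algebra_simps sum.distrib sum_subtractf)

lemma bil_diff_right: "bil p (\<lambda>x. a x - b x) e = bil p a e - bil p b e"
  by (simp add: bil_def algebra_simps sum.distrib sum_subtractf)

lemma bil_scale_right: "bil p (\<lambda>x. c * a x) e = c * bil p a e"
  by (simp add: bil_def sum_distrib_left algebra_simps)

lemma bil_commute: "bil p q e = bil q p e"
  by (simp add: bil_def mult.commute)

lemma bil_zero_right: "bil p (\<lambda>_. 0) e = 0"
  by (simp add: bil_def)

lemma bil_cnj: "bil (\<lambda>x. cnj (p x)) (\<lambda>x. cnj (q x)) e = cnj (bil p q e)"
  by (simp add: bil_def)

lemma bil_sum_right: "bil p (\<lambda>x. \<Sum>k\<in>K. f k x) e = (\<Sum>k\<in>K. bil p (f k) e)"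
  by (induction K rule: infinite_finite_induct) (simp_all add: bil_zero_right bil_add_right)

lemma der_bil:
  assumes "D \<in> ders X"
  shows "D (bil p q e) = bil (D \<circ> p) q e + bil p (D \<circ> q) e"
  by (simp add: bil_def der_sum[OF assms] der_mult[OF assms] der_diff[OF assms] sum.distrib)

lemma der_len: "D \<in> ders X \<Longrightarrow> D (len p e) = 2 * bil p (D \<circ> p) e"
  using der_bil[of D X p p e] bil_commute[of "D \<circ> p" p e] by (simp add: len_def)

lemma field_rel_bil:
  assumes "field_rel R" "\<And>x. R (p x) (p' x)" "\<And>x. R (q x) (q' x)"
  shows "R (bil p q e) (bil p' q' e)"
  unfolding bil_def
  by (intro field_rel_sum[OF assms(1)] field_rel_mult[OF assms(1)] field_rel_diff[OF assms(1)] assms(2,3))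

lemma field_rel_len: "field_rel R \<Longrightarrow> (\<And>x. R (p x) (p' x)) \<Longrightarrow> R (len p e) (len p' e)"
  unfolding len_def by (rule field_rel_bil)

lemma der_comp_disps:
  assumes "D \<in> ders (z ` Bc)" "p \<in> cfgs" "\<And>x. x \<in> Bc \<Longrightarrow> p x = z x"
  shows "D \<circ> p \<in> disps"
  unfolding disps_def
proof (intro CollectI allI impI)
  fix x assume "x \<notin> Fc"
  then consider "x \<notin> I" | "x \<in> Bc" by (metis I_split Un_iff)
  then show "(D \<circ> p) x = 0"
    using der_zero[OF assms(1)] der_const[OF assms(1), of "z x"] cfgsD[OF assms(2)] assms(3)
    by cases auto
qed

lemma generic_cfgs: "generic z \<Longrightarrow> z \<in> cfgs"
  by (simp add: generic_def)

text \<open>Algebraically independent coordinates can be given arbitrary derivatives, so at a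
  generic configuration displacements and derivations are interchangeable.\<close>

lemma generic_der:
  assumes "generic z" "a \<in> disps"
  obtains D where "D \<in> ders (z ` Bc)" "D \<circ> z = a"
proof -
  obtain D where D: "D \<in> ders {}" "\<forall>x\<in>I. D (z x) = a x"
    using assms(1) ontoD[of "ders {}" I "\<lambda>x D. D (z x)" a] by (auto simp: generic_def)
  have "D \<circ> z = a"
  proof
    fix x show "(D \<circ> z) x = a x"
    proof (cases "x \<in> I")
      case True
      then show ?thesis using bspec[OF D(2) True] by simp
    next
      case False
      then have "z x = 0" "a x = 0"
        using assms cfgsD[of z x] dispsD[of a x] by (auto simp: generic_def I_split)
      then show ?thesis using der_zero[OF D(1)] by simp
    qed
  qed
  moreover have "D (z x) = 0" if "x \<in> Bc" for x
    using that D(2) dispsD[OF assms(2), of x] BV by auto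
  then have "D \<in> ders (z ` Bc)" using D(1) by (auto simp: ders_def)
  ultimately show ?thesis using that by blast
qed

text \<open>By \<open>der_len\<close>, a derivation killing the base data moves \<open>z\<close> by
  an infinitesimal flex. In other words, the coordinates are algebraic over the base data.\<close>

lemma inf_rigid_der:
  assumes "inf_rigid z" "z \<in> cfgs" "D \<in> ders (base z)"
  shows "D (z x) = 0"
proof -
  have D: "D \<in> ders (z ` Bc)" by (rule ders_mono[OF assms(3)]) (auto simp: base_def)
  have "bil z (D \<circ> z) e = 0" if "e \<in> E" for e
    using der_len[OF assms(3), of z e] der_const[OF assms(3), of "len z e"] that by (simp add: base_def)
  then have "D \<circ> z = (\<lambda>_. 0)" using assms(1) der_comp_disps[OF D assms(2)] by (simp add: inf_rigid_def)
  then show ?thesis by (metis comp_apply)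
qed

text \<open>A count of transcendence degrees. The base data together with the coordinates in
  \<open>J\<close> has full rank \<open>card I\<close> at \<open>z\<close>; putting independent
  values \<open>a\<close> on \<open>J\<close> keeps the rank. All these numbers are polynomials in
  the coordinates of \<open>q\<close>, which must therefore be independent, and conversely algebraic
  over them.\<close>

lemma fibre_generic:
  assumes z: "generic z" and J: "J \<subseteq> Fc"
    and oz: "onto (ders (base z)) J (\<lambda>x D. D (z x))"
    and kz: "\<forall>D\<in>ders (base z). (\<forall>x\<in>J. D (z x) = 0) \<longrightarrow> (\<forall>x. D (z x) = 0)"
    and oa: "onto (ders (base z)) J (\<lambda>x D. D (a x))"
    and q: "q \<in> fibre z" "\<forall>x\<in>J. q x = a x"
  shows "generic q" "\<And>D x. D \<in> ders (base z) \<Longrightarrow> \<forall>x\<in>J. D (a x) = 0 \<Longrightarrow> D (q x) = 0"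
proof -
  let ?W = "ders {}"
  define y where "y k D = (case k of Inl x \<Rightarrow> D (z x) | Inr e \<Rightarrow> D (len z e))"
    for k :: "'v \<times> nat + 'e" and D :: "complex \<Rightarrow> complex"
  have ly: "lfun W (y k)" for W k by (auto simp: y_def lfun_def split: sum.split)
  \<comment> \<open>The base data may satisfy algebraic relations, so an independent part is
    extracted before counting.\<close>
  have "\<exists>S\<subseteq>Bc <+> E. onto ?W S y \<and>
      (\<forall>D\<in>?W. (\<forall>k\<in>S. y k D = 0) \<longrightarrow> (\<forall>k\<in>Bc <+> E. y k D = 0))"
    by (rule onto_maximal_subset) (use finite_index finite_E lspace_ders ly in auto)
  then obtain S where S: "S \<subseteq> Bc <+> E" "onto ?W S y"
    "\<And>D k. D \<in> ?W \<Longrightarrow> (\<forall>k\<in>S. y k D = 0) \<Longrightarrow> k \<in> Bc <+> E \<Longrightarrow> y k D = 0" by blast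
  have finS: "finite S" "finite J" using S(1) J finite_index finite_E
    by (meson finite_Plus finite_subset)+
  have base_iff: "D \<in> ders (base z) \<longleftrightarrow> D \<in> ?W \<and> (\<forall>k\<in>Bc <+> E. y k D = 0)" for D
    by (auto simp: ders_def base_def y_def Plus_def ball_Un)
  define c where "c b k D = (case k of Inl k \<Rightarrow> y k D | Inr x \<Rightarrow> D (b x))"
    for b :: "'v \<times> nat \<Rightarrow> complex" and k :: "('v \<times> nat + 'e) + 'v \<times> nat" and D :: "complex \<Rightarrow> complex"
  have lc: "lfun W (c b k)" for W b k
    using ly by (auto simp: c_def lfun_def split: sum.split)
  have kc: "D \<in> ders (base z) \<and> (\<forall>x\<in>J. D (b x) = 0)"
    if "D \<in> ?W" "\<forall>k\<in>S <+> J. c b k D = 0" for D b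
  proof -
    have "y k D = 0" if "k \<in> S" for k using \<open>\<forall>k\<in>S <+> J. c b k D = 0\<close> that by (force simp: c_def)
    then have "D \<in> ders (base z)" using S(3) that(1) unfolding base_iff by blast
    moreover have "D (b x) = 0" if "x \<in> J" for x using \<open>\<forall>k\<in>S <+> J. c b k D = 0\<close> that by (force simp: c_def)
    ultimately show ?thesis by blast
  qed
  have "card I \<le> card (S <+> J)"
  proof (rule onto_card_le[where W = ?W and a = "\<lambda>x D. D (z x)" and b = "c z"])
    show "onto ?W I (\<lambda>x D. D (z x))" using z by (simp add: generic_def)
    show "D (z x) = 0" if "D \<in> ?W" "\<forall>k\<in>S <+> J. c z k D = 0" for D x
      using kc[OF that] kz by blast
  qed (use finS finite_index lspace_ders lfun_eval lc in auto)
  moreover have "onto ?W (S <+> J) (c a)"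
    unfolding onto_def
  proof
    fix \<delta> :: "('v \<times> nat + 'e) + 'v \<times> nat \<Rightarrow> complex"
    obtain D0 where D0: "D0 \<in> ?W" "\<forall>k\<in>S. y k D0 = \<delta> (Inl k)"
      using ontoD[OF S(2), of "\<lambda>k. \<delta> (Inl k)"] by blast
    obtain D1 where D1: "D1 \<in> ders (base z)" "\<forall>x\<in>J. D1 (a x) = \<delta> (Inr x) - D0 (a x)"
      using ontoD[OF oa, of "\<lambda>x. \<delta> (Inr x) - D0 (a x)"] by blast
    have D1': "D1 \<in> ?W" "\<And>k. k \<in> S \<Longrightarrow> y k D1 = 0" using D1(1) S(1) unfolding base_iff by auto
    have "(\<lambda>x. 1 * D0 x + D1 x) \<in> ?W" by (rule lspaceD[OF lspace_ders D0(1) D1'(1)])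
    moreover have "\<forall>k\<in>S <+> J. c a k (\<lambda>x. 1 * D0 x + D1 x) = \<delta> k"
    proof
      fix k assume "k \<in> S <+> J"
      then show "c a k (\<lambda>x. 1 * D0 x + D1 x) = \<delta> k"
      proof
        fix s assume s: "s \<in> S" "k = Inl s"
        then show ?thesis using lfunD[OF ly D0(1) D1'(1), of s 1] D0(2) D1'(2) by (simp add: c_def)
      next
        fix x assume x: "x \<in> J" "k = Inr x"
        then show ?thesis using D1(2) by (simp add: c_def)
      qed
    qed
    ultimately show "\<exists>D\<in>?W. \<forall>k\<in>S <+> J. c a k D = \<delta> k" by blast
  qed
  moreover have kq: "c a k D = 0" if "D \<in> ?W" "\<forall>x\<in>I. D (q x) = 0" "k \<in> S <+> J" for D k
  proof -
    have qc: "q \<in> cfgs" using fibreD(1)[OF q(1)] .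
    have "(D \<circ> q) x = 0" for x
      using that(2) cfgsD[OF qc, of x] der_zero[OF that(1)] by (cases "x \<in> I") auto
    then have dq: "D \<circ> q = (\<lambda>_. 0)" by auto
    then have dq': "D (q x) = 0" for x by (metis comp_apply)
    have "D (z x) = 0" if "x \<in> Bc" for x using dq'[of x] fibreD(2)[OF q(1) that] by simp
    moreover have "D (len z e) = 0" if "e \<in> E" for e
    proof -
      have "len z e = len q e" using fibreD(3)[OF q(1) that] by simp
      then show ?thesis using der_len[OF \<open>D \<in> ?W\<close>, of q e] by (simp add: dq bil_zero_right)
    qed
    ultimately have yk: "y k D = 0" if "k \<in> Bc <+> E" for k using that by (auto simp: y_def)
    have ax: "D (a x) = 0" if "x \<in> J" for x using bspec[OF q(2) that] dq'[of x] by simp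
    show ?thesis using that(3)
    proof
      fix s assume "s \<in> S" "k = Inl s"
      then show ?thesis using yk[of s] S(1) by (auto simp: c_def)
    next
      fix x assume "x \<in> J" "k = Inr x"
      then show ?thesis using ax[of x] by (simp add: c_def)
    qed
  qed
  ultimately have cond: "card I \<le> card (S <+> J)" "onto ?W (S <+> J) (c a)" by auto
  have fin: "finite (S <+> J)" using finS by simp
  have "onto ?W I (\<lambda>x D. D (q x))"
    by (rule onto_of_kernel_subset[OF finite_index(1) fin lspace_ders lc lfun_eval cond(2) _ cond(1)])
      (rule kq)
  then show "generic q" using fibreD(1)[OF q(1)] by (simp add: generic_def)
  show "D (q x) = 0" if D: "D \<in> ders (base z)" "\<forall>x\<in>J. D (a x) = 0" for D x
  proof (cases "x \<in> I")
    case True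
    have DW: "D \<in> ?W" using D(1) base_iff by blast
    show ?thesis
    proof (rule kernel_subset_of_onto[OF finite_index(1) fin lspace_ders lc lfun_eval cond(2) _ cond(1) DW _ True])
      show "c a k D = 0" if "k \<in> S <+> J" for k
        using that D S(1) unfolding base_iff by (auto simp: c_def)
    qed (rule kq)
  next
    case False
    then show ?thesis using cfgsD[OF fibreD(1)[OF q(1)]] der_zero[OF D(1)] by simp
  qed
qed

lemma fibre_generic_inf_rigid:
  assumes "generic z" "inf_rigid z" "q \<in> fibre z"
  shows "generic q" "\<And>D x. D \<in> ders (base z) \<Longrightarrow> D (q x) = 0"
proof -
  have on: "onto (ders (base z)) {} (\<lambda>x D. D (z x))"
    using lspace_ders[of "base z"] by (auto simp: onto_def lspace_def)
  show "generic q" "\<And>D x. D \<in> ders (base z) \<Longrightarrow> D (q x) = 0"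
    using fibre_generic[where a = z, OF assms(1) _ on _ on assms(3)] inf_rigid_der[OF assms(2) generic_cfgs[OF assms(1)]]
    by blast+
qed

section \<open>Finiteness and invariance of the number of points\<close>

definition subfibre :: "('v \<times> nat \<Rightarrow> complex) \<Rightarrow> ('v \<times> nat) set \<Rightarrow> ('v \<times> nat \<Rightarrow> complex) \<Rightarrow> ('v \<times> nat \<Rightarrow> complex) set" where
  "subfibre z J a = {q \<in> fibre z. \<forall>x\<in>J. q x = a x}"

lemma generic_partial_isomorphism:
  assumes "generic z" "generic z'"
  obtains R where "field_rel R" "\<And>x. R (z x) (z' x)" "\<And>e. R (len z e) (len z' e)"
proof -
  have on: "onto (ders {}) I (\<lambda>x D. D (z x))" "onto (ders {}) I (\<lambda>x D. D (z' x))"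
    using assms by (simp_all add: generic_def)
  obtain R where R: "field_rel R" "\<And>x. x \<in> I \<Longrightarrow> R (z x) (z' x)"
    using partial_isomorphism[OF finite_index(1) on] by metis
  have Rz: "R (z x) (z' x)" for x
    using R(2) field_rel_zero[OF R(1)] cfgsD[OF generic_cfgs[OF assms(1)], of x]
      cfgsD[OF generic_cfgs[OF assms(2)], of x] by (cases "x \<in> I") auto
  show ?thesis by (rule that[OF R(1) Rz field_rel_len[OF R(1) Rz]])
qed

text \<open>Every point \<open>q\<close> is generic, so a partial isomorphism takes \<open>z\<close>
  to \<open>q\<close>, and it fixes the base data and the coordinates in \<open>J\<close>. Each
  coordinate of \<open>q\<close> is thus a root of a polynomial that annihilates the same coordinate
  of \<open>z\<close>.\<close>

lemma finite_subfibre: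
  assumes z: "generic z" and J: "J \<subseteq> Fc"
    and oz: "onto (ders (base z)) J (\<lambda>x D. D (z x))"
    and kz: "\<forall>D\<in>ders (base z). (\<forall>x\<in>J. D (z x) = 0) \<longrightarrow> (\<forall>x. D (z x) = 0)"
  shows "finite (subfibre z J z)"
proof -
  let ?X = "base z \<union> z ` J"
  have "\<exists>p. over (rgen ?X) p \<and> p \<noteq> 0 \<and> poly p (z x) = 0" for x
    by (rule algebraic_over_rgen) (use kz in \<open>auto simp: ders_Un\<close>)
  then obtain p where p: "\<And>x. over (rgen ?X) (p x)" "\<And>x. p x \<noteq> 0" "\<And>x. poly (p x) (z x) = 0" by metis
  let ?Y = "\<Union>x\<in>I. {y. poly (p x) y = 0}"
  have "subfibre z J z \<subseteq> {f. \<forall>x. (x \<in> I \<longrightarrow> f x \<in> ?Y) \<and> (x \<notin> I \<longrightarrow> f x = 0)}"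
  proof
    fix q assume "q \<in> subfibre z J z"
    then have q: "q \<in> fibre z" "\<forall>x\<in>J. q x = z x" by (auto simp: subfibre_def)
    have "generic q" by (rule fibre_generic(1)[OF z J oz kz oz q])
    then obtain R where R: "field_rel R" and Rzq: "\<And>x. R (z x) (q x)" and Rl: "\<And>e. R (len z e) (len q e)"
      using generic_partial_isomorphism[OF z] by metis
    have off: "q x = 0" if "x \<notin> I" for x
      using that cfgsD[OF fibreD(1)[OF q(1)]] by blast
    have "R x x" if xX: "x \<in> ?X" for x
    proof -
      consider y where "y \<in> Bc" "x = z y" | e where "e \<in> E" "x = len z e" | y where "y \<in> J" "x = z y"
        using xX unfolding base_def by blast
      then show ?thesis
      proof cases
        case 1
        then show ?thesis using Rzq[of y] fibreD(2)[OF q(1)] by simp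
      next
        case 2
        then show ?thesis using Rl[of e] fibreD(3)[OF q(1)] by simp
      next
        case 3
        then show ?thesis using Rzq[of y] q(2) by auto
      qed
    qed
    then have "R c c" if "c \<in> rgen ?X" for c using field_rel_rgen[OF R(1) _ that] by blast
    then have "R (poly (p x) (z x)) (poly (p x) (q x))" for x
      by (intro field_rel_poly[OF R(1)] Rzq) (use p(1) in \<open>auto simp: over_def\<close>)
    then have "poly (p x) (q x) = 0" for x using p(3) field_rel_zero_left[OF R(1)] by metis
    then show "q \<in> {f. \<forall>x. (x \<in> I \<longrightarrow> f x \<in> ?Y) \<and> (x \<notin> I \<longrightarrow> f x = 0)}" using off by blast
  qed
  moreover have "finite ?Y" using finite_index p(2) poly_roots_finite by blast
  ultimately show ?thesis using finite_set_of_finite_funs[OF finite_index(1), of ?Y 0] finite_subset by blast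
qed

lemma finite_fibre:
  assumes "generic z" "inf_rigid z" shows "finite (fibre z)"
proof -
  have on: "onto (ders (base z)) {} (\<lambda>x D. D (z x))"
    using lspace_ders[of "base z"] by (auto simp: onto_def lspace_def)
  have "finite (subfibre z {} z)"
    by (rule finite_subfibre[OF assms(1) _ on])
      (use inf_rigid_der[OF assms(2) generic_cfgs[OF assms(1)]] in auto)
  then show ?thesis by (simp add: subfibre_def)
qed

lemma field_rel_fibre:
  assumes "field_rel R" "q \<in> fibre z" "\<And>x. R (q x) (q' x)"
    "\<And>x. x \<in> Bc \<Longrightarrow> R (z x) (z' x)" "\<And>e. e \<in> E \<Longrightarrow> R (len z e) (len z' e)"
  shows "q' \<in> fibre z'"
proof (rule fibreI)
  show "q' \<in> cfgs"
    unfolding cfgs_def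
  proof (intro CollectI allI impI)
    fix x assume "x \<notin> I"
    then have "q x = 0" by (rule cfgsD[OF fibreD(1)[OF assms(2)]])
    then show "q' x = 0" using assms(3)[of x] field_rel_zero_left[OF assms(1)] by simp
  qed
  show "q' x = z' x" if "x \<in> Bc" for x
    using field_rel_right_unique[OF assms(1), of "z x" "q' x" "z' x"] assms(3)[of x] assms(4)[OF that]
      fibreD(2)[OF assms(2) that] by simp
  show "len q' e = len z' e" if "e \<in> E" for e
    using field_rel_right_unique[OF assms(1), of "len z e" "len q' e" "len z' e"]
      field_rel_len[where p = q and p' = q' and e = e, OF assms(1,3)] assms(5)[OF that] fibreD(3)[OF assms(2) that] by simp
qed

text \<open>Here the base data stays fixed under the partial isomorphism and only the values
  prescribed on \<open>J\<close> move.\<close>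

lemma card_subfibre_eq:
  assumes z: "generic z" and J: "J \<subseteq> Fc"
    and oz: "onto (ders (base z)) J (\<lambda>x D. D (z x))"
    and kz: "\<forall>D\<in>ders (base z). (\<forall>x\<in>J. D (z x) = 0) \<longrightarrow> (\<forall>x. D (z x) = 0)"
    and oa: "onto (ders (base z)) J (\<lambda>x D. D (a x))"
  shows "finite (subfibre z J a)" "card (subfibre z J a) = card (subfibre z J z)"
proof -
  have finJ: "finite J" using J finite_index finite_subset by blast
  have inj: "\<exists>h. inj_on h (subfibre z J b) \<and> h ` subfibre z J b \<subseteq> subfibre z J c"
    if ob: "onto (ders (base z)) J (\<lambda>x D. D (b x))" and oc: "onto (ders (base z)) J (\<lambda>x D. D (c x))" for b c
  proof (rule solution_set_injection[OF finJ ob oc])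
    show "D (q k) = 0" if "q \<in> subfibre z J b" "D \<in> ders (base z)" "\<forall>j\<in>J. D (b j) = 0" for q k D
      using fibre_generic(2)[OF z J oz kz ob _ _ that(2,3)] that(1) by (simp add: subfibre_def)
    fix R q q'
    assume R: "field_rel R" "\<And>x. x \<in> base z \<Longrightarrow> R x x" "\<And>j. j \<in> J \<Longrightarrow> R (b j) (c j)"
      "q \<in> subfibre z J b" "\<And>k. R (q k) (q' k)"
    have "q' \<in> fibre z"
      by (rule field_rel_fibre[OF R(1) _ R(5)]) (use R(2,4) in \<open>auto simp: subfibre_def base_def\<close>)
    moreover have "q' x = c x" if "x \<in> J" for x
    proof -
      have "q x = b x" using R(4) that by (simp add: subfibre_def)
      then show ?thesis using field_rel_right_unique[OF R(1), of "b x" "q' x" "c x"] R(3)[OF that] R(5)[of x] by simp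
    qed
    ultimately show "q' \<in> subfibre z J c" by (simp add: subfibre_def)
  qed
  have fz: "finite (subfibre z J z)" by (rule finite_subfibre[OF z J oz kz])
  obtain h where h: "inj_on h (subfibre z J a)" "h ` subfibre z J a \<subseteq> subfibre z J z" using inj[OF oa oz] by blast
  show fa: "finite (subfibre z J a)" using h fz by (meson finite_imageD finite_subset)
  obtain g where g: "inj_on g (subfibre z J z)" "g ` subfibre z J z \<subseteq> subfibre z J a" using inj[OF oz oa] by blast
  show "card (subfibre z J a) = card (subfibre z J z)"
    using card_inj_on_le[OF h fz] card_inj_on_le[OF g fa] by simp
qed

text \<open>A flex of \<open>z'\<close> has the form \<open>D \<circ> z'\<close> with
  \<open>D\<close> killing the base data of \<open>z'\<close>. Algebraic equations of
  \<open>z\<close> over its base data carry over to \<open>z'\<close>, and they force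
  \<open>D\<close> to vanish on the coordinates.\<close>

lemma inf_rigid_transfer:
  assumes "generic z" "generic z'" "inf_rigid z"
  shows "inf_rigid z'"
  unfolding inf_rigid_def
proof (intro ballI impI)
  fix a assume a: "a \<in> disps" "\<forall>e\<in>E. bil z' a e = 0"
  obtain D where D: "D \<in> ders (z' ` Bc)" "D \<circ> z' = a" using generic_der[OF assms(2) a(1)] by blast
  have "D (len z' e) = 0" if "e \<in> E" for e using der_len[OF D(1), of z' e] a(2) D(2) that by simp
  then have Db: "D \<in> ders (base z')" using D(1) by (auto simp: base_def ders_Un)
  obtain R where R: "field_rel R" "\<And>x. R (z x) (z' x)" "\<And>e. R (len z e) (len z' e)"
    using generic_partial_isomorphism[OF assms(1,2)] by blast
  have rel: "\<exists>c'\<in>rgen (base z'). R c c'" if "c \<in> rgen (base z)" for c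
    using that
  proof induction
    case rgen_one
    then show ?case using field_rel_one[OF R(1)] rgen.rgen_one by blast
  next
    case (rgen_minus c b)
    then show ?case using field_rel_diff[OF R(1)] rgen.rgen_minus by blast
  next
    case (rgen_gen y c)
    have "\<exists>y'\<in>base z'. R y y'" using rgen_gen(1) R(2,3) by (auto simp: base_def)
    then show ?case using rgen_gen(3) field_rel_mult[OF R(1)] rgen.rgen_gen by blast
  qed
  have "D (z' x) = 0" for x
  proof -
    obtain p where p: "over (rgen (base z)) p" "p \<noteq> 0" "poly p (z x) = 0"
      using algebraic_over_rgen[of "base z" "z x"] inf_rigid_der[OF assms(3) generic_cfgs[OF assms(1)]] by blast
    have "\<forall>i. \<exists>c'. c' \<in> rgen (base z') \<and> R (coeff p i) c'" using rel p(1) by (auto simp: over_def)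
    then obtain c where c: "\<And>i. c i \<in> rgen (base z')" "\<And>i. R (coeff p i) (c i)" by metis
    define p' where "p' = Poly (map c [0..<Suc (degree p)])"
    have cp': "coeff p' i = c i" for i
    proof (cases "i \<le> degree p")
      case False
      then have "c i = 0" using c(2)[of i] field_rel_zero_left[OF R(1)] by (simp add: coeff_eq_0)
      then show ?thesis using False by (simp add: p'_def nth_default_def less_Suc_eq_le del: upt_Suc)
    qed (simp add: p'_def nth_default_def less_Suc_eq_le del: upt_Suc)
    have "p' \<noteq> 0"
    proof
      assume "p' = 0"
      then have "R (coeff p i) 0" for i using c(2)[of i] cp'[of i] by simp
      then have "coeff p i = 0" for i using field_rel_zero_right[OF R(1)] by blast
      then show False using p(2) by (simp add: poly_eq_iff)
    qed
    moreover have "R (poly p (z x)) (poly p' (z' x))"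
      by (rule field_rel_poly[OF R(1) _ R(2)]) (simp add: cp' c)
    then have "poly p' (z' x) = 0" using p(3) field_rel_zero_left[OF R(1)] by simp
    moreover have "\<forall>i. D (coeff p' i) = 0" using der_rgen[OF c(1) Db] by (simp add: cp')
    ultimately show ?thesis using der_root[OF D(1)] by blast
  qed
  then show "a = (\<lambda>_. 0)" using D(2) by auto
qed

text \<open>The base data moves as well, so the partial isomorphism is started from all coordinates
  of \<open>z\<close>. Rigidity of \<open>z'\<close> is needed for the injection in the opposite
  direction.\<close>

lemma card_fibre_eq:
  assumes "generic z" "generic z'" "inf_rigid z"
  shows "card (fibre z) = card (fibre z')"
proof -
  have inj: "\<exists>h. inj_on h (fibre z) \<and> h ` fibre z \<subseteq> fibre z'"
    if z: "generic z" "inf_rigid z" "generic z'" for z z'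
  proof (rule solution_set_injection[where X = "{}" and J = I and a = z and b = z'])
    show "onto (ders {}) I (\<lambda>j D. D (z j))" "onto (ders {}) I (\<lambda>j D. D (z' j))"
      using z by (auto simp: generic_def)
    fix q k D assume *: "q \<in> fibre z" "D \<in> ders {}" "\<forall>j\<in>I. D (z j) = 0"
    have "(D \<circ> z) x = 0" for x
      using *(3) cfgsD[OF generic_cfgs[OF z(1)], of x] der_zero[OF *(2)] by (cases "x \<in> I") auto
    then have Dz: "D \<circ> z = (\<lambda>_. 0)" by auto
    then have "D \<in> ders (base z)"
      using *(2) der_len[OF *(2), of z] by (auto simp: base_def ders_def bil_zero_right dest: fun_cong)
    then show "D (q k) = 0" using fibre_generic_inf_rigid(2)[OF z(1,2) *(1)] by blast
  next
    fix R q q' assume R: "field_rel R" "\<And>j. j \<in> I \<Longrightarrow> R (z j) (z' j)" "q \<in> fibre z" "\<And>k. R (q k) (q' k)"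
    have Rz: "R (z x) (z' x)" for x
      using R(2) field_rel_zero[OF R(1)] cfgsD[OF generic_cfgs[OF z(1)], of x]
        cfgsD[OF generic_cfgs[OF z(3)], of x] by (cases "x \<in> I") auto
    show "q' \<in> fibre z'" by (rule field_rel_fibre[OF R(1,3,4) Rz field_rel_len[OF R(1) Rz]])
  qed (rule finite_index)
  have r': "inf_rigid z'" by (rule inf_rigid_transfer[OF assms])
  obtain h where h: "inj_on h (fibre z)" "h ` fibre z \<subseteq> fibre z'" using inj[OF assms(1,3,2)] by blast
  obtain g where g: "inj_on g (fibre z')" "g ` fibre z' \<subseteq> fibre z" using inj[OF assms(2) r' assms(1)] by blast
  show ?thesis
    using card_inj_on_le[OF h finite_fibre[OF assms(2) r']] card_inj_on_le[OF g finite_fibre[OF assms(1,3)]] by simp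
qed

end

section \<open>The fibre over a generic stress\<close>

text \<open>Equilibrium is tested only against displacements of unpinned vertices. By rigidity the
  stress space has dimension \<open>card E - card Fc\<close>; the bound on \<open>card E\<close>
  says that \<open>\<omega>\<close> has at least that many coordinates independent over
  \<open>z\<close>, so it is a generic stress.\<close>

locale stressed_graph = pinned_graph V d E fst_end snd_end B
  for V :: "'v set" and d :: nat and E :: "'e set" and fst_end snd_end :: "'e \<Rightarrow> 'v" and B :: "'v set" +
  fixes z :: "'v \<times> nat \<Rightarrow> complex" and \<omega> :: "'e \<Rightarrow> complex" and S :: "'e set"
  assumes z_generic: "generic z" and z_rigid: "inf_rigid z"
    and z_stress: "\<And>a. a \<in> disps \<Longrightarrow> (\<Sum>e\<in>E. \<omega> e * bil z a e) = 0"
    and \<omega>_generic: "onto (ders (z ` I)) S (\<lambda>s D. D (\<omega> s))"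
    and S: "S \<subseteq> E" "card E \<le> card Fc + card S"
begin

definition stress :: "('v \<times> nat \<Rightarrow> complex) \<Rightarrow> bool" where
  "stress p \<longleftrightarrow> (\<forall>a\<in>disps. (\<Sum>e\<in>E. \<omega> e * bil p a e) = 0)"

text \<open>An affine space, because equilibrium is linear in the configuration for fixed
  \<open>\<omega>\<close>.\<close>

definition flat :: "('v \<times> nat \<Rightarrow> complex) set" where
  "flat = {p \<in> cfgs. (\<forall>x\<in>Bc. p x = z x) \<and> stress p}"

text \<open>The vectors \<open>D \<circ> \<omega>\<close> stand for tangent vectors to the variety
  of stresses. Their annihilator is the direction space of the affine space that receives the length
  map.\<close>

definition conormal_ann :: "('e \<Rightarrow> complex) set" where
  "conormal_ann = {v. \<forall>D\<in>ders (z ` Bc). (\<Sum>e\<in>E. D (\<omega> e) * v e) = 0}"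

definition params :: "complex set" where
  "params = z ` Bc \<union> \<omega> ` E"

lemma finite_params: "finite params"
  unfolding params_def using finite_index finite_E by blast

lemma ders_params: "D \<in> ders params \<Longrightarrow> D \<in> ders (z ` Bc)"
  by (erule ders_mono) (auto simp: params_def)

lemma z_flat: "z \<in> flat"
  using generic_cfgs[OF z_generic] z_stress by (simp add: flat_def stress_def)

lemma flatD:
  assumes "p \<in> flat"
  shows "p \<in> cfgs" "\<And>x. x \<in> Bc \<Longrightarrow> p x = z x" "\<And>a. a \<in> disps \<Longrightarrow> (\<Sum>e\<in>E. \<omega> e * bil p a e) = 0"
  using assms unfolding flat_def stress_def by blast+

lemma flat_diff_disps:
  assumes "p \<in> flat" shows "(\<lambda>x. p x - z x) \<in> disps"
  unfolding disps_def
proof (intro CollectI allI impI)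
  fix x assume "x \<notin> Fc"
  then consider "x \<notin> I" | "x \<in> Bc" by (metis I_split Un_iff)
  then show "p x - z x = 0"
    using cfgsD[OF flatD(1)[OF assms]] cfgsD[OF generic_cfgs[OF z_generic]] flatD(2)[OF assms] by cases auto
qed

text \<open>For fixed weights the energy is stationary at \<open>p\<close> along displacements, so
  only the derivatives of the weights survive.\<close>

lemma flat_stress_der:
  assumes "p \<in> flat" "D \<in> ders (z ` Bc)"
  shows "D (\<Sum>e\<in>E. \<omega> e * len p e) = (\<Sum>e\<in>E. D (\<omega> e) * len p e)"
proof -
  have "D (\<Sum>e\<in>E. \<omega> e * len p e) = (\<Sum>e\<in>E. D (\<omega> e) * len p e) + 2 * (\<Sum>e\<in>E. \<omega> e * bil p (D \<circ> p) e)"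
    by (simp add: der_sum[OF assms(2)] der_mult[OF assms(2)] der_len[OF assms(2)] sum.distrib
        sum_distrib_left algebra_simps)
  moreover have "(\<Sum>e\<in>E. \<omega> e * bil p (D \<circ> p) e) = 0"
    by (intro flatD(3)[OF assms(1)] der_comp_disps[OF assms(2)] flatD(1,2)[OF assms(1)])
  ultimately show ?thesis by simp
qed

text \<open>The difference of the energies is the equilibrium of \<open>p\<close> plus that of
  \<open>z\<close>, both tested on the displacement \<open>p - z\<close>.\<close>

lemma flat_stress_energy:
  assumes "p \<in> flat" shows "(\<Sum>e\<in>E. \<omega> e * len p e) = (\<Sum>e\<in>E. \<omega> e * len z e)"
proof -
  let ?a = "\<lambda>x. p x - z x"
  have "len p e - len z e = bil p ?a e + bil z ?a e" for e
    by (simp add: len_def bil_diff_right bil_commute[of z p])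
  then have "(\<Sum>e\<in>E. \<omega> e * len p e) - (\<Sum>e\<in>E. \<omega> e * len z e)
      = (\<Sum>e\<in>E. \<omega> e * bil p ?a e) + (\<Sum>e\<in>E. \<omega> e * bil z ?a e)"
    unfolding sum_subtractf[symmetric] sum.distrib[symmetric] right_diff_distrib[symmetric]
    by (simp add: algebra_simps)
  then show ?thesis using flatD(3)[OF assms flat_diff_disps[OF assms]] z_stress[OF flat_diff_disps[OF assms]] by simp
qed

lemma flat_len_ann:
  assumes "p \<in> flat" shows "(\<lambda>e. len p e - len z e) \<in> conormal_ann"
  unfolding conormal_ann_def
proof (intro CollectI ballI)
  fix D assume D: "D \<in> ders (z ` Bc)"
  show "(\<Sum>e\<in>E. D (\<omega> e) * (len p e - len z e)) = 0"
    using flat_stress_der[OF assms D] flat_stress_der[OF z_flat D] flat_stress_energy[OF assms]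
    by (simp add: right_diff_distrib sum_subtractf)
qed

text \<open>The line through \<open>z\<close> in direction \<open>a\<close> stays in
  \<open>flat\<close>, and its length change is quadratic in the parameter. Subtracting the values
  at \<open>1\<close> and \<open>-1\<close> isolates the linear part.\<close>

lemma flat_direction_ann:
  assumes "a \<in> disps" "stress a" shows "(\<lambda>e. bil z a e) \<in> conormal_ann"
proof -
  have flat: "(\<lambda>x. z x + c * a x) \<in> flat" for c
  proof -
    have "(\<lambda>x. z x + c * a x) \<in> cfgs"
      unfolding cfgs_def
    proof (intro CollectI allI impI)
      fix x assume "x \<notin> I"
      then show "z x + c * a x = 0"
        using cfgsD[OF generic_cfgs[OF z_generic], of x] dispsD[OF assms(1), of x] by (simp add: I_split)
    qed
    moreover have "z x + c * a x = z x" if "x \<in> Bc" for x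
      using that dispsD[OF assms(1), of x] by auto
    moreover have "bil (\<lambda>x. z x + c * a x) b e = bil z b e + c * bil a b e" for b e
      using bil_add_right[of b z "\<lambda>x. c * a x" e] bil_scale_right[of b c a e]
      by (simp add: bil_commute[of _ b])
    then have "stress (\<lambda>x. z x + c * a x)"
      using z_stress assms(2) by (simp add: stress_def algebra_simps sum.distrib flip: sum_distrib_left)
    ultimately show ?thesis by (simp add: flat_def)
  qed
  have len: "len (\<lambda>x. z x + c * a x) e - len z e = 2 * c * bil z a e + c^2 * len a e" for c e
    by (simp add: len_def bil_def power2_eq_square sum_distrib_left sum.distrib[symmetric]
        sum_subtractf[symmetric] algebra_simps)
  show ?thesis
    unfolding conormal_ann_def
  proof (intro CollectI ballI)
    fix D assume D: "D \<in> ders (z ` Bc)"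
    have "(\<Sum>e\<in>E. D (\<omega> e) * (2 * c * bil z a e + c^2 * len a e)) = 0" for c
      using flat_len_ann[OF flat[of c]] D unfolding conormal_ann_def len by blast
    from this[of 1] this[of "-1"]
    have "(\<Sum>e\<in>E. D (\<omega> e) * (2 * bil z a e + len a e)) - (\<Sum>e\<in>E. D (\<omega> e) * (- 2 * bil z a e + len a e)) = 0"
      by simp
    then have "4 * (\<Sum>e\<in>E. D (\<omega> e) * bil z a e) = 0"
      unfolding sum_subtractf[symmetric] by (simp add: sum_distrib_left algebra_simps)
    then show "(\<Sum>e\<in>E. D (\<omega> e) * bil z a e) = 0" by simp
  qed
qed

lemma flat_der:
  assumes "p \<in> flat" "D \<in> ders params"
  shows "D \<circ> p \<in> disps" "stress (D \<circ> p)"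
proof -
  have D: "D \<in> ders (z ` Bc)" by (rule ders_params[OF assms(2)])
  show "D \<circ> p \<in> disps" by (rule der_comp_disps[OF D flatD(1,2)[OF assms(1)]])
  show "stress (D \<circ> p)"
    unfolding stress_def
  proof
    fix a assume a: "a \<in> disps"
    have "D \<circ> a \<in> disps" unfolding disps_def
      using dispsD[OF a] der_zero[OF D] by (intro CollectI allI impI) simp
    then have "(\<Sum>e\<in>E. \<omega> e * bil p (D \<circ> a) e) = 0" by (rule flatD(3)[OF assms(1)])
    moreover have "D (\<Sum>e\<in>E. \<omega> e * bil p a e) = (\<Sum>e\<in>E. \<omega> e * bil (D \<circ> p) a e) + (\<Sum>e\<in>E. \<omega> e * bil p (D \<circ> a) e)"
      using der_const[OF assms(2)]
      by (simp add: der_sum[OF D] der_mult[OF D] der_bil[OF D] params_def sum.distrib[symmetric] algebra_simps)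
    ultimately show "(\<Sum>e\<in>E. \<omega> e * bil (D \<circ> p) a e) = 0"
      using flatD(3)[OF assms(1) a] der_zero[OF D] by simp
  qed
qed

text \<open>Equal lengths have equal derivatives: with \<open>D \<circ> q = a\<close> one gets
  \<open>bil q a e = bil z (D \<circ> z) e\<close>, and the equilibrium of \<open>z\<close> applies.
  Genericity of \<open>q\<close> is what realises every \<open>a\<close> by some
  \<open>D\<close>.\<close>

lemma fibre_flat:
  assumes "q \<in> fibre z" shows "q \<in> flat"
proof -
  have gq: "generic q" by (rule fibre_generic_inf_rigid(1)[OF z_generic z_rigid assms])
  have "(\<Sum>e\<in>E. \<omega> e * bil q a e) = 0" if a: "a \<in> disps" for a
  proof -
    obtain D where D: "D \<in> ders (q ` Bc)" "D \<circ> q = a" using generic_der[OF gq a] by blast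
    have "q ` Bc = z ` Bc" using fibreD(2)[OF assms] by simp
    then have D': "D \<in> ders (z ` Bc)" using D by simp
    have "bil q a e = bil z (D \<circ> z) e" if "e \<in> E" for e
      using der_len[OF D(1), of q e] der_len[OF D', of z e] fibreD(3)[OF assms that] D(2) by simp
    then have "(\<Sum>e\<in>E. \<omega> e * bil q a e) = (\<Sum>e\<in>E. \<omega> e * bil z (D \<circ> z) e)" by simp
    also have "\<dots> = 0" by (intro z_stress der_comp_disps[OF D'] generic_cfgs[OF z_generic]) simp
    finally show ?thesis .
  qed
  then show ?thesis using fibreD[OF assms] by (simp add: flat_def stress_def)
qed

text \<open>\<open>T\<close> is the complement of a maximal independent set \<open>S'\<close> of
  weights. The relations defining \<open>conormal_ann\<close> express the entries on
  \<open>S'\<close> through those on \<open>T\<close>, and a rank count shows that the lengths on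
  \<open>T\<close> are independent over \<open>params\<close>.\<close>

lemma conormal_coordinates:
  obtains T where "T \<subseteq> E" "\<And>v e. v \<in> conormal_ann \<Longrightarrow> \<forall>t\<in>T. v t = 0 \<Longrightarrow> e \<in> E \<Longrightarrow> v e = 0"
    "onto (ders params) T (\<lambda>t D. D (len z t))"
proof -
  let ?W = "ders (z ` Bc)"
  have "\<exists>S'\<subseteq>E. onto ?W S' (\<lambda>e D. D (\<omega> e)) \<and>
      (\<forall>D\<in>?W. (\<forall>e\<in>S'. D (\<omega> e) = 0) \<longrightarrow> (\<forall>e\<in>E. D (\<omega> e) = 0))"
    by (rule onto_maximal_subset) (use finite_E lspace_ders lfun_eval in auto)
  then obtain S' where S': "S' \<subseteq> E" "onto ?W S' (\<lambda>e D. D (\<omega> e))"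
    "\<forall>D\<in>?W. (\<forall>e\<in>S'. D (\<omega> e) = 0) \<longrightarrow> (\<forall>e\<in>E. D (\<omega> e) = 0)" by auto
  have zero: "v e = 0" if v: "v \<in> conormal_ann" "\<forall>t\<in>E - S'. v t = 0" "e \<in> E" for v e
  proof (cases "e \<in> S'")
    case True
    obtain D where D: "D \<in> ?W" "\<forall>i\<in>S'. D (\<omega> i) = (if i = e then 1 else 0)"
      using ontoD[OF S'(2), of "\<lambda>i. if i = e then 1 else 0"] by blast
    have "D (\<omega> i) * v i = (if i = e then v e else 0)" if "i \<in> E" for i
      using D(2) v(2) that True by (cases "i \<in> S'") auto
    then have "(\<Sum>i\<in>E. D (\<omega> i) * v i) = (\<Sum>i\<in>E. if i = e then v e else 0)" by (rule sum.cong[OF refl])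
    also have "\<dots> = v e" using finite_E v(3) by simp
    finally show ?thesis using v(1) D(1) by (simp add: conormal_ann_def)
  qed (use v in auto)
  \<comment> \<open>One functional per edge: the weight on \<open>S'\<close>, the length elsewhere.
    Their common kernel kills the free coordinates and the weights on \<open>S\<close>, which have
    rank at least \<open>card E\<close>; hence they are independent.\<close>
  define b where "b e D = (if e \<in> S' then D (\<omega> e) else D (len z e))" for e and D :: "complex \<Rightarrow> complex"
  define c where "c k D = (case k of Inl x \<Rightarrow> D (z x) | Inr s \<Rightarrow> D (\<omega> s))"
    for k :: "'v \<times> nat + 'e" and D :: "complex \<Rightarrow> complex"
  have finS: "finite S" using S(1) finite_E finite_subset by blast
  have oc: "onto ?W (Fc <+> S) c"
    unfolding onto_def
  proof
    fix \<delta> :: "'v \<times> nat + 'e \<Rightarrow> complex"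
    define a where "a x = (if x \<in> Fc then \<delta> (Inl x) else 0)" for x
    have "a \<in> disps" by (auto simp: disps_def a_def)
    then obtain D0 where D0: "D0 \<in> ?W" "D0 \<circ> z = a" using generic_der[OF z_generic] by blast
    obtain D1 where D1: "D1 \<in> ders (z ` I)" "\<forall>s\<in>S. D1 (\<omega> s) = \<delta> (Inr s) - D0 (\<omega> s)"
      using ontoD[OF \<omega>_generic, of "\<lambda>s. \<delta> (Inr s) - D0 (\<omega> s)"] by blast
    have D1': "D1 \<in> ?W" by (rule ders_mono[OF D1(1)]) (use BV in auto)
    have "(\<lambda>x. 1 * D0 x + D1 x) \<in> ?W" by (rule lspaceD[OF lspace_ders D0(1) D1'])
    moreover have "\<forall>k\<in>Fc <+> S. c k (\<lambda>x. 1 * D0 x + D1 x) = \<delta> k"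
    proof
      fix k assume "k \<in> Fc <+> S"
      then show "c k (\<lambda>x. 1 * D0 x + D1 x) = \<delta> k"
      proof
        fix x assume x: "x \<in> Fc" "k = Inl x"
        have "D1 (z x) = 0" using der_const[OF D1(1), of "z x"] x(1) by auto
        moreover have "D0 (z x) = \<delta> (Inl x)" using fun_cong[OF D0(2), of x] x(1) by (simp add: a_def)
        ultimately show ?thesis using x by (simp add: c_def)
      next
        fix s assume "s \<in> S" "k = Inr s"
        then show ?thesis using D1(2) by (simp add: c_def)
      qed
    qed
    ultimately show "\<exists>D\<in>?W. \<forall>k\<in>Fc <+> S. c k D = \<delta> k" by blast
  qed
  have kc: "c k D = 0" if D: "D \<in> ?W" "\<forall>e\<in>E. b e D = 0" "k \<in> Fc <+> S" for D k
  proof -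
    have "D (\<omega> e) = 0" if "e \<in> S'" for e
    proof -
      have "b e D = 0" using D(2) S'(1) that by blast
      then show ?thesis using that by (simp add: b_def)
    qed
    then have w: "D (\<omega> e) = 0" if "e \<in> E" for e using S'(3) D(1) that by blast
    then have Dc: "D \<in> ders params" using D(1) by (auto simp: params_def ders_Un)
    have v: "(\<lambda>e. bil z (D \<circ> z) e) \<in> conormal_ann" by (intro flat_direction_ann flat_der[OF z_flat Dc])
    have l: "D (len z e) = 2 * bil z (D \<circ> z) e" for e by (rule der_len[OF D(1)])
    have "bil z (D \<circ> z) e = 0" if "e \<in> E - S'" for e
    proof -
      have "b e D = 0" using D(2) that by blast
      then show ?thesis using l[of e] that by (simp add: b_def)
    qed
    then have "bil z (D \<circ> z) e = 0" if "e \<in> E" for e using zero[OF v _ that] by blast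
    then have "D \<circ> z = (\<lambda>_. 0)" using z_rigid flat_der(1)[OF z_flat Dc] by (simp add: inf_rigid_def)
    then have "D (z x) = 0" for x by (metis comp_apply)
    then have "case k of Inl x \<Rightarrow> D (z x) = 0 | Inr s \<Rightarrow> D (\<omega> s) = 0"
      using w S(1) D(3) by (cases k) auto
    then show ?thesis by (cases k) (simp_all add: c_def)
  qed
  have cE: "card E \<le> card (Fc <+> S)"
    using S(2) card_Plus[OF finite_index(3) finS] by simp
  have lc: "lfun ?W (c k)" for k by (cases k) (simp_all add: c_def lfun_def)
  have lb: "lfun ?W (b e)" for e by (simp add: b_def lfun_def)
  have ob: "onto ?W E b"
    by (rule onto_of_kernel_subset[where J = "Fc <+> S" and a = c, OF finite_E _ lspace_ders lc lb oc _ cE])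
      (use finite_index finS in simp, rule kc)
  have "onto (ders params) (E - S') (\<lambda>t D. D (len z t))"
    unfolding onto_def
  proof
    fix \<delta> :: "'e \<Rightarrow> complex"
    obtain D where D: "D \<in> ?W" "\<forall>e\<in>E. b e D = (if e \<in> S' then 0 else \<delta> e)"
      using ontoD[OF ob, of "\<lambda>e. if e \<in> S' then 0 else \<delta> e"] by blast
    have "D (\<omega> e) = 0" if "e \<in> S'" for e
    proof -
      have "b e D = 0" using D(2) S'(1) that by auto
      then show ?thesis using that by (simp add: b_def)
    qed
    then have "\<forall>e\<in>E. D (\<omega> e) = 0" using S'(3) D(1) by blast
    then have "D \<in> ders params" using D(1) by (auto simp: params_def ders_Un)
    moreover have "\<forall>t\<in>E - S'. D (len z t) = \<delta> t"
    proof
      fix t assume "t \<in> E - S'"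
      then show "D (len z t) = \<delta> t" using bspec[OF D(2), of t] by (simp add: b_def)
    qed
    ultimately show "\<exists>D\<in>ders params. \<forall>t\<in>E - S'. D (len z t) = \<delta> t" by blast
  qed
  then show ?thesis using that[of "E - S'"] zero by blast
qed

definition slice :: "'e set \<Rightarrow> ('e \<Rightarrow> complex) \<Rightarrow> ('v \<times> nat \<Rightarrow> complex) set" where
  "slice T y = {p \<in> flat. \<forall>t\<in>T. len p t = y t}"

text \<open>The form \<open>bil\<close> is taken at \<open>z\<close>, where rigidity is known. This
  is legitimate because \<open>D \<circ> p\<close> is a direction of \<open>flat\<close>, and all
  points of an affine space share their directions.\<close>

lemma slice_algebraic:
  assumes T: "T \<subseteq> E" "\<And>v e. v \<in> conormal_ann \<Longrightarrow> \<forall>t\<in>T. v t = 0 \<Longrightarrow> e \<in> E \<Longrightarrow> v e = 0"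
    and y: "onto (ders params) T (\<lambda>t D. D (y t))"
    and p: "p \<in> slice T y" and D: "D \<in> ders params" "\<forall>t\<in>T. D (y t) = 0"
  shows "D (p x) = 0"
proof -
  have pf: "p \<in> flat" "\<And>t. t \<in> T \<Longrightarrow> len p t = y t" using p by (auto simp: slice_def)
  have finT: "finite T" using T(1) finite_E finite_subset by blast
  have zero: "D \<circ> p = (\<lambda>_. 0)" if D: "D \<in> ders params" "\<forall>t\<in>T. bil z (D \<circ> p) t = 0" for D
  proof -
    have "(\<lambda>e. bil z (D \<circ> p) e) \<in> conormal_ann" by (intro flat_direction_ann flat_der[OF pf(1) D(1)])
    then have "bil z (D \<circ> p) e = 0" if "e \<in> E" for e using T(2) D(2) that by blast
    then show ?thesis using z_rigid flat_der(1)[OF pf(1) D(1)] by (simp add: inf_rigid_def)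
  qed
  have "bil z (D \<circ> p) t = 0" if "t \<in> T" for t
  \<comment> \<open>Both families are indexed by \<open>T\<close>, so the ranks agree and vanishing
    on \<open>y\<close> implies vanishing of the rigidity rows at \<open>z\<close>.\<close>
  proof (rule kernel_subset_of_onto[where W = "ders params" and J = T and S = T
        and a = "\<lambda>t D. D (y t)" and b = "\<lambda>t D. bil z (D \<circ> p) t" and ?D1.0 = D])
    show "lfun (ders params) (\<lambda>D. bil z (D \<circ> p) j)" for j
      unfolding lfun_def comp_def by (simp add: bil_add_right bil_scale_right)
    fix D j assume *: "D \<in> ders params" "\<forall>s\<in>T. bil z (D \<circ> p) s = 0" "j \<in> T"
    have "D \<circ> p = (\<lambda>_. 0)" by (rule zero[OF *(1,2)])
    then have "D (len p j) = 0" using der_len[OF *(1), of p j] by (simp add: bil_zero_right)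
    then show "D (y j) = 0" using pf(2)[OF *(3)] by simp
  qed (use finT lspace_ders lfun_eval y D that in auto)
  then have "D \<circ> p = (\<lambda>_. 0)" using zero[OF D(1)] by blast
  then show ?thesis by (metis comp_apply)
qed

text \<open>Unit displacements reduce equilibrium to finitely many equations over
  \<open>params\<close>, which a partial isomorphism can transport.\<close>

lemma flat_iff:
  "p \<in> flat \<longleftrightarrow> p \<in> cfgs \<and> (\<forall>x\<in>Bc. p x = z x) \<and>
    (\<forall>k\<in>Fc. (\<Sum>e\<in>E. \<omega> e * bil p (\<lambda>x. if x = k then 1 else 0) e) = 0)"
proof -
  have "stress p" if unit: "\<forall>k\<in>Fc. (\<Sum>e\<in>E. \<omega> e * bil p (\<lambda>x. if x = k then 1 else 0) e) = 0"
    unfolding stress_def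
  proof
    fix a assume a: "a \<in> disps"
    have "a = (\<lambda>x. \<Sum>k\<in>Fc. a k * (if x = k then 1 else 0))"
    proof
      fix x show "a x = (\<Sum>k\<in>Fc. a k * (if x = k then 1 else 0))"
        using finite_index(3) dispsD[OF a, of x] by (simp add: if_distrib[of "\<lambda>c. a _ * c"] cong: if_cong)
    qed
    then have "bil p a e = bil p (\<lambda>x. \<Sum>k\<in>Fc. a k * (if x = k then 1 else 0)) e" for e by simp
    then have "bil p a e = (\<Sum>k\<in>Fc. a k * bil p (\<lambda>x. if x = k then 1 else 0) e)" for e
      by (simp only: bil_sum_right bil_scale_right)
    then have "(\<Sum>e\<in>E. \<omega> e * bil p a e) = (\<Sum>e\<in>E. \<Sum>k\<in>Fc. a k * (\<omega> e * bil p (\<lambda>x. if x = k then 1 else 0) e))"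
      by (simp only: sum_distrib_left mult.left_commute)
    also have "\<dots> = (\<Sum>k\<in>Fc. a k * (\<Sum>e\<in>E. \<omega> e * bil p (\<lambda>x. if x = k then 1 else 0) e))"
      by (subst sum.swap) (simp only: sum_distrib_left)
    also have "\<dots> = 0" by (intro sum.neutral ballI) (use unit in simp)
    finally show "(\<Sum>e\<in>E. \<omega> e * bil p a e) = 0" .
  qed
  moreover have "(\<lambda>x. if x = k then 1 else 0) \<in> disps" if "k \<in> Fc" for k
    using that by (auto simp: disps_def)
  ultimately show ?thesis unfolding flat_def stress_def by blast
qed

lemma field_rel_flat:
  assumes R: "field_rel R" "\<And>x. x \<in> params \<Longrightarrow> R x x" "\<And>k. R (q k) (q' k)" and q: "q \<in> flat"
  shows "q' \<in> flat"
  unfolding flat_iff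
proof (intro conjI ballI)
  show "q' \<in> cfgs"
    unfolding cfgs_def
  proof (intro CollectI allI impI)
    fix x assume "x \<notin> I"
    then have "q x = 0" by (rule cfgsD[OF flatD(1)[OF q]])
    then show "q' x = 0" using R(3)[of x] field_rel_zero_left[OF R(1)] by simp
  qed
  show "q' x = z x" if "x \<in> Bc" for x
    using field_rel_right_unique[OF R(1), of "z x" "q' x" "z x"] R(2)[of "z x"] R(3)[of x] flatD(2)[OF q that] that
    by (simp add: params_def)
  fix k assume k: "k \<in> Fc"
  have u: "R (if x = k then 1 else 0) (if x = k then 1 else 0)" for x
    using field_rel_one[OF R(1)] field_rel_zero[OF R(1)] by simp
  have "R (\<Sum>e\<in>E. \<omega> e * bil q (\<lambda>x. if x = k then 1 else 0) e) (\<Sum>e\<in>E. \<omega> e * bil q' (\<lambda>x. if x = k then 1 else 0) e)"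
    by (intro field_rel_sum[OF R(1)] field_rel_mult[OF R(1)] field_rel_bil[OF R(1)] R(3) u R(2))
      (simp add: params_def)
  moreover have "(\<Sum>e\<in>E. \<omega> e * bil q (\<lambda>x. if x = k then 1 else 0) e) = 0"
    using q k unfolding flat_iff by blast
  ultimately show "(\<Sum>e\<in>E. \<omega> e * bil q' (\<lambda>x. if x = k then 1 else 0) e) = 0"
    using field_rel_zero_left[OF R(1)] by simp
qed

text \<open>On \<open>flat\<close> the differences of lengths lie in \<open>conormal_ann\<close>, so
  agreement on \<open>T\<close> spreads to all edges.\<close>

lemma fibre_slice:
  assumes T: "T \<subseteq> E" "\<And>v e. v \<in> conormal_ann \<Longrightarrow> \<forall>t\<in>T. v t = 0 \<Longrightarrow> e \<in> E \<Longrightarrow> v e = 0"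
  shows "fibre z = slice T (len z)"
proof
  show "fibre z \<subseteq> slice T (len z)"
    using fibre_flat fibreD(3) T(1) by (fastforce simp: slice_def)
  show "slice T (len z) \<subseteq> fibre z"
  proof
    fix p assume "p \<in> slice T (len z)"
    then have p: "p \<in> flat" "\<forall>t\<in>T. len p t = len z t" by (auto simp: slice_def)
    have "len p e - len z e = 0" if "e \<in> E" for e
      using T(2)[OF flat_len_ann[OF p(1)] _ that] p(2) by simp
    then show "p \<in> fibre z" using flatD(1,2)[OF p(1)] by (intro fibreI) auto
  qed
qed

lemma card_slice_eq:
  assumes T: "T \<subseteq> E" "\<And>v e. v \<in> conormal_ann \<Longrightarrow> \<forall>t\<in>T. v t = 0 \<Longrightarrow> e \<in> E \<Longrightarrow> v e = 0"
    "onto (ders params) T (\<lambda>t D. D (len z t))"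
    and y: "onto (ders params) T (\<lambda>t D. D (y t))"
  shows "finite (slice T y)" "card (slice T y) = card (fibre z)"
proof -
  have finT: "finite T" using T(1) finite_E finite_subset by blast
  have inj: "\<exists>h. inj_on h (slice T b) \<and> h ` slice T b \<subseteq> slice T c"
    if ob: "onto (ders params) T (\<lambda>t D. D (b t))" and oc: "onto (ders params) T (\<lambda>t D. D (c t))" for b c
  proof (rule solution_set_injection[OF finT ob oc])
    show "D (q k) = 0" if "q \<in> slice T b" "D \<in> ders params" "\<forall>j\<in>T. D (b j) = 0" for q k D
      by (rule slice_algebraic[OF T(1) _ ob that]) (rule T(2))
    fix R q q'
    assume R: "field_rel R" "\<And>x. x \<in> params \<Longrightarrow> R x x" "\<And>j. j \<in> T \<Longrightarrow> R (b j) (c j)"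
      "q \<in> slice T b" "\<And>k. R (q k) (q' k)"
    have q: "q \<in> flat" "\<forall>t\<in>T. len q t = b t" using R(4) by (auto simp: slice_def)
    have "q' \<in> flat" by (rule field_rel_flat[OF R(1,2,5) q(1)])
    moreover have "len q' t = c t" if "t \<in> T" for t
      using field_rel_right_unique[OF R(1), of "b t" "len q' t" "c t"] R(3)[OF that] q(2) that
        field_rel_len[where p = q and p' = q' and e = t, OF R(1,5)] by simp
    ultimately show "q' \<in> slice T c" by (simp add: slice_def)
  qed
  have fz: "fibre z = slice T (len z)" by (rule fibre_slice[OF T(1)]) (rule T(2))
  have fin: "finite (slice T (len z))" using finite_fibre[OF z_generic z_rigid] fz by simp
  obtain h where h: "inj_on h (slice T y)" "h ` slice T y \<subseteq> slice T (len z)" using inj[OF y T(3)] by blast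
  show fy: "finite (slice T y)" using h fin by (meson finite_imageD finite_subset)
  obtain g where g: "inj_on g (slice T (len z))" "g ` slice T (len z) \<subseteq> slice T y" using inj[OF T(3) y] by blast
  show "card (slice T y) = card (fibre z)"
    unfolding fz using card_inj_on_le[OF h fin] card_inj_on_le[OF g fy] by simp
qed

lemma flat_cnj:
  assumes "\<And>x. z x \<in> \<real>" "\<And>e. \<omega> e \<in> \<real>" "p \<in> flat"
  shows "(\<lambda>x. cnj (p x)) \<in> flat"
proof -
  have "(\<lambda>x. cnj (p x)) \<in> cfgs"
    unfolding cfgs_def using cfgsD[OF flatD(1)[OF assms(3)]] by (intro CollectI allI impI) simp
  moreover have "cnj (p x) = z x" if "x \<in> Bc" for x
    using flatD(2)[OF assms(3) that] assms(1)[of x] by (simp add: Reals_cnj_iff)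
  moreover have "(\<Sum>e\<in>E. \<omega> e * bil (\<lambda>x. cnj (p x)) a e) = 0" if a: "a \<in> disps" for a
  proof -
    have "(\<lambda>x. cnj (a x)) \<in> disps" unfolding disps_def using dispsD[OF a] by (intro CollectI allI impI) simp
    then have "cnj (\<Sum>e\<in>E. \<omega> e * bil p (\<lambda>x. cnj (a x)) e) = 0" using flatD(3)[OF assms(3)] by simp
    moreover have "cnj (\<omega> e) = \<omega> e" for e using assms(2)[of e] by (simp add: Reals_cnj_iff)
    ultimately show ?thesis using bil_cnj[of p "\<lambda>x. cnj (a x)"] by simp
  qed
  ultimately show ?thesis by (simp add: flat_def stress_def)
qed

lemma fibre_trivial_or_even:
  assumes "\<And>x. z x \<in> \<real>" "\<And>e. \<omega> e \<in> \<real>"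
  shows "fibre z = {z} \<or> even (card (fibre z))"
proof -
  obtain T where T: "T \<subseteq> E" "\<And>v e. v \<in> conormal_ann \<Longrightarrow> \<forall>t\<in>T. v t = 0 \<Longrightarrow> e \<in> E \<Longrightarrow> v e = 0"
    "onto (ders params) T (\<lambda>t D. D (len z t))" using conormal_coordinates by blast
  show ?thesis
  proof (cases "T = {}")
    case True
    \<comment> \<open>Without coordinates the annihilator vanishes on \<open>E\<close>; the
      direction \<open>q - z\<close> of \<open>flat\<close> is then an infinitesimal flex of
      \<open>z\<close>.\<close>
    have "q = z" if q: "q \<in> fibre z" for q
    proof -
      let ?a = "\<lambda>x. q x - z x"
      have f: "q \<in> flat" by (rule fibre_flat[OF q])
      have a: "?a \<in> disps" by (rule flat_diff_disps[OF f])
      have "bil ?a b e = bil q b e - bil z b e" for b e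
        using bil_diff_right[of b q z e] by (simp add: bil_commute[of _ b])
      then have "stress ?a"
        using flatD(3)[OF f] z_stress by (simp add: stress_def right_diff_distrib sum_subtractf)
      then have "bil z ?a e = 0" if "e \<in> E" for e
        using T(2)[OF flat_direction_ann[OF a] _ that] True by simp
      then have "?a = (\<lambda>_. 0)" using z_rigid a by (simp add: inf_rigid_def)
      then show ?thesis by (metis eq_iff_diff_eq_0 ext)
    qed
    moreover have "z \<in> fibre z" using generic_cfgs[OF z_generic] by (simp add: fibre_def)
    ultimately show ?thesis by blast
  next
    case False
    then obtain t where t: "t \<in> T" by blast
    have finT: "finite T" using T(1) finite_E finite_subset by blast
    obtain r where r: "\<And>t. r t < 0" "onto (ders params) T (\<lambda>t D. D (complex_of_real (r t)))"
      using generic_negative_reals[OF finT finite_params] by blast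
    let ?Q = "slice T (\<lambda>t. complex_of_real (r t))"
    have "even (card ?Q)"
    proof (rule even_card_involution[where \<tau> = "\<lambda>q x. cnj (q x)"])
      show "finite ?Q" by (rule card_slice_eq(1)[OF T(1) _ T(3) r(2)]) (rule T(2))
      fix q assume "q \<in> ?Q"
      then have q: "q \<in> flat" "\<forall>t\<in>T. len q t = complex_of_real (r t)" by (auto simp: slice_def)
      have "len (\<lambda>x. cnj (q x)) e = cnj (len q e)" for e by (simp add: len_def bil_cnj)
      then have "(\<lambda>x. cnj (q x)) \<in> ?Q" using flat_cnj[OF assms q(1)] q(2) by (simp add: slice_def)
      moreover have "(\<lambda>x. cnj (q x)) \<noteq> q"
      proof
        assume eq: "(\<lambda>x. cnj (q x)) = q"
        have re: "q x = complex_of_real (Re (q x))" for x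
          using fun_cong[OF eq, of x] by (metis Reals_cnj_iff of_real_Re)
        have "len q t = complex_of_real (\<Sum>i<d. (Re (q (fst_end t, i)) - Re (q (snd_end t, i)))^2)"
          unfolding len_def bil_def by (subst (1 2 3 4) re) (simp add: power2_eq_square)
        then have "r t = (\<Sum>i<d. (Re (q (fst_end t, i)) - Re (q (snd_end t, i)))^2)"
          using q(2) t by (metis of_real_eq_iff)
        then have "r t \<ge> 0" by (simp add: sum_nonneg)
        then show False using r(1)[of t] by simp
      qed
      ultimately show "(\<lambda>x. cnj (q x)) \<in> ?Q \<and> (\<lambda>x. cnj (cnj (q x))) = q \<and> (\<lambda>x. cnj (q x)) \<noteq> q" by simp
    qed
    moreover have "card ?Q = card (fibre z)" by (rule card_slice_eq(2)[OF T(1) _ T(3) r(2)]) (rule T(2))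
    ultimately show ?thesis by simp
  qed
qed

end

section \<open>A generic real stress of a real configuration\<close>

context pinned_graph
begin

text \<open>The stress is built by hand: \<open>T\<close> indexes a basis of the rigidity rows, the
  edges outside \<open>T\<close> receive generic real weights, and the row relations dictate the
  weights on \<open>T\<close>.\<close>

lemma real_fibre_trivial_or_even:
  assumes z: "generic z" "inf_rigid z" "\<And>x. z x \<in> \<real>"
  shows "fibre z = {z} \<or> even (card (fibre z))"
proof -
  let ?W = "ders (z ` Bc)"
  have "\<exists>T\<subseteq>E. onto ?W T (\<lambda>e D. D (len z e)) \<and>
      (\<forall>D\<in>?W. (\<forall>e\<in>T. D (len z e) = 0) \<longrightarrow> (\<forall>e\<in>E. D (len z e) = 0))"
    by (rule onto_maximal_subset) (use finite_E lspace_ders lfun_eval in auto)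
  then obtain T where T: "T \<subseteq> E" "onto ?W T (\<lambda>e D. D (len z e))"
    "\<forall>D\<in>?W. (\<forall>e\<in>T. D (len z e) = 0) \<longrightarrow> (\<forall>e\<in>E. D (len z e) = 0)" by auto
  have finT: "finite T" using T(1) finite_E finite_subset by blast
  have cT: "card T \<le> card Fc"
  proof (rule onto_card_le[where W = ?W and a = "\<lambda>e D. D (len z e)" and b = "\<lambda>x D. D (z x)"])
    fix D e assume D: "D \<in> ?W" "\<forall>x\<in>Fc. D (z x) = 0"
    have "D \<circ> z \<in> disps" by (rule der_comp_disps[OF D(1) generic_cfgs[OF z(1)]]) simp
    then have "(D \<circ> z) x = 0" for x using D(2) dispsD[of "D \<circ> z" x] by (cases "x \<in> Fc") auto
    then have "D \<circ> z = (\<lambda>_. 0)" by auto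
    then show "D (len z e) = 0" using der_len[OF D(1), of z e] by (simp add: bil_zero_right)
  qed (use finT finite_index lspace_ders lfun_eval T in auto)
  have "\<exists>c. \<forall>D\<in>?W. D (len z s) = (\<Sum>t\<in>T. c t * D (len z t))" if "s \<in> E" for s
    by (rule lfun_in_span) (use finT lspace_ders lfun_eval T(3) that in auto)
  then obtain c where c: "\<And>s D. s \<in> E \<Longrightarrow> D \<in> ?W \<Longrightarrow> D (len z s) = (\<Sum>t\<in>T. c s t * D (len z t))" by metis
  have dep: "bil z a s = (\<Sum>t\<in>T. c s t * bil z a t)" if s: "s \<in> E" and a: "a \<in> disps" for s a
  proof -
    obtain D where D: "D \<in> ?W" "D \<circ> z = a" using generic_der[OF z(1) a] by blast
    have "2 * bil z a s = (\<Sum>t\<in>T. c s t * (2 * bil z a t))"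
      using c[OF s D(1)] der_len[OF D(1), of z] D(2) by simp
    also have "\<dots> = 2 * (\<Sum>t\<in>T. c s t * bil z a t)" by (simp add: sum_distrib_left algebra_simps)
    finally show ?thesis by simp
  qed
  have zc: "cnj (z x) = z x" for x using z(3)[of x] by (simp add: Reals_cnj_iff)
  \<comment> \<open>The rows of a real configuration are real, so averaging a relation with its
    conjugate makes the coefficients real.\<close>
  have dep_real: "bil z a s = (\<Sum>t\<in>T. of_real (Re (c s t)) * bil z a t)" if s: "s \<in> E" and a: "a \<in> disps" for s a
  proof -
    have "(\<lambda>x. cnj (a x)) \<in> disps" unfolding disps_def using dispsD[OF a] by (intro CollectI allI impI) simp
    from dep[OF s this] have "cnj (bil z a s) = (\<Sum>t\<in>T. c s t * cnj (bil z a t))"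
      using bil_cnj[of z a] zc by simp
    from arg_cong[OF this, of cnj] have "bil z a s = (\<Sum>t\<in>T. cnj (c s t) * bil z a t)" by simp
    then have "2 * bil z a s = (\<Sum>t\<in>T. (c s t + cnj (c s t)) * bil z a t)"
      using dep[OF s a] by (simp add: algebra_simps sum.distrib)
    also have "\<dots> = 2 * (\<Sum>t\<in>T. of_real (Re (c s t)) * bil z a t)"
      by (simp add: complex_add_cnj sum_distrib_left algebra_simps)
    finally show ?thesis by simp
  qed
  define S where "S = E - T"
  have finS: "finite S" using finite_E by (simp add: S_def)
  obtain r where r: "\<And>s. r s < 0" "onto (ders (z ` I)) S (\<lambda>s D. D (complex_of_real (r s)))"
    using generic_negative_reals[OF finS, of "z ` I"] finite_index by auto
  define w where "w e = (if e \<in> S then r e else - (\<Sum>s\<in>S. r s * Re (c s e)))" for e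
  interpret stressed_graph V d E fst_end snd_end B z "\<lambda>e. complex_of_real (w e)" S
  proof
    show "generic z" "inf_rigid z" by fact+
    show "S \<subseteq> E" by (auto simp: S_def)
    have "card S = card E - card T" unfolding S_def using T(1) finT by (simp add: card_Diff_subset)
    then show "card E \<le> card Fc + card S" using cT by linarith
    show "onto (ders (z ` I)) S (\<lambda>s D. D (complex_of_real (w s)))"
      using r(2) by (auto simp: onto_def w_def)
    fix a assume a: "a \<in> disps"
    have "(\<Sum>e\<in>E. complex_of_real (w e) * bil z a e)
        = (\<Sum>e\<in>S. complex_of_real (w e) * bil z a e) + (\<Sum>e\<in>T. complex_of_real (w e) * bil z a e)"
      unfolding S_def by (subst sum.subset_diff[OF T(1) finite_E]) simp
    also have "(\<Sum>e\<in>S. complex_of_real (w e) * bil z a e) = (\<Sum>s\<in>S. \<Sum>t\<in>T. of_real (r s) * (of_real (Re (c s t)) * bil z a t))"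
    proof (rule sum.cong[OF refl])
      fix s assume s: "s \<in> S"
      then have "s \<in> E" by (simp add: S_def)
      from dep_real[OF this a] show "complex_of_real (w s) * bil z a s = (\<Sum>t\<in>T. of_real (r s) * (of_real (Re (c s t)) * bil z a t))"
        using s by (simp add: w_def sum_distrib_left)
    qed
    also have "(\<Sum>e\<in>T. complex_of_real (w e) * bil z a e) = (\<Sum>t\<in>T. \<Sum>s\<in>S. - (of_real (r s) * (of_real (Re (c s t)) * bil z a t)))"
    proof (rule sum.cong[OF refl])
      fix t assume "t \<in> T"
      then have "t \<notin> S" by (simp add: S_def)
      then show "complex_of_real (w t) * bil z a t = (\<Sum>s\<in>S. - (of_real (r s) * (of_real (Re (c s t)) * bil z a t)))"
        by (simp add: w_def sum_distrib_right sum_negf mult.assoc)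
    qed
    also have "(\<Sum>s\<in>S. \<Sum>t\<in>T. of_real (r s) * (of_real (Re (c s t)) * bil z a t)) + \<dots> = 0"
      by (subst sum.swap) (simp add: sum_negf)
    finally show "(\<Sum>e\<in>E. complex_of_real (w e) * bil z a e) = 0" .
  qed
  show ?thesis by (rule fibre_trivial_or_even) (use z(3) in auto)
qed

end

section \<open>Parity in an arbitrary signature\<close>

context pinned_graph
begin

text \<open>The conjugation belonging to signature \<open>s\<close>: its fixed points are imaginary
  in the first \<open>s\<close> coordinates and real in the others.\<close>

definition sconj :: "nat \<Rightarrow> ('v \<times> nat \<Rightarrow> complex) \<Rightarrow> 'v \<times> nat \<Rightarrow> complex" where
  "sconj s q = (\<lambda>x. (if snd x < s then - 1 else 1) * cnj (q x))"

lemma sconj_sconj: "sconj s (sconj s q) = q"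
  by (auto simp: sconj_def)

lemma len_sconj: "len (sconj s q) e = cnj (len q e)"
proof -
  have "((if i < s then - 1 else 1) * cnj a - (if i < s then - 1 else 1) * cnj b) *
      ((if i < s then - 1 else 1) * cnj a - (if i < s then - 1 else 1) * cnj b) = cnj ((a - b) * (a - b))"
    for a b and i :: nat by (simp add: algebra_simps)
  then show ?thesis by (simp add: len_def bil_def sconj_def)
qed

lemma sconj_fibre:
  assumes "sconj s z = z" "q \<in> fibre z" shows "sconj s q \<in> fibre z"
proof (rule fibreI)
  show "sconj s q \<in> cfgs"
    unfolding cfgs_def sconj_def using cfgsD[OF fibreD(1)[OF assms(2)]] by (intro CollectI allI impI) simp
  show "sconj s q x = z x" if "x \<in> Bc" for x
    using fibreD(2)[OF assms(2) that] fun_cong[OF assms(1), of x] by (simp add: sconj_def)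
  show "len (sconj s q) e = len z e" if "e \<in> E" for e
    using fibreD(3)[OF assms(2) that] len_sconj[of s z e] assms(1) by (simp add: len_sconj)
qed

lemma unique_real_fibre_point:
  assumes z: "generic z" "sconj s z = z"
    and uniq: "\<And>q. q \<in> fibre z \<Longrightarrow> sconj s q = q \<Longrightarrow> q = z"
  shows "inf_rigid z" "odd (card (fibre z))"
proof -
  let ?W = "ders (base z)"
  \<comment> \<open>\<open>J\<close> is a transcendence basis of the free coordinates over the base
    data. Freezing it gives a finite set in which parity makes sense before the fibre is known to be
    finite.\<close>
  have "\<exists>J\<subseteq>Fc. onto ?W J (\<lambda>x D. D (z x)) \<and>
      (\<forall>D\<in>?W. (\<forall>x\<in>J. D (z x) = 0) \<longrightarrow> (\<forall>x\<in>Fc. D (z x) = 0))"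
    by (rule onto_maximal_subset) (use finite_index lspace_ders lfun_eval in auto)
  then obtain J where J: "J \<subseteq> Fc" "onto ?W J (\<lambda>x D. D (z x))"
    "\<forall>D\<in>?W. (\<forall>x\<in>J. D (z x) = 0) \<longrightarrow> (\<forall>x\<in>Fc. D (z x) = 0)" by blast
  have zc: "z \<in> cfgs" by (rule generic_cfgs[OF z(1)])
  have kz: "\<forall>D\<in>?W. (\<forall>x\<in>J. D (z x) = 0) \<longrightarrow> (\<forall>x. D (z x) = 0)"
  proof (intro ballI impI allI)
    fix D x assume D: "D \<in> ?W" "\<forall>x\<in>J. D (z x) = 0"
    consider "x \<notin> I" | "x \<in> Bc" | "x \<in> Fc" by (metis I_split Un_iff)
    then show "D (z x) = 0"
    proof cases
      case 1
      then show ?thesis using cfgsD[OF zc] der_zero[OF D(1)] by simp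
    next
      case 2
      then show ?thesis using der_const[OF D(1)] by (simp add: base_def)
    next
      case 3
      then show ?thesis using J(3) D by blast
    qed
  qed
  have finJ: "finite J" using J(1) finite_index finite_subset by blast
  \<comment> \<open>Independence over the coordinates of \<open>z\<close>, and not only over the
    base data, ensures that the new values differ from the old ones.\<close>
  have "finite (base z \<union> z ` I)" using finite_base finite_index by blast
  from generic_negative_reals[OF finJ this]
  obtain r where r: "onto (ders (base z \<union> z ` I)) J (\<lambda>x D. D (complex_of_real (r x)))" by blast
  \<comment> \<open>The factor makes the new values fixed by \<open>sconj s\<close>, so the
    involution acts on the moved subfibre too.\<close>
  define k where "k x = (if snd x < s then \<i> else 1)" for x :: "'v \<times> nat"
  have k0: "k x \<noteq> 0" for x by (simp add: k_def)
  define w where "w x = k x * complex_of_real (r x)" for x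
  have Dw: "D (w x) = k x * D (complex_of_real (r x))" if "D \<in> ders X" for D X x
    using der_mult[OF that] der_imaginary[OF that] der_one[OF that] by (simp add: w_def k_def)
  have "onto ?W J (\<lambda>x D. D (w x))"
    unfolding onto_def
  proof
    fix \<delta> :: "'v \<times> nat \<Rightarrow> complex"
    obtain D where D: "D \<in> ders (base z \<union> z ` I)" "\<forall>x\<in>J. D (complex_of_real (r x)) = \<delta> x / k x"
      using ontoD[OF r, of "\<lambda>x. \<delta> x / k x"] by blast
    have "D \<in> ?W" by (rule ders_mono[OF D(1)]) simp
    moreover have "\<forall>x\<in>J. D (w x) = \<delta> x" using D(2) Dw[OF D(1)] k0 by simp
    ultimately show "\<exists>D\<in>?W. \<forall>x\<in>J. D (w x) = \<delta> x" by blast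
  qed
  note cw = card_subfibre_eq[OF z(1) J(1,2) kz this]
  have fz: "finite (subfibre z J z)" by (rule finite_subfibre[OF z(1) J(1,2) kz])
  have zf: "z \<in> subfibre z J z" using zc by (simp add: subfibre_def fibre_def)
  have sub: "sconj s q \<in> subfibre z J a" if "q \<in> subfibre z J a" "\<And>x. sconj s a x = a x" for q a
    using that sconj_fibre[OF z(2), of q] by (simp add: subfibre_def sconj_def)
  have "even (card (subfibre z J z - {z}))"
  proof (rule even_card_involution[where \<tau> = "sconj s"])
    fix q assume q: "q \<in> subfibre z J z - {z}"
    have "sconj s q \<in> subfibre z J z" using sub[of q z] q z(2) by simp
    moreover have "sconj s q \<noteq> q" using uniq[of q] q by (auto simp: subfibre_def)
    moreover have "sconj s q \<noteq> z" using q z(2) sconj_sconj[of s q] by auto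
    ultimately show "sconj s q \<in> subfibre z J z - {z} \<and> sconj s (sconj s q) = q \<and> sconj s q \<noteq> q"
      by (simp add: sconj_sconj)
  qed (use fz in simp)
  then have odd: "odd (card (subfibre z J z))"
    using zf fz by (metis card_Suc_Diff1 even_Suc)
  have "J = {}"
  proof (rule ccontr)
    assume "J \<noteq> {}"
    then obtain x where x: "x \<in> J" by blast
    have ws: "sconj s w y = w y" for y by (simp add: sconj_def w_def k_def)
    \<comment> \<open>An involution on a set of odd size has a fixed point; at the new values it is
      a second real point of the fibre.\<close>
    have "\<exists>q\<in>subfibre z J w. sconj s q = q"
    proof (rule ccontr)
      assume no: "\<not> ?thesis"
      have "even (card (subfibre z J w))"
        by (rule even_card_involution[where \<tau> = "sconj s", OF cw(1)])
          (use no sub[OF _ ws] sconj_sconj in blast)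
      then show False using odd cw(2) by simp
    qed
    then obtain q where q: "q \<in> subfibre z J w" "sconj s q = q" by blast
    then have "q = z" using uniq by (simp add: subfibre_def)
    then have "z x = w x" using q(1) x by (simp add: subfibre_def)
    moreover obtain D where D: "D \<in> ders (base z \<union> z ` I)" "D (complex_of_real (r x)) = 1"
      using ontoD[OF r, of "\<lambda>_. 1"] x by blast
    have "D (z x) = 0" using der_const[OF D(1), of "z x"] x J(1) by blast
    ultimately show False using Dw[OF D(1), of x] D(2) k0 by simp
  qed
  then show "odd (card (fibre z))" using odd by (simp add: subfibre_def)
  show "inf_rigid z"
    unfolding inf_rigid_def
  proof (intro ballI impI)
    fix a assume a: "a \<in> disps" "\<forall>e\<in>E. bil z a e = 0"
    obtain D where D: "D \<in> ders (z ` Bc)" "D \<circ> z = a" using generic_der[OF z(1) a(1)] by blast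
    have "D (len z e) = 0" if "e \<in> E" for e using der_len[OF D(1), of z e] a(2) D(2) that by simp
    then have "D \<in> ?W" using D(1) by (auto simp: base_def ders_Un)
    then have "D (z x) = 0" for x using kz \<open>J = {}\<close> by blast
    then show "a = (\<lambda>_. 0)" using D(2) by auto
  qed
qed

section \<open>Generic simplices and placement relative to them\<close>

lemma generic_affine_independent:
  assumes z: "generic z" and B: "card B = d + 1" "b0 \<in> B"
    and y: "\<And>b. b \<in> B \<Longrightarrow> (\<Sum>i<d. y i * (z (b, i) - z (b0, i))) = 0" and i0: "i0 < d"
  shows "y i0 = 0"
proof (rule ccontr)
  assume ne: "y i0 \<noteq> 0"
  \<comment> \<open>If \<open>y\<close> is normal to a hyperplane through all points of
    \<open>B\<close>, the \<open>i0\<close> coordinates of the \<open>d\<close> points other than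
    \<open>b0\<close> follow from the remaining coordinates and the \<open>d - 1\<close> ratios
    \<open>y i / y i0\<close>. Independent numbers would then be controlled by one number
    fewer.\<close>
  let ?B' = "(B - {b0}) \<times> {i0}"
  let ?S = "(Bc - ?B') <+> ({..<d} - {i0})"
  define c where "c k D = (case k of Inl x \<Rightarrow> D (z x) | Inr i \<Rightarrow> D (y i / y i0))"
    for k :: "'v \<times> nat + nat" and D :: "complex \<Rightarrow> complex"
  have finB: "finite B" using BV finite_V finite_subset by blast
  have "card Bc \<le> card ?S"
  proof (rule onto_card_le[where W = "ders {}" and a = "\<lambda>x D. D (z x)" and b = c])
    show "onto (ders {}) Bc (\<lambda>x D. D (z x))"
      using z onto_mono[of "ders {}" I _ Bc] BV by (auto simp: generic_def)
    show "lfun (ders {}) (c k)" for k by (cases k) (simp_all add: c_def lfun_def)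
    fix D x assume D: "D \<in> ders {}" "\<forall>k\<in>?S. c k D = 0" and x: "x \<in> Bc"
    have Dz: "D (z x) = 0" if "x \<in> Bc - ?B'" for x
      using bspec[OF D(2) InlI[OF that]] by (simp add: c_def)
    have Dy: "D (y i / y i0) = 0" if "i < d" "i \<noteq> i0" for i
      using bspec[OF D(2) InrI[of i]] that by (simp add: c_def)
    show "D (z x) = 0"
    proof (cases "x \<in> ?B'")
      case False
      then show ?thesis using Dz x by blast
    next
      case True
      then obtain b where b: "x = (b, i0)" "b \<in> B" "b \<noteq> b0" by auto
      have "y i0 * (z (b, i0) - z (b0, i0)) + (\<Sum>i\<in>{..<d} - {i0}. y i * (z (b, i) - z (b0, i))) = 0"
        using y[OF b(2)] i0 by (subst (asm) sum.remove[of _ i0]) auto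
      then have "y i0 * (z x - z (b0, i0)) = - (\<Sum>i\<in>{..<d} - {i0}. y i * (z (b, i) - z (b0, i)))"
        using b(1) by (simp add: eq_neg_iff_add_eq_0)
      then have "z x - z (b0, i0) = - (\<Sum>i\<in>{..<d} - {i0}. y i * (z (b, i) - z (b0, i))) / y i0"
        using ne by (metis nonzero_mult_div_cancel_left)
      also have "\<dots> = - (\<Sum>i\<in>{..<d} - {i0}. (y i / y i0) * (z (b, i) - z (b0, i)))"
        by (simp add: sum_divide_distrib)
      finally have zx: "z x = z (b0, i0) - (\<Sum>i\<in>{..<d} - {i0}. (y i / y i0) * (z (b, i) - z (b0, i)))"
        by (simp add: algebra_simps)
      have "D (z x) = D (z (b0, i0)) - (\<Sum>i\<in>{..<d} - {i0}. D (y i / y i0) * (z (b, i) - z (b0, i))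
          + (y i / y i0) * (D (z (b, i)) - D (z (b0, i))))"
        unfolding zx by (simp only: der_diff[OF D(1)] der_sum[OF D(1)] der_mult[OF D(1)])
      also have "\<dots> = 0 - (\<Sum>i\<in>{..<d} - {i0}. 0)"
        using Dz[of "(b0, i0)"] Dz[of "(b, i)" for i] Dz[of "(b0, i)" for i] Dy b B(2) i0
        by (intro arg_cong2[where f = "(-)"] sum.cong refl) auto
      finally show ?thesis by simp
    qed
  qed (use finB lspace_ders lfun_eval in auto)
  moreover have "card ?S = card Bc - card ?B' + (d - 1)"
  proof -
    have "?B' \<subseteq> Bc" using i0 by auto
    then have "card (Bc - ?B') = card Bc - card ?B'" using finB by (intro card_Diff_subset) auto
    then show ?thesis using finB i0 by (subst card_Plus) auto
  qed
  moreover have "card ?B' = d" using B finB by (simp add: card_cartesian_product)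
  moreover have "card Bc = (d + 1) * d" using B by (simp add: card_cartesian_product)
  ultimately show False using i0 by simp
qed

text \<open>Subtracting the equations of two base points removes the quadratic terms and leaves
  \<open>q - p\<close> orthogonal to all edges of the simplex.\<close>

lemma determined_by_base_distances:
  assumes z: "generic z" and B: "card B = d + 1"
    and q: "\<And>b. b \<in> B \<Longrightarrow> (\<Sum>i<d. (q i - z (b, i))^2) = (\<Sum>i<d. (p i - z (b, i))^2)" and i: "i < d"
  shows "q i = p i"
proof -
  obtain b0 where b0: "b0 \<in> B" using B by (metis card.empty add_is_0 equals0I one_neq_zero)
  have "(\<Sum>i<d. (q i - p i) * (z (b, i) - z (b0, i))) = 0" if b: "b \<in> B" for b
  proof -
    have e: "(\<Sum>i<d. (q i - p i) * (q i + p i - 2 * z (b, i))) = 0" if "b \<in> B" for b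
    proof -
      have "(\<Sum>i<d. (q i - p i) * (q i + p i - 2 * z (b, i))) = (\<Sum>i<d. (q i - z (b, i))^2 - (p i - z (b, i))^2)"
        by (intro sum.cong refl) (simp add: power2_eq_square algebra_simps)
      then show ?thesis using q[OF that] by (simp add: sum_subtractf)
    qed
    have "2 * (\<Sum>i<d. (q i - p i) * (z (b, i) - z (b0, i)))
        = (\<Sum>i<d. (q i - p i) * (q i + p i - 2 * z (b0, i)) - (q i - p i) * (q i + p i - 2 * z (b, i)))"
      unfolding sum_distrib_left by (intro sum.cong refl) (simp add: algebra_simps)
    also have "\<dots> = 0" using e[OF b] e[OF b0] by (simp add: sum_subtractf)
    finally show ?thesis by simp
  qed
  then show ?thesis using generic_affine_independent[OF z B b0, of "\<lambda>i. q i - p i" i] i by simp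
qed

end

text \<open>A relation among the \<open>c'\<close> yields, with the same coefficients, a combination
  of the \<open>c\<close> orthogonal to every \<open>c b\<close>. That combination is zero, and the
  coefficients vanish because the functionals given by \<open>c\<close> are independent.\<close>

lemma spanning_of_equal_gram:
  fixes c c' :: "'b \<Rightarrow> nat \<Rightarrow> complex"
  assumes B: "finite B" "card B = d"
    and c: "\<And>y. (\<And>b. b \<in> B \<Longrightarrow> (\<Sum>i<d. y i * c b i) = 0) \<Longrightarrow> \<forall>i<d. y i = 0"
    and gram: "\<And>a b. a \<in> B \<Longrightarrow> b \<in> B \<Longrightarrow> (\<Sum>i<d. c a i * c b i) = (\<Sum>i<d. c' a i * c' b i)"
  shows "\<exists>t. \<forall>i<d. x i = (\<Sum>b\<in>B. t b * c' b i)"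
proof -
  have UN: "lspace UNIV" by (simp add: lspace_def)
  have coord: "onto UNIV J (\<lambda>j y. y j)" for J :: "'i set" by (auto simp: onto_def)
  have on_c: "onto UNIV B (\<lambda>b y. \<Sum>i<d. y i * c b i)"
  proof (rule onto_of_kernel_subset[where J = "{..<d}" and a = "\<lambda>j y. y j"])
    show "lfun UNIV (\<lambda>y. \<Sum>i<d. y i * c b i)" for b
      by (simp add: lfun_def algebra_simps sum.distrib sum_distrib_left)
  qed (use B UN coord c lfun_eval in auto)
  have "onto UNIV {..<d} (\<lambda>i t. \<Sum>b\<in>B. t b * c' b i)"
  proof (rule onto_of_kernel_subset[where J = B and a = "\<lambda>j t. t j"])
    show "lfun UNIV (\<lambda>t. \<Sum>b\<in>B. t b * c' b i)" for i
      by (simp add: lfun_def algebra_simps sum.distrib sum_distrib_left)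
    fix t :: "'b \<Rightarrow> complex" and b
    assume t: "\<forall>i\<in>{..<d}. (\<Sum>b\<in>B. t b * c' b i) = 0" and b: "b \<in> B"
    define u where "u i = (\<Sum>b\<in>B. t b * c b i)" for i
    have swap: "(\<Sum>i<d. (\<Sum>b\<in>B. t b * k b i) * l i) = (\<Sum>b\<in>B. t b * (\<Sum>i<d. k b i * l i))"
      for k :: "'b \<Rightarrow> nat \<Rightarrow> complex" and l
      by (simp add: sum_distrib_right sum_distrib_left mult.assoc) (rule sum.swap)
    have "(\<Sum>i<d. u i * c a i) = 0" if a: "a \<in> B" for a
    proof -
      have "(\<Sum>i<d. u i * c a i) = (\<Sum>b\<in>B. t b * (\<Sum>i<d. c' b i * c' a i))"
        unfolding u_def swap using gram a by simp
      also have "\<dots> = 0" unfolding swap[symmetric] using t by simp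
      finally show ?thesis .
    qed
    then have u: "\<forall>i<d. u i = 0" by (rule c)
    obtain y :: "nat \<Rightarrow> complex" where y: "\<forall>a\<in>B. (\<Sum>i<d. y i * c a i) = (if a = b then 1 else 0)"
      using ontoD[OF on_c, of "\<lambda>a. if a = b then 1 else 0"] by blast
    have "0 = (\<Sum>i<d. u i * y i)" using u by simp
    also have "\<dots> = (\<Sum>a\<in>B. t a * (\<Sum>i<d. y i * c a i))" unfolding u_def swap by (simp add: mult.commute)
    also have "\<dots> = (\<Sum>a\<in>B. if a = b then t a else 0)" using y by (intro sum.cong refl) simp
    also have "\<dots> = t b" using B b by simp
    finally show "t b = 0" by simp
  qed (use B UN coord lfun_eval in auto)
  from ontoD[OF this, of x] show ?thesis by (metis lessThan_iff UNIV_I)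
qed

context pinned_graph
begin

text \<open>The points of \<open>y\<close> are written in the frame of their own simplex and rebuilt
  with the same coefficients in the frame of \<open>z\<close>. Distances depend only on the
  coefficients and the Gram matrix, which the two frames share.\<close>

lemma pinned_representative:
  assumes z: "generic z" and B: "card B = d + 1"
    and dist: "\<And>a b. a \<in> B \<Longrightarrow> b \<in> B \<Longrightarrow> (\<Sum>i<d. (z (a, i) - z (b, i))^2) = (\<Sum>i<d. (y (a, i) - y (b, i))^2)"
  shows "\<exists>q\<in>cfgs. (\<forall>x\<in>Bc. q x = z x) \<and>
    (\<forall>u\<in>V. \<forall>v\<in>V. (\<Sum>i<d. (q (u, i) - q (v, i))^2) = (\<Sum>i<d. (y (u, i) - y (v, i))^2))"
proof -
  obtain b0 where b0: "b0 \<in> B" using B by (metis card.empty add_is_0 equals0I one_neq_zero)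
  define B' where "B' = B - {b0}"
  have finB: "finite B" using BV finite_V finite_subset by blast
  have B': "finite B'" "card B' = d" using finB B b0 by (auto simp: B'_def)
  define c where "c b i = z (b, i) - z (b0, i)" for b i
  define c' where "c' b i = y (b, i) - y (b0, i)" for b i
  have polar: "2 * (\<Sum>i<d. (f a i - f b0 i) * (f b i - f b0 i)) = (\<Sum>i<d. (f a i - f b0 i)^2)
      + (\<Sum>i<d. (f b i - f b0 i)^2) - (\<Sum>i<d. (f a i - f b i)^2)" for a b and f :: "'v \<Rightarrow> nat \<Rightarrow> complex"
    unfolding sum_distrib_left sum.distrib[symmetric] sum_subtractf[symmetric]
    by (intro sum.cong refl) (simp add: power2_eq_square algebra_simps)
  have gram: "(\<Sum>i<d. c a i * c b i) = (\<Sum>i<d. c' a i * c' b i)" if "a \<in> B'" "b \<in> B'" for a b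
  proof -
    have "a \<in> B" "b \<in> B" using that by (auto simp: B'_def)
    then have "2 * (\<Sum>i<d. c a i * c b i) = 2 * (\<Sum>i<d. c' a i * c' b i)"
      unfolding c_def c'_def polar[of "\<lambda>v i. z (v, i)"] polar[of "\<lambda>v i. y (v, i)"]
      using dist[of a b0] dist[of b b0] dist[of a b] b0 by simp
    then show ?thesis by simp
  qed
  have "\<forall>i<d. x i = 0" if x: "\<And>b. b \<in> B' \<Longrightarrow> (\<Sum>i<d. x i * c b i) = 0" for x
  proof (intro allI impI)
    fix i assume "i < d"
    show "x i = 0"
    proof (rule generic_affine_independent[OF z B b0 _ \<open>i < d\<close>])
      show "(\<Sum>i<d. x i * (z (b, i) - z (b0, i))) = 0" if "b \<in> B" for b
        using x[of b] that by (cases "b = b0") (auto simp: B'_def c_def)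
    qed
  qed
  then have ex: "\<exists>t. \<forall>i<d. x i = (\<Sum>b\<in>B'. t b * c' b i)" for x
    by (rule spanning_of_equal_gram[where c = c, OF B' _ gram])
  have "\<forall>v. \<exists>t. \<forall>i<d. y (v, i) - y (b0, i) = (\<Sum>b\<in>B'. t b * c' b i)"
    by (rule allI) (rule ex)
  from choice[OF this] obtain t0
    where "\<forall>v. \<forall>i<d. y (v, i) - y (b0, i) = (\<Sum>b\<in>B'. t0 v b * c' b i)" by (rule exE)
  then have t0: "\<And>v i. i < d \<Longrightarrow> y (v, i) - y (b0, i) = (\<Sum>b\<in>B'. t0 v b * c' b i)" by blast
  \<comment> \<open>On \<open>B\<close> the coefficients are prescribed as unit vectors, so that
    \<open>q\<close> agrees with \<open>z\<close> there at once.\<close>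
  define t where "t v b = (if v \<in> B then if v = b then 1 else 0 else t0 v b)" for v b
  have unit: "(\<Sum>b\<in>B'. t v b * k b i) = (if v = b0 then 0 else k v i)" if "v \<in> B" for v i
      and k :: "'v \<Rightarrow> nat \<Rightarrow> complex"
  proof -
    have "(\<Sum>b\<in>B'. t v b * k b i) = (\<Sum>b\<in>B'. if b = v then k v i else 0)"
      using that by (intro sum.cong refl) (auto simp: t_def)
    then show ?thesis using B'(1) that by (simp add: B'_def)
  qed
  have t: "y (v, i) - y (b0, i) = (\<Sum>b\<in>B'. t v b * c' b i)" if "i < d" for v i
  proof (cases "v \<in> B")
    case True
    have "(\<Sum>b\<in>B'. t v b * c' b i) = y (v, i) - y (b0, i)"
      unfolding unit[OF True] by (simp add: c'_def)
    then show ?thesis by simp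
  next
    case False
    then show ?thesis using t0[OF that, of v] by (simp only: t_def if_False)
  qed
  define q where "q x = (if x \<in> I then z (b0, snd x) + (\<Sum>b\<in>B'. t (fst x) b * c b (snd x)) else 0)" for x
  have quad: "(\<Sum>i<d. (\<Sum>b\<in>B'. h b * k b i)^2) = (\<Sum>a\<in>B'. \<Sum>b\<in>B'. h a * h b * (\<Sum>i<d. k a i * k b i))"
    for h and k :: "'v \<Rightarrow> nat \<Rightarrow> complex"
  proof -
    have "(\<Sum>i<d. (\<Sum>b\<in>B'. h b * k b i)^2) = (\<Sum>i<d. \<Sum>a\<in>B'. \<Sum>b\<in>B'. h a * h b * (k a i * k b i))"
      unfolding power2_eq_square sum_product by (intro sum.cong refl) (simp only: ac_simps)
    also have "\<dots> = (\<Sum>a\<in>B'. \<Sum>i<d. \<Sum>b\<in>B'. h a * h b * (k a i * k b i))" by (rule sum.swap)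
    also have "\<dots> = (\<Sum>a\<in>B'. \<Sum>b\<in>B'. \<Sum>i<d. h a * h b * (k a i * k b i))"
      by (intro sum.cong refl) (rule sum.swap)
    finally show ?thesis by (simp add: sum_distrib_left)
  qed
  show ?thesis
  proof (intro bexI conjI ballI)
    show "q \<in> cfgs" by (simp add: cfgs_def q_def)
    fix x assume "x \<in> Bc"
    show "q x = z x"
    proof -
      obtain v i where x: "x = (v, i)" "v \<in> B" "i < d" using \<open>x \<in> Bc\<close> by auto
      then have "x \<in> I" using BV by auto
      then show ?thesis using unit[OF x(2), of c i] x by (simp add: q_def c_def)
    qed
  next
    fix u v assume uv: "u \<in> V" "v \<in> V"
    have "(\<Sum>i<d. (q (u, i) - q (v, i))^2) = (\<Sum>i<d. (\<Sum>b\<in>B'. (t u b - t v b) * c b i)^2)"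
      using uv by (intro sum.cong refl) (simp add: q_def left_diff_distrib sum_subtractf)
    also have "\<dots> = (\<Sum>i<d. (\<Sum>b\<in>B'. (t u b - t v b) * c' b i)^2)"
      unfolding quad using gram by simp
    also have "\<dots> = (\<Sum>i<d. (y (u, i) - y (v, i))^2)"
    proof (intro sum.cong refl)
      fix i assume "i \<in> {..<d}"
      then have "y (u, i) - y (v, i) = (\<Sum>b\<in>B'. (t u b - t v b) * c' b i)"
      proof -
        have "y (u, i) - y (v, i) = (y (u, i) - y (b0, i)) - (y (v, i) - y (b0, i))" by simp
        also have "\<dots> = (\<Sum>b\<in>B'. t u b * c' b i) - (\<Sum>b\<in>B'. t v b * c' b i)"
          using t[of i u] t[of i v] \<open>i \<in> {..<d}\<close> by (simp only: lessThan_iff)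
        finally show ?thesis by (simp only: left_diff_distrib sum_subtractf)
      qed
      then show "(\<Sum>b\<in>B'. (t u b - t v b) * c' b i)^2 = (y (u, i) - y (v, i))^2" by simp
    qed
    finally show "(\<Sum>i<d. (q (u, i) - q (v, i))^2) = (\<Sum>i<d. (y (u, i) - y (v, i))^2)" .
  qed
qed

end

section \<open>Generic frameworks\<close>

lemma prod_power_upd:
  fixes r :: "'k \<Rightarrow> real"
  assumes "finite I" "x \<in> I"
  shows "(\<Prod>y\<in>I. r y ^ (m(x := n)) y) = r x ^ n * (\<Prod>y\<in>I - {x}. r y ^ m y)"
proof -
  have "(\<Prod>y\<in>I. r y ^ (m(x := n)) y) = r x ^ (m(x := n)) x * (\<Prod>y\<in>I - {x}. r y ^ (m(x := n)) y)"
    by (rule prod.remove[OF assms])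
  also have "(\<Prod>y\<in>I - {x}. r y ^ (m(x := n)) y) = (\<Prod>y\<in>I - {x}. r y ^ m y)"
    by (intro prod.cong refl) simp
  finally show ?thesis by simp
qed

text \<open>Monomials are evaluated over all of \<open>I\<close> although supported in
  \<open>I'\<close>, which leaves room for powers of a further variable.\<close>

definition poly_rep :: "('k \<Rightarrow> real) \<Rightarrow> 'k set \<Rightarrow> 'k set \<Rightarrow> ('k \<Rightarrow> nat) set \<Rightarrow> (('k \<Rightarrow> nat) \<Rightarrow> rat) \<Rightarrow> complex \<Rightarrow> bool" where
  "poly_rep r I I' M c a \<longleftrightarrow> finite M \<and> (\<forall>m\<in>M. \<forall>x. x \<notin> I' \<longrightarrow> m x = 0) \<and>
    a = complex_of_real (\<Sum>m\<in>M. of_rat (c m) * (\<Prod>x\<in>I. r x ^ m x))"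

lemma rgen_polynomial:
  fixes r :: "'k \<Rightarrow> real"
  assumes I: "finite I" "I' \<subseteq> I" and a: "a \<in> rgen ((\<lambda>x. complex_of_real (r x)) ` I')"
  shows "\<exists>M c. poly_rep r I I' M c a"
  unfolding poly_rep_def using a
proof induction
  case rgen_one
  show ?case by (intro exI[of _ "{\<lambda>_. 0}"] exI[of _ "\<lambda>_. 1"]) simp
next
  case (rgen_minus a b)
  then obtain M N and c e :: "('k \<Rightarrow> nat) \<Rightarrow> rat" where
    M: "finite M" "\<forall>m\<in>M. \<forall>x. x \<notin> I' \<longrightarrow> m x = 0"
      "a = complex_of_real (\<Sum>m\<in>M. of_rat (c m) * (\<Prod>x\<in>I. r x ^ m x))" and
    N: "finite N" "\<forall>m\<in>N. \<forall>x. x \<notin> I' \<longrightarrow> m x = 0"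
      "b = complex_of_real (\<Sum>m\<in>N. of_rat (e m) * (\<Prod>x\<in>I. r x ^ m x))" by blast
  define k where "k m = (if m \<in> M then c m else 0) - (if m \<in> N then e m else 0)" for m
  have ext: "(\<Sum>m\<in>L. of_rat (f m) * (\<Prod>x\<in>I. r x ^ m x))
      = (\<Sum>m\<in>M \<union> N. of_rat (if m \<in> L then f m else 0) * (\<Prod>x\<in>I. r x ^ m x))"
    if "L \<subseteq> M \<union> N" for L f
    by (rule sum.mono_neutral_cong_left) (use that M(1) N(1) in auto)
  have "a - b = complex_of_real (\<Sum>m\<in>M \<union> N. of_rat (k m) * (\<Prod>x\<in>I. r x ^ m x))"
    unfolding M(3) N(3) of_real_diff[symmetric] ext[of M c, OF Un_upper1] ext[of N e, OF Un_upper2]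
      sum_subtractf[symmetric] k_def of_rat_diff left_diff_distrib ..
  then show ?case using M(1,2) N(1,2) by (intro exI[of _ "M \<union> N"] exI[of _ k]) auto
next
  case (rgen_gen y a)
  then obtain M and c :: "('k \<Rightarrow> nat) \<Rightarrow> rat" where
    M: "finite M" "\<forall>m\<in>M. \<forall>x. x \<notin> I' \<longrightarrow> m x = 0"
      "a = complex_of_real (\<Sum>m\<in>M. of_rat (c m) * (\<Prod>x\<in>I. r x ^ m x))" by blast
  obtain x0 where x0: "x0 \<in> I'" "y = complex_of_real (r x0)" using rgen_gen(1) by blast
  have x0I: "x0 \<in> I" using x0 I by blast
  define h where "h m = m(x0 := Suc (m x0))" for m :: "'k \<Rightarrow> nat"
  define g where "g m = m(x0 := m x0 - 1)" for m :: "'k \<Rightarrow> nat"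
  have gh: "g (h m) = m" for m by (simp add: g_def h_def)
  have inj: "inj_on h M" by (rule inj_on_inverseI[of _ g]) (rule gh)
  have prod: "(\<Prod>x\<in>I. r x ^ h m x) = r x0 * (\<Prod>x\<in>I. r x ^ m x)" for m
    unfolding h_def prod_power_upd[OF I(1) x0I] prod.remove[OF I(1) x0I, of "\<lambda>x. r x ^ m x"] by simp
  have "(\<Sum>m\<in>h ` M. of_rat (c (g m)) * (\<Prod>x\<in>I. r x ^ m x)) = r x0 * (\<Sum>m\<in>M. of_rat (c m) * (\<Prod>x\<in>I. r x ^ m x))"
    unfolding sum.reindex[OF inj] comp_def gh prod sum_distrib_left by (intro sum.cong refl) simp
  then have "y * a = complex_of_real (\<Sum>m\<in>h ` M. of_rat (c (g m)) * (\<Prod>x\<in>I. r x ^ m x))"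
    by (simp add: x0(2) M(3))
  moreover have "\<forall>m\<in>h ` M. \<forall>x. x \<notin> I' \<longrightarrow> m x = 0" using M(2) x0(1) by (auto simp: h_def)
  ultimately show ?case using M(1) by (intro exI[of _ "h ` M"] exI[of _ "\<lambda>m. c (g m)"]) simp
qed

text \<open>An algebraic equation of one coordinate over the others expands into a rational
  polynomial relation among all coordinates, against genericity.\<close>

lemma generic_coordinate_der:
  assumes gen: "generic_fw V d \<rho>" and V: "finite V" and x0: "x0 \<in> V \<times> {..<d}"
  defines "r \<equiv> \<lambda>x. \<rho> (fst x) (snd x)"
  shows "\<exists>D\<in>ders ((\<lambda>x. complex_of_real (r x)) ` (V \<times> {..<d} - {x0})). D (complex_of_real (r x0)) = 1"
proof -
  let ?I = "V \<times> {..<d}"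
  let ?X = "(\<lambda>x. complex_of_real (r x)) ` (?I - {x0})"
  have finI: "finite ?I" using V by simp
  have "poly p (complex_of_real (r x0)) \<noteq> 0" if p: "over (rgen ?X) p" "p \<noteq> 0" for p
  proof
    assume root: "poly p (complex_of_real (r x0)) = 0"
    have "\<forall>i. \<exists>M c. poly_rep r ?I (?I - {x0}) M c (coeff p i)"
      by (rule allI, rule rgen_polynomial[OF finI Diff_subset]) (use p(1) in \<open>simp add: over_def\<close>)
    from choice[OF this] obtain M
      where "\<forall>i. \<exists>c. poly_rep r ?I (?I - {x0}) (M i) c (coeff p i)" ..
    from choice[OF this] obtain c
      where "\<forall>i. poly_rep r ?I (?I - {x0}) (M i) (c i) (coeff p i)" ..
    note rep' = spec[OF this[unfolded poly_rep_def]]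
    have supp: "\<forall>m\<in>M i. \<forall>x. x \<notin> ?I - {x0} \<longrightarrow> m x = 0" for i
      by (rule conjunct1[OF conjunct2[OF rep']])
    have M: "\<And>i. finite (M i)" "\<And>i m x. m \<in> M i \<Longrightarrow> x \<notin> ?I - {x0} \<Longrightarrow> m x = 0"
        "\<And>i. coeff p i = complex_of_real (\<Sum>m\<in>M i. of_rat (c i m) * (\<Prod>x\<in>?I. r x ^ m x))"
      by (rule conjunct1[OF rep'], erule (1) supp[THEN bspec, THEN spec, THEN mp], rule conjunct2[OF conjunct2[OF rep']])
    define K where "K = Sigma {..degree p} M"
    \<comment> \<open>A power of \<open>x0\<close> and a monomial without \<open>x0\<close> are
      merged into one monomial; \<open>C\<close> recovers the coefficient by splitting it
      again.\<close>
    define h where "h k = (snd k)(x0 := fst k)" for k :: "nat \<times> ('a \<times> nat \<Rightarrow> nat)"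
    define C where "C m = c (m x0) (m(x0 := 0))" for m
    have h_inv: "(h (i, m)) x0 = i \<and> (h (i, m))(x0 := 0) = m" if "m \<in> M i" for i m
      using M(2)[OF that, of x0] by (auto simp: h_def)
    have inj: "inj_on h K"
      by (rule inj_on_inverseI[of _ "\<lambda>m. (m x0, m(x0 := 0))"]) (use h_inv in \<open>auto simp: K_def\<close>)
    have mon: "(\<Prod>x\<in>?I. r x ^ h (i, m) x) = r x0 ^ i * (\<Prod>x\<in>?I. r x ^ m x)" if "m \<in> M i" for i m
    proof -
      have "(\<Prod>x\<in>?I. r x ^ m x) = (\<Prod>x\<in>?I - {x0}. r x ^ m x)"
        using M(2)[OF that, of x0] by (simp add: prod.remove[OF finI x0])
      then show ?thesis unfolding h_def using prod_power_upd[OF finI x0, of r m i] by simp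
    qed
    have "(\<Sum>m\<in>h ` K. of_rat (C m) * (\<Prod>x\<in>?I. r x ^ m x))
        = (\<Sum>k\<in>K. of_rat (C (h k)) * (\<Prod>x\<in>?I. r x ^ h k x))"
      by (simp add: sum.reindex[OF inj])
    also have "\<dots> = (\<Sum>i\<le>degree p. \<Sum>m\<in>M i. of_rat (C (h (i, m))) * (\<Prod>x\<in>?I. r x ^ h (i, m) x))"
      unfolding K_def by (subst sum.Sigma) (use M(1) in \<open>auto simp: case_prod_unfold\<close>)
    also have "\<dots> = (\<Sum>i\<le>degree p. \<Sum>m\<in>M i. of_rat (c i m) * (r x0 ^ i * (\<Prod>x\<in>?I. r x ^ m x)))"
      by (intro sum.cong refl) (simp add: mon C_def h_inv)
    also have "\<dots> = (\<Sum>i\<le>degree p. (\<Sum>m\<in>M i. of_rat (c i m) * (\<Prod>x\<in>?I. r x ^ m x)) * r x0 ^ i)"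
      unfolding sum_distrib_right by (intro sum.cong refl) simp
    finally have "complex_of_real (\<Sum>m\<in>h ` K. of_rat (C m) * (\<Prod>x\<in>?I. r x ^ m x))
        = poly p (complex_of_real (r x0))"
      unfolding poly_altdef M(3) by simp
    then have "(\<Sum>m\<in>h ` K. of_rat (C m) * (\<Prod>x\<in>?I. r x ^ m x)) = 0"
      unfolding root of_real_eq_0_iff .
    then have "(\<Sum>m\<in>h ` K. of_rat (C m) * (\<Prod>x\<in>?I. \<rho> (fst x) (snd x) ^ m x)) = 0"
      unfolding r_def .
    moreover have "finite (h ` K)" using M(1) by (simp add: K_def)
    moreover have "\<forall>m\<in>h ` K. \<forall>x. x \<notin> ?I \<longrightarrow> m x = 0"
    proof (intro ballI allI impI)
      fix m x assume "m \<in> h ` K" and x: "x \<notin> ?I"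
      then obtain i m' where m: "m' \<in> M i" "m = m'(x0 := i)" by (auto simp: K_def h_def)
      have "m' x = 0" by (rule M(2)[OF m(1)]) (use x in blast)
      moreover have "x \<noteq> x0" using x x0 by blast
      ultimately show "m x = 0" by (simp add: m(2))
    qed
    ultimately have zero: "\<forall>m\<in>h ` K. C m = 0" using gen unfolding generic_fw_def by blast
    have "c i m = 0" if "i \<le> degree p" "m \<in> M i" for i m
    proof -
      have "C (h (i, m)) = 0" using zero that by (auto simp: K_def)
      then show ?thesis using h_inv[OF that(2)] by (simp add: C_def)
    qed
    then have "lead_coeff p = 0" unfolding M(3) by simp
    then show False using p(2) by simp
  qed
  from derivation_exists[OF subring_rgen this] obtain D where D: "D \<in> ders (rgen ?X)" "D (complex_of_real (r x0)) = 1" by blast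
  have "D \<in> ders ?X" by (rule ders_mono[OF D(1)]) (auto intro: rgen_base)
  then show ?thesis using D(2) by blast
qed

lemma generic_fw_onto:
  assumes gen: "generic_fw V d \<rho>" and V: "finite V" and J: "J \<subseteq> V \<times> {..<d}"
  shows "onto (ders {}) J (\<lambda>x D. D (complex_of_real (\<rho> (fst x) (snd x))))"
proof -
  have "finite J" using J V finite_subset by fastforce
  then show ?thesis using J
  proof (induction J rule: finite_induct)
    case empty
    then show ?case using lspace_ders[of "{}"] by (auto simp: onto_def lspace_def)
  next
    case (insert x J)
    let ?r = "\<lambda>x. complex_of_real (\<rho> (fst x) (snd x))"
    have xI: "x \<in> V \<times> {..<d}" using insert.prems by blast
    obtain D0 where D0: "D0 \<in> ders (?r ` (V \<times> {..<d} - {x}))" "D0 (?r x) = 1"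
      using generic_coordinate_der[OF gen V xI] by blast
    have D0': "D0 \<in> ders {}" by (rule ders_mono[OF D0(1)]) simp
    have IH: "onto (ders {}) J (\<lambda>x D. D (?r x))" by (rule insert.IH) (use insert.prems in blast)
    show ?case
      unfolding onto_def
    proof
      fix \<delta> :: "'a \<times> nat \<Rightarrow> complex"
      obtain D where D: "D \<in> ders {}" "\<forall>y\<in>J. D (?r y) = \<delta> y" using ontoD[OF IH] by blast
      define k where "k = \<delta> x - D (?r x)"
      have "k * D0 (?r y) + D (?r y) = \<delta> y" if "y \<in> insert x J" for y
      proof (cases "y = x")
        case True
        then show ?thesis using D0(2) by (simp add: k_def)
      next
        case False
        then have "y \<in> J" "y \<in> V \<times> {..<d} - {x}" using that insert.prems by blast+
        then show ?thesis using D(2) der_const[OF D0(1), of "?r y"] by simp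
      qed
      then show "\<exists>D\<in>ders {}. \<forall>y\<in>insert x J. D (?r y) = \<delta> y"
        using lspaceD[OF lspace_ders D0' D(1), of k] by (intro bexI[of _ "\<lambda>u. k * D0 u + D u"]) auto
    qed
  qed
qed

lemma generic_fw_subset:
  assumes gen: "generic_fw V d \<rho>" and V: "finite V" "V0 \<subseteq> V"
  shows "generic_fw V0 d \<rho>"
  unfolding generic_fw_def
proof (intro allI impI)
  fix M :: "('a \<times> nat \<Rightarrow> nat) set" and c :: "('a \<times> nat \<Rightarrow> nat) \<Rightarrow> rat"
  assume M: "finite M" "\<forall>m\<in>M. \<forall>x. x \<notin> V0 \<times> {..<d} \<longrightarrow> m x = 0"
    "(\<Sum>m\<in>M. real_of_rat (c m) * (\<Prod>x\<in>V0 \<times> {..<d}. \<rho> (fst x) (snd x) ^ m x)) = 0"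
  have sub: "V0 \<times> {..<d} \<subseteq> V \<times> {..<d}" using V by blast
  have "(\<Prod>x\<in>V \<times> {..<d}. \<rho> (fst x) (snd x) ^ m x) = (\<Prod>x\<in>V0 \<times> {..<d}. \<rho> (fst x) (snd x) ^ m x)" if "m \<in> M" for m
  proof (rule prod.mono_neutral_right)
    show "\<forall>x\<in>V \<times> {..<d} - V0 \<times> {..<d}. \<rho> (fst x) (snd x) ^ m x = 1"
      using bspec[OF M(2) that] by simp
  qed (use V sub in auto)
  then have "(\<Sum>m\<in>M. real_of_rat (c m) * (\<Prod>x\<in>V \<times> {..<d}. \<rho> (fst x) (snd x) ^ m x)) = 0"
    using M(3) by simp
  moreover have "\<forall>m\<in>M. \<forall>x. x \<notin> V \<times> {..<d} \<longrightarrow> m x = 0" using M(2) sub by blast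
  ultimately show "\<forall>m\<in>M. c m = 0" using gen M(1) unfolding generic_fw_def by blast
qed

section \<open>Frameworks as complex configurations\<close>

definition complexify :: "nat \<Rightarrow> 'v set \<Rightarrow> nat \<Rightarrow> ('v \<Rightarrow> nat \<Rightarrow> real) \<Rightarrow> 'v \<times> nat \<Rightarrow> complex" where
  "complexify s V d \<rho> x = (if x \<in> V \<times> {..<d}
     then (if snd x < s then \<i> else 1) * complex_of_real (\<rho> (fst x) (snd x)) else 0)"

lemma sqlen_complexify:
  assumes "s \<le> d" "t \<in> V" "u \<in> V"
  shows "complex_of_real (sqlen s d (diffv (\<rho> t) (\<rho> u)))
    = (\<Sum>i<d. (complexify s V d \<rho> (t, i) - complexify s V d \<rho> (u, i))^2)"
proof -
  have "(\<Sum>i<d. (complexify s V d \<rho> (t, i) - complexify s V d \<rho> (u, i))^2)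
      = (\<Sum>i<d. complex_of_real ((if i < s then - 1 else 1) * (\<rho> t i - \<rho> u i)^2))"
  proof (rule sum.cong[OF refl])
    fix i assume "i \<in> {..<d}"
    then have "complexify s V d \<rho> (t, i) - complexify s V d \<rho> (u, i)
        = (if i < s then \<i> else 1) * complex_of_real (\<rho> t i - \<rho> u i)"
      using assms(2,3) by (simp add: complexify_def right_diff_distrib)
    then show "(complexify s V d \<rho> (t, i) - complexify s V d \<rho> (u, i))^2
        = complex_of_real ((if i < s then - 1 else 1) * (\<rho> t i - \<rho> u i)^2)"
      by (simp add: power_mult_distrib)
  qed
  also have "\<dots> = complex_of_real (\<Sum>i<d. (if i < s then - 1 else 1) * (\<rho> t i - \<rho> u i)^2)" by simp
  also have "(\<Sum>i<d. (if i < s then - 1 else 1) * (\<rho> t i - \<rho> u i)^2)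
      = (\<Sum>i<s. (if i < s then - 1 else 1) * (\<rho> t i - \<rho> u i)^2) + (\<Sum>i\<in>{s..<d}. (if i < s then - 1 else 1) * (\<rho> t i - \<rho> u i)^2)"
    using assms(1) by (simp only: lessThan_atLeast0 sum.atLeastLessThan_concat[of 0 s d] le0)
  also have "\<dots> = sqlen s d (diffv (\<rho> t) (\<rho> u))"
    by (simp add: sqlen_def diffv_def sum_negf)
  finally show ?thesis by simp
qed

lemma congruent_of_complexify:
  assumes "s \<le> d"
    "\<And>t u. t \<in> V \<Longrightarrow> u \<in> V \<Longrightarrow> (\<Sum>i<d. (complexify s V d \<rho> (t, i) - complexify s V d \<rho> (u, i))^2)
      = (\<Sum>i<d. (complexify s V d \<sigma> (t, i) - complexify s V d \<sigma> (u, i))^2)"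
  shows "congruent_fw s d V \<rho> \<sigma>"
  unfolding congruent_fw_def
proof (intro ballI)
  fix t u assume tu: "t \<in> V" "u \<in> V"
  show "sqlen s d (diffv (\<rho> t) (\<rho> u)) = sqlen s d (diffv (\<sigma> t) (\<sigma> u))"
    unfolding of_real_eq_iff[symmetric, where 'a = complex]
      sqlen_complexify[OF assms(1) tu, of \<rho>] sqlen_complexify[OF assms(1) tu, of \<sigma>]
    by (rule assms(2)[OF tu])
qed

lemma sqlen_commute: "sqlen s d (diffv x y) = sqlen s d (diffv y x)"
  unfolding sqlen_def diffv_def by (subst (1 2) power2_commute) (rule refl)

lemma graph_ends:
  assumes "is_graph V E"
  obtains f g where "\<And>e. e \<in> E \<Longrightarrow> e = {f e, g e}" "\<And>e. e \<in> E \<Longrightarrow> f e \<in> V" "\<And>e. e \<in> E \<Longrightarrow> g e \<in> V"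
proof -
  have "\<exists>p. e = {fst p, snd p}" if e: "e \<in> E" for e
  proof -
    obtain x y where "e = {x, y}" using assms e by (auto simp: is_graph_def card_2_iff)
    then show ?thesis by (intro exI[of _ "(x, y)"]) simp
  qed
  then have "\<forall>e\<in>E. \<exists>p. e = {fst p, snd p}" by blast
  from bchoice[OF this] obtain p where p: "\<forall>e\<in>E. e = {fst (p e), snd (p e)}" ..
  have "fst (p e) \<in> V \<and> snd (p e) \<in> V" if "e \<in> E" for e
  proof -
    have "e \<subseteq> V" using assms that by (simp add: is_graph_def)
    moreover have "fst (p e) \<in> e" "snd (p e) \<in> e" using bspec[OF p that] by (metis insertCI)+
    ultimately show ?thesis by blast
  qed
  then show ?thesis using that[of "\<lambda>e. fst (p e)" "\<lambda>e. snd (p e)"] bspec[OF p] by blast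
qed

section \<open>Comparison of the two parities\<close>

theorem mainTheorem4:
  fixes s d :: nat and V V0 :: "'v set" and E E0 :: "'v set set"
  assumes "s \<le> d"
    and "is_graph V E"
    and "\<not> gen_globally_rigid s d V E"
    and "is_graph V0 E0" and "V0 \<subseteq> V" and "E0 \<subseteq> E"
    and "card V0 \<ge> d + 1"
    and "gen_globally_rigid s d V0 E0"
  shows "gen_globally_flexible s d V E"
proof (rule ccontr)
  assume "\<not> gen_globally_flexible s d V E"
  then obtain \<rho>1 where \<rho>1: "generic_fw V d \<rho>1" "globally_rigid s d V E \<rho>1"
    by (auto simp: gen_globally_flexible_def globally_flexible_def)
  have finV: "finite V" using assms(2) by (simp add: is_graph_def)
  have "E \<subseteq> Pow V" using assms(2) by (auto simp: is_graph_def)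
  then have finE: "finite E" using finV finite_subset by blast
  obtain f g where fg: "\<And>e. e \<in> E \<Longrightarrow> e = {f e, g e}" "\<And>e. e \<in> E \<Longrightarrow> f e \<in> V" "\<And>e. e \<in> E \<Longrightarrow> g e \<in> V"
    using graph_ends[OF assms(2)] by metis
  obtain B where B: "B \<subseteq> V0" "card B = d + 1"
    using obtain_subset_with_card_n[OF assms(7)] by metis
  interpret pinned_graph V d E f g B
    by unfold_locales (use finV finE B assms(5) fg(2,3) in auto)
  let ?c = "complexify s V d"
  have cc: "?c \<rho> \<in> cfgs" for \<rho> by (simp add: cfgs_def complexify_def)
  have gen: "generic (?c \<rho>)" if \<rho>: "generic_fw V d \<rho>" for \<rho>
    unfolding generic_def onto_def
  proof (intro conjI allI cc)
    fix \<delta> :: "'v \<times> nat \<Rightarrow> complex"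
    let ?k = "\<lambda>x::'v \<times> nat. if snd x < s then \<i> else 1"
    obtain D where D: "D \<in> ders {}" "\<forall>x\<in>I. D (complex_of_real (\<rho> (fst x) (snd x))) = \<delta> x / ?k x"
      using ontoD[OF generic_fw_onto[OF \<rho> finV subset_refl], of "\<lambda>x. \<delta> x / ?k x"] by blast
    have "D (?c \<rho> x) = \<delta> x" if "x \<in> I" for x
      using bspec[OF D(2) that] that der_mult[OF D(1)] der_imaginary[OF D(1)] der_one[OF D(1)]
      by (simp add: complexify_def split: if_splits)
    then show "\<exists>D\<in>ders {}. \<forall>x\<in>I. D (?c \<rho> x) = \<delta> x" using D(1) by blast
  qed
  have len: "len (?c \<rho>) e = complex_of_real (sqlen s d (diffv (\<rho> (f e)) (\<rho> (g e))))" if "e \<in> E" for \<rho> e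
    using sqlen_complexify[OF assms(1) fg(2)[OF that] fg(3)[OF that], of \<rho>]
    by (simp add: len_def bil_def power2_eq_square)
  \<comment> \<open>A point fixed by \<open>sconj s\<close> comes from a framework
    \<open>\<sigma>\<close> of the same signature. Global rigidity of \<open>\<rho>1\<close> and the
    distances to the pinned simplex then identify it.\<close>
  have uniq: "q = ?c \<rho>1" if q: "q \<in> fibre (?c \<rho>1)" "sconj s q = q" for q
  proof -
    define \<sigma> where "\<sigma> v i = (if i < s then Im (q (v, i)) else Re (q (v, i)))" for v i
    have "?c \<sigma> x = q x" for x
    proof (cases "x \<in> I")
      case True
      have "(if snd x < s then - 1 else 1) * cnj (q x) = q x" using fun_cong[OF q(2), of x] by (simp add: sconj_def)
      then show ?thesis using True
        by (auto simp: complexify_def \<sigma>_def complex_eq_iff split: if_splits)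
    next
      case False
      then show ?thesis using cfgsD[OF fibreD(1)[OF q(1)]] by (simp add: complexify_def)
    qed
    then have qs: "?c \<sigma> = q" by blast
    have "sqlen s d (diffv (\<rho>1 t) (\<rho>1 u)) = sqlen s d (diffv (\<sigma> t) (\<sigma> u))" if tu: "{t, u} \<in> E" for t u
    proof -
      define a b where "a = f {t, u}" and "b = g {t, u}"
      have "len (?c \<sigma>) {t, u} = len (?c \<rho>1) {t, u}" using fibreD(3)[OF q(1) tu] qs by simp
      then have ab: "sqlen s d (diffv (\<sigma> a) (\<sigma> b)) = sqlen s d (diffv (\<rho>1 a) (\<rho>1 b))"
        unfolding len[OF tu] of_real_eq_iff a_def b_def .
      have "{t, u} = {a, b}" unfolding a_def b_def by (rule fg(1)[OF tu])
      then consider "t = a" "u = b" | "t = b" "u = a" by (auto simp: doubleton_eq_iff)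
      then show ?thesis
      proof cases
        case 1
        then show ?thesis using ab by simp
      next
        case 2
        then show ?thesis using ab sqlen_commute[of s d "\<sigma> a" "\<sigma> b"] sqlen_commute[of s d "\<rho>1 a" "\<rho>1 b"] by simp
      qed
    qed
    then have "equivalent_fw s d E \<rho>1 \<sigma>" by (simp add: equivalent_fw_def)
    then have cong: "congruent_fw s d V \<rho>1 \<sigma>" using \<rho>1(2) by (simp add: globally_rigid_def)
    have "q (v, i) = ?c \<rho>1 (v, i)" if v: "v \<in> V" "i < d" for v i
    proof (rule determined_by_base_distances[OF gen[OF \<rho>1(1)] B(2), of "\<lambda>i. q (v, i)" "\<lambda>i. ?c \<rho>1 (v, i)"])
      fix b assume b: "b \<in> B"
      then have bV: "b \<in> V" using BV by blast
      have "(\<Sum>i<d. (q (v, i) - ?c \<rho>1 (b, i))^2) = (\<Sum>i<d. (q (v, i) - q (b, i))^2)"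
        using fibreD(2)[OF q(1)] b by (intro sum.cong refl) simp
      also have "\<dots> = complex_of_real (sqlen s d (diffv (\<sigma> v) (\<sigma> b)))"
        using sqlen_complexify[OF assms(1) v(1) bV, of \<sigma>] qs by simp
      also have "\<dots> = complex_of_real (sqlen s d (diffv (\<rho>1 v) (\<rho>1 b)))"
        using cong v(1) bV by (simp add: congruent_fw_def)
      also have "\<dots> = (\<Sum>i<d. (?c \<rho>1 (v, i) - ?c \<rho>1 (b, i))^2)" by (rule sqlen_complexify[OF assms(1) v(1) bV])
      finally show "(\<Sum>i<d. (q (v, i) - ?c \<rho>1 (b, i))^2) = (\<Sum>i<d. (?c \<rho>1 (v, i) - ?c \<rho>1 (b, i))^2)" .
    qed (rule v)
    moreover have "q x = ?c \<rho>1 x" if "x \<notin> I" for x using cfgsD[OF fibreD(1)[OF q(1)] that] cfgsD[OF cc that] by simp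
    ultimately show ?thesis by (intro ext) (metis SigmaE lessThan_iff)
  qed
  have sc: "sconj s (?c \<rho>1) = ?c \<rho>1" by (auto simp: sconj_def complexify_def)
  have rig1: "inf_rigid (?c \<rho>1)" and odd: "odd (card (fibre (?c \<rho>1)))"
    using unique_real_fibre_point[OF gen[OF \<rho>1(1)] sc] uniq by blast+
  \<comment> \<open>The evenness argument requires a Euclidean real configuration, so rigidity and
    the count are transferred to a generic one.\<close>
  obtain r where r: "onto (ders {}) I (\<lambda>x D. D (complex_of_real (r x)))"
    using generic_negative_reals[OF finite_index(1), of "{}"] by auto
  define zR where "zR x = (if x \<in> I then complex_of_real (r x) else 0)" for x
  have zR: "generic zR" using r by (auto simp: generic_def cfgs_def zR_def onto_def)
  have "fibre zR = {zR} \<or> even (card (fibre zR))"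
    by (rule real_fibre_trivial_or_even[OF zR inf_rigid_transfer[OF gen[OF \<rho>1(1)] zR rig1]]) (simp add: zR_def)
  moreover have "card (fibre (?c \<rho>1)) = card (fibre zR)" by (rule card_fibre_eq[OF gen[OF \<rho>1(1)] zR rig1])
  ultimately have one: "card (fibre (?c \<rho>1)) = 1" using odd by auto
  have "gen_globally_rigid s d V E"
    unfolding gen_globally_rigid_def globally_rigid_def
  proof (intro allI impI)
    fix \<rho> \<sigma> assume \<rho>: "generic_fw V d \<rho>" and eq: "equivalent_fw s d E \<rho> \<sigma>"
    \<comment> \<open>The rigid subgraph enters here: it fixes the distances between pinned vertices
      that are not joined by edges.\<close>
    have "equivalent_fw s d E0 \<rho> \<sigma>" using eq assms(6) by (auto simp: equivalent_fw_def)
    then have cong: "congruent_fw s d V0 \<rho> \<sigma>"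
      using assms(8) generic_fw_subset[OF \<rho> finV assms(5)]
      by (auto simp: gen_globally_rigid_def globally_rigid_def)
    have "card (fibre (?c \<rho>)) = 1" using card_fibre_eq[OF gen[OF \<rho>1(1)] gen[OF \<rho>] rig1] one by simp
    moreover have "?c \<rho> \<in> fibre (?c \<rho>)" using cc by (intro fibreI) auto
    ultimately have fib: "fibre (?c \<rho>) = {?c \<rho>}" by (metis card_1_singletonE singletonD)
    have dist: "(\<Sum>i<d. (?c \<rho> (a, i) - ?c \<rho> (b, i))^2) = (\<Sum>i<d. (?c \<sigma> (a, i) - ?c \<sigma> (b, i))^2)"
      if "a \<in> B" "b \<in> B" for a b
    proof -
      have "a \<in> V" "b \<in> V" "a \<in> V0" "b \<in> V0" using that B assms(5) by auto
      then show ?thesis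
        using sqlen_complexify[OF assms(1), of a V b \<rho>] sqlen_complexify[OF assms(1), of a V b \<sigma>] cong
        by (simp add: congruent_fw_def)
    qed
    \<comment> \<open>The representative \<open>q\<close> is only known to be complex, which
      suffices because the singleton \<open>fib\<close> is the whole complex fibre.\<close>
    have "\<exists>q\<in>cfgs. (\<forall>x\<in>Bc. q x = ?c \<rho> x) \<and>
      (\<forall>u\<in>V. \<forall>v\<in>V. (\<Sum>i<d. (q (u, i) - q (v, i))^2) = (\<Sum>i<d. (?c \<sigma> (u, i) - ?c \<sigma> (v, i))^2))"
      by (rule pinned_representative[OF gen[OF \<rho>] B(2)]) (rule dist)
    then obtain q where q: "q \<in> cfgs" "\<forall>x\<in>Bc. q x = ?c \<rho> x"
      "\<forall>u\<in>V. \<forall>v\<in>V. (\<Sum>i<d. (q (u, i) - q (v, i))^2) = (\<Sum>i<d. (?c \<sigma> (u, i) - ?c \<sigma> (v, i))^2)"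
      by (elim bexE conjE)
    have "q \<in> fibre (?c \<rho>)"
    proof (rule fibreI[OF q(1) bspec[OF q(2)]])
      fix e assume e: "e \<in> E"
      have "len q e = (\<Sum>i<d. (?c \<sigma> (f e, i) - ?c \<sigma> (g e, i))^2)"
        using bspec[OF bspec[OF q(3) fg(2)[OF e]] fg(3)[OF e]] by (simp add: len_def bil_def power2_eq_square)
      also have "\<dots> = len (?c \<sigma>) e" by (simp add: len_def bil_def power2_eq_square)
      also have "\<dots> = len (?c \<rho>) e"
      proof -
        have "{f e, g e} \<in> E" using e by (subst (asm) fg(1)[OF e])
        then show ?thesis unfolding len[OF e] using eq[unfolded equivalent_fw_def, rule_format, of "f e" "g e"] by simp
      qed
      finally show "len q e = len (?c \<rho>) e" .
    qed
    then have "q = ?c \<rho>" unfolding fib by (rule singletonD)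
    note q' = q(3)[unfolded this]
    show "congruent_fw s d V \<rho> \<sigma>"
      by (rule congruent_of_complexify[OF assms(1)]) (rule bspec[OF bspec[OF q']])
  qed
  then show False using assms(3) by simp
qed

end
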